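(* Let $V\in W^{2,2}(B)$ be radially symmetric and let $k=\det\nabla^2 V$. Then $V$ is formally stationary for $\mathcal{W}_k$.
   Context: $B\subset\mathbb{R}^2$ is the open unit disk and $\nabla^2 V$ is the (weak) Hessian matrix of $V$. A function $V$ on $B$ is radially symmetric if $V(x)=v(|x|)$ for some function $v$ on $[0,1)$. For matrices, $A:C=\sum_{i,j}A_{ij}C_{ij}$ and $|A|^2=A:A$; $\operatorname{cof}A$ denotes the cofactor matrix of $A$, i.e. for a $2\times2$ matrix, $\operatorname{cof}\begin{pmatrix}a&b\\c&d\end{pmatrix}=\begin{pmatrix}d&-c\\-b&a\end{pmatrix}$. For $k=\det\nabla^2 U_0$ with some $U_0\in W^{2,2}(B)$, the functional $\mathcal{W}_k: W^{2,2}(B)\to[0,\infty]$ is defined by $\mathcal{W}_k(V)=\int_B|\nabla^2 V(x)|^2\,dx$ if $\det\nabla^2 V=k$ a.e. on $B$, and $\mathcal{W}_k(V)=+\infty$ otherwise. A function $V\in W^{2,2}(B)$ with $\det\nabla^2 V=k$ is called formally stationary for $\mathcal{W}_k$ if $$\int_B\nabla^2 V:\nabla^2 f=0\quad\text{for all } f\in W^{2,2}(B)\text{ with }\operatorname{cof}\nabla^2 V:\nabla^2 f=0\text{ a.e. in }B.$$ *)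

theory Defs
  imports "HOL-Analysis.Analysis"
begin

section \<open>Test functions\<close>

definition partial :: "'n \<Rightarrow> (real^'n \<Rightarrow> real) \<Rightarrow> real^'n \<Rightarrow> real" where
  "partial i f x = frechet_derivative f (at x) (axis i 1)"

primrec C_k :: "nat \<Rightarrow> (real^'n \<Rightarrow> real) \<Rightarrow> bool" where
  "C_k 0 f \<longleftrightarrow> continuous_on UNIV f"
| "C_k (Suc m) f \<longleftrightarrow> (\<forall>x. f differentiable (at x)) \<and> (\<forall>i. C_k m (partial i f))"

definition test_function :: "(real^'n) set \<Rightarrow> (real^'n \<Rightarrow> real) \<Rightarrow> bool" where
  "test_function \<Omega> \<phi> \<longleftrightarrow>
     (\<forall>m. C_k m \<phi>) \<and> compact (closure {x. \<phi> x \<noteq> 0}) \<and> closure {x. \<phi> x \<noteq> 0} \<subseteq> \<Omega>"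

section \<open>Weak derivatives and the Sobolev space of order two\<close>

text \<open>Elements of function spaces are represented by functions on the whole space, of which only
  the values at almost every point of \<open>\<Omega>\<close> matter.\<close>

definition locally_integrable :: "(real^'n) set \<Rightarrow> (real^'n \<Rightarrow> real) \<Rightarrow> bool" where
  "locally_integrable \<Omega> u \<longleftrightarrow> (\<forall>K. compact K \<and> K \<subseteq> \<Omega> \<longrightarrow> set_integrable lebesgue K u)"

definition L2 :: "(real^'n) set \<Rightarrow> (real^'n \<Rightarrow> real) set" where
  "L2 \<Omega> = {u. u \<in> borel_measurable (lebesgue_on \<Omega>) \<and> integrable (lebesgue_on \<Omega>) (\<lambda>x. (u x)\<^sup>2)}"

definition has_weak_gradient ::
  "(real^'n) set \<Rightarrow> (real^'n \<Rightarrow> real) \<Rightarrow> (real^'n \<Rightarrow> real^'n) \<Rightarrow> bool" where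
  "has_weak_gradient \<Omega> u G \<longleftrightarrow>
     locally_integrable \<Omega> u \<and> (\<forall>i. locally_integrable \<Omega> (\<lambda>x. G x $ i)) \<and>
     (\<forall>\<phi> i. test_function \<Omega> \<phi> \<longrightarrow>
        (\<integral>x. u x * partial i \<phi> x \<partial>lebesgue_on \<Omega>) = - (\<integral>x. G x $ i * \<phi> x \<partial>lebesgue_on \<Omega>))"

definition has_weak_hessian ::
  "(real^'n) set \<Rightarrow> (real^'n \<Rightarrow> real) \<Rightarrow> (real^'n \<Rightarrow> real^'n^'n) \<Rightarrow> bool" where
  "has_weak_hessian \<Omega> u H \<longleftrightarrow>
     locally_integrable \<Omega> u \<and> (\<forall>i j. locally_integrable \<Omega> (\<lambda>x. H x $ i $ j)) \<and>
     (\<forall>\<phi> i j. test_function \<Omega> \<phi> \<longrightarrow>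
        (\<integral>x. u x * partial i (partial j \<phi>) x \<partial>lebesgue_on \<Omega>) =
        (\<integral>x. H x $ i $ j * \<phi> x \<partial>lebesgue_on \<Omega>))"

definition W22 :: "(real^'n) set \<Rightarrow> (real^'n \<Rightarrow> real) set" where
  "W22 \<Omega> = {u. u \<in> L2 \<Omega> \<and>
     (\<exists>G. has_weak_gradient \<Omega> u G \<and> (\<forall>i. (\<lambda>x. G x $ i) \<in> L2 \<Omega>)) \<and>
     (\<exists>H. has_weak_hessian \<Omega> u H \<and> (\<forall>i j. (\<lambda>x. H x $ i $ j) \<in> L2 \<Omega>))}"

text \<open>The weak Hessian is unique up to null sets of an open \<open>\<Omega>\<close>; this picks a representative.\<close>

definition weak_hessian ::
  "(real^'n) set \<Rightarrow> (real^'n \<Rightarrow> real) \<Rightarrow> real^'n \<Rightarrow> real^'n^'n" where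
  "weak_hessian \<Omega> u = (SOME H. has_weak_hessian \<Omega> u H)"

section \<open>The functional and its formally stationary points\<close>

abbreviation B :: "(real^2) set" where
  "B \<equiv> ball 0 1"

abbreviation hess :: "(real^2 \<Rightarrow> real) \<Rightarrow> real^2 \<Rightarrow> real^2^2" where
  "hess \<equiv> weak_hessian B"

definition cof :: "real^2^2 \<Rightarrow> real^2^2" where
  "cof A = vector [vector [A $ 2 $ 2, - A $ 2 $ 1], vector [- A $ 1 $ 2, A $ 1 $ 1]]"

text \<open>The pairing \<open>A : C\<close> is the library's inner product on \<^typ>\<open>real^2^2\<close>.\<close>

lemma inner_matrix: "A \<bullet> C = (\<Sum>i\<in>UNIV. \<Sum>j\<in>UNIV. A $ i $ j * C $ i $ j)"
  for A C :: "real^2^2"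
  by (simp add: inner_vec_def)

definition radially_symmetric :: "(real^2 \<Rightarrow> real) \<Rightarrow> bool" where
  "radially_symmetric V \<longleftrightarrow> (\<exists>v. AE x in lebesgue_on B. V x = v (norm x))"

definition W_functional :: "(real^2 \<Rightarrow> real) \<Rightarrow> (real^2 \<Rightarrow> real) \<Rightarrow> ennreal" where
  "W_functional k V =
     (if AE x in lebesgue_on B. det (hess V x) = k x
      then \<integral>\<^sup>+ x. ennreal (hess V x \<bullet> hess V x) \<partial>lebesgue_on B
      else \<infinity>)"

text \<open>Stationarity for \<^term>\<open>W_functional k\<close> on \<^term>\<open>W22 B\<close>; the functional enters only through
  its constraint.\<close>

definition formally_stationary :: "(real^2 \<Rightarrow> real) \<Rightarrow> (real^2 \<Rightarrow> real) \<Rightarrow> bool" where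
  "formally_stationary k V \<longleftrightarrow>
     V \<in> W22 B \<and> (AE x in lebesgue_on B. det (hess V x) = k x) \<and>
     (\<forall>f \<in> W22 B. (AE x in lebesgue_on B. cof (hess V x) \<bullet> hess f x = 0) \<longrightarrow>
        (\<integral>x. hess V x \<bullet> hess f x \<partial>lebesgue_on B) = 0)"

end

theory Submission
  imports Defs
begin

text \<open>
  Write \<open>s = \<bar>x\<bar>\<^sup>2\<close>, let \<open>H\<close> and \<open>K\<close> be the Hessians of \<open>V\<close> and \<open>f\<close>, and let \<open>h\<close>, \<open>k\<close> be the integrals of
  their traces over circles, as functions of \<open>s\<close>, with primitives \<open>m\<close>, \<open>n\<close> vanishing at \<open>0\<close>. Testing with
  radial functions shows that the circle integrals of the tangential components \<open>x\<^sup>\<bottom> \<cdot> K x\<^sup>\<bottom>\<close> are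
  \<open>n / 2\<close> (and \<open>m / 2\<close> for \<open>H\<close>). Since \<open>V\<close> is invariant under rotations and reflections, \<open>H\<close> is diagonal
  in the frame \<open>x\<close>, \<open>x\<^sup>\<bottom>\<close> with radial entries, so averaging \<open>cof H : K = 0\<close> over circles gives
  \<open>m n' + m' n = m n / s\<close>. Hence \<open>m n = c s\<close>; square integrability of the Hessians makes \<open>m n / s\<^sup>2\<close>
  integrable, so \<open>c = 0\<close>, and then \<open>h k = m' n' = 0\<close> almost everywhere. Finally
  \<open>H : K = tr H tr K - cof H : K\<close>, whose integral is \<open>\<integral> h k / \<pi> = 0\<close>.
\<close>

section \<open>Smooth functions\<close>

text \<open>The constraint holds pointwise and \<open>f\<close> is not radial. The coefficients of
  \<open>H\<close> in the frame are radial, though, so on each circle the constraint sees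
  \<open>f\<close> only through two averages, and the tangential identity expresses both by
  \<open>n\<close>. Square integrability is decisive for \<open>c = 0\<close>: away from the origin
  the cone V = f = |x| satisfies the constraint, with m n = c s and c > 0, but its Hessian has the
  tangential entry 1/|x|, and the integral of 1/|x|^2 over the disk diverges logarithmically. The
  conclusion m n = 0 does not make either factor vanish identically, since they may live on disjoint
  sets of radii. Where m is nonzero, n = 0 and the equation leaves n' = 0; where m = 0, one has m' =
  0 almost everywhere, because the derivative of an absolutely continuous function vanishes almost
  everywhere on its zero set. All functions are given only up to null sets and derivatives are weak,
  so the identities come from test functions and Fubini; the profile of \<open>V\<close> is never
  differentiated.\<close>

lemma C_k_const: "C_k m (\<lambda>x. c)"
proof (induction m arbitrary: c)
  case (Suc m)
  have "partial i (\<lambda>x. c) = (\<lambda>x. 0)" for i :: 'a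
    unfolding partial_def by (rule ext) (simp add: frechet_derivative_const)
  with Suc show ?case by simp
qed simp

lemma partial_eqI: "(f has_derivative f') (at x) \<Longrightarrow> partial i f x = f' (axis i 1)"
  unfolding partial_def by (metis frechet_derivative_at)

lemma C_k_continuous: "C_k m f \<Longrightarrow> continuous_on UNIV f"
  by (cases m) (auto intro!: continuous_at_imp_continuous_on differentiable_imp_continuous_within)

lemma C_k_SucD: "C_k (Suc m) f \<Longrightarrow> C_k m f"
proof (induction m arbitrary: f)
  case 0
  then show ?case using C_k_continuous[of "Suc 0" f] by simp
qed auto

lemma partial_add:
  assumes "\<And>x. f differentiable (at x)" "\<And>x. g differentiable (at x)"
  shows "partial i (\<lambda>x. f x + g x) = (\<lambda>x. partial i f x + partial i g x)"
proof
  fix x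
  have "((\<lambda>x. f x + g x) has_derivative
      (\<lambda>h. frechet_derivative f (at x) h + frechet_derivative g (at x) h)) (at x)"
    using assms[of x] by (intro has_derivative_add) (simp_all add: frechet_derivative_works[symmetric])
  then show "partial i (\<lambda>x. f x + g x) x = partial i f x + partial i g x"
    by (subst partial_eqI) (auto simp: partial_def)
qed

lemma partial_mult:
  assumes "\<And>x. f differentiable (at x)" "\<And>x. g differentiable (at x)"
  shows "partial i (\<lambda>x. f x * g x) = (\<lambda>x. f x * partial i g x + partial i f x * g x)"
proof
  fix x
  have "((\<lambda>x. f x * g x) has_derivative
      (\<lambda>h. f x * frechet_derivative g (at x) h + frechet_derivative f (at x) h * g x)) (at x)"
    using assms[of x] by (intro has_derivative_mult) (simp_all add: frechet_derivative_works[symmetric])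
  then show "partial i (\<lambda>x. f x * g x) x = f x * partial i g x + partial i f x * g x"
    by (subst partial_eqI) (auto simp: partial_def)
qed

lemma C_k_add: "C_k m f \<Longrightarrow> C_k m g \<Longrightarrow> C_k m (\<lambda>x. f x + g x)"
proof (induction m arbitrary: f g)
  case 0
  then show ?case by (auto intro: continuous_on_add)
next
  case (Suc m)
  then show ?case by (auto simp: partial_add)
qed

lemma C_k_mult: "C_k m f \<Longrightarrow> C_k m g \<Longrightarrow> C_k m (\<lambda>x. f x * g x)"
proof (induction m arbitrary: f g)
  case 0
  then show ?case by (auto intro: continuous_on_mult)
next
  case (Suc m)
  then show ?case using C_k_SucD[of m f] C_k_SucD[of m g]
    by (auto simp: partial_mult intro!: C_k_add)
qed

lemma C_k_sum: "(\<And>i. i \<in> I \<Longrightarrow> C_k m (f i)) \<Longrightarrow> C_k m (\<lambda>x. \<Sum>i\<in>I. f i x)"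
  by (induction I rule: infinite_finite_induct) (auto intro: C_k_const C_k_add)

lemma C_k_prod: "(\<And>i. i \<in> I \<Longrightarrow> C_k m (f i)) \<Longrightarrow> C_k m (\<lambda>x. \<Prod>i\<in>I. f i x)"
  by (induction I rule: infinite_finite_induct) (auto intro: C_k_const C_k_mult)

lemma partial_nth: "partial i (\<lambda>x. x $ j) = (\<lambda>x. if i = j then 1 else 0)"
proof
  fix x :: "real^'a"
  have "((\<lambda>x. x $ j) has_derivative (\<lambda>h. h $ j)) (at x)"
    by (rule bounded_linear_imp_has_derivative) (rule bounded_linear_vec_nth)
  from partial_eqI[OF this] show "partial i (\<lambda>x. x $ j) x = (if i = j then 1 else 0)"
    by (simp add: axis_def)
qed

lemma C_k_nth: "C_k m (\<lambda>x. x $ j)"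
  by (cases m) (auto simp: partial_nth intro!: C_k_const continuous_intros
      bounded_linear_imp_differentiable bounded_linear_vec_nth)

section \<open>Smooth functions of one variable and their compositions\<close>

primrec smooth1 :: "nat \<Rightarrow> (real \<Rightarrow> real) \<Rightarrow> bool" where
  "smooth1 0 w \<longleftrightarrow> continuous_on UNIV w"
| "smooth1 (Suc m) w \<longleftrightarrow> (\<exists>w'. (\<forall>t. (w has_real_derivative w' t) (at t)) \<and> smooth1 m w')"

lemma smooth1_continuous: "smooth1 m w \<Longrightarrow> continuous_on UNIV w"
  by (cases m) (auto intro!: continuous_at_imp_continuous_on intro: DERIV_isCont)

lemma smooth1_SucD: "smooth1 (Suc m) f \<Longrightarrow> smooth1 m f"
proof (induction m arbitrary: f)
  case 0
  then show ?case using smooth1_continuous[of "Suc 0" f] by simp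
next
  case (Suc m)
  from Suc.prems obtain w' where "\<forall>t. (f has_real_derivative w' t) (at t)" "smooth1 (Suc m) w'"
    unfolding smooth1.simps(2)[of "Suc m"] by blast
  with Suc.IH show ?case by auto
qed

lemma smooth1_const: "smooth1 m (\<lambda>t. c)"
  by (induction m arbitrary: c) (auto intro!: exI[of _ "\<lambda>_. 0"])

lemma smooth1_add: "smooth1 m f \<Longrightarrow> smooth1 m g \<Longrightarrow> smooth1 m (\<lambda>t. f t + g t)"
proof (induction m arbitrary: f g)
  case 0
  then show ?case by (auto intro: continuous_on_add)
next
  case (Suc m)
  then obtain f' g' where "\<forall>t. (f has_real_derivative f' t) (at t)" "smooth1 m f'"
    "\<forall>t. (g has_real_derivative g' t) (at t)" "smooth1 m g'" by auto
  with Suc.IH show ?case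
    by (auto intro!: exI[of _ "\<lambda>t. f' t + g' t"] derivative_eq_intros)
qed

lemma smooth1_mult: "smooth1 m f \<Longrightarrow> smooth1 m g \<Longrightarrow> smooth1 m (\<lambda>t. f t * g t)"
proof (induction m arbitrary: f g)
  case 0
  then show ?case by (auto intro: continuous_on_mult)
next
  case (Suc m)
  then obtain f' g' where "\<forall>t. (f has_real_derivative f' t) (at t)" "smooth1 m f'"
    "\<forall>t. (g has_real_derivative g' t) (at t)" "smooth1 m g'" by auto
  with Suc.IH smooth1_SucD[OF Suc.prems(1)] smooth1_SucD[OF Suc.prems(2)] show ?case
    by (auto intro!: exI[of _ "\<lambda>t. f' t * g t + f t * g' t"] smooth1_add derivative_eq_intros)
qed

lemma smooth1_affine: "smooth1 m f \<Longrightarrow> smooth1 m (\<lambda>t. f (a * t + b))"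
proof (induction m arbitrary: f)
  case 0
  then show ?case
    by (auto intro!: continuous_intros continuous_on_compose2[of UNIV f])
next
  case (Suc m)
  then obtain f' where "\<forall>t. (f has_real_derivative f' t) (at t)" "smooth1 m f'" by auto
  with Suc.IH show ?case
    by (auto intro!: exI[of _ "\<lambda>t. f' (a * t + b) * a"] smooth1_mult smooth1_const
        DERIV_chain2[of f] derivative_eq_intros)
qed

lemma partial_compose:
  assumes "\<And>t. (w has_real_derivative w' t) (at t)" "\<And>x. p differentiable (at x)"
  shows "partial i (\<lambda>x. w (p x)) = (\<lambda>x. w' (p x) * partial i p x)"
proof
  fix x
  have "(p has_derivative frechet_derivative p (at x)) (at x)"
    using assms(2) by (simp add: frechet_derivative_works[symmetric])
  from has_derivative_compose[OF this assms(1)[unfolded has_field_derivative_def]]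
  show "partial i (\<lambda>x. w (p x)) x = w' (p x) * partial i p x"
    by (subst partial_eqI) (auto simp: partial_def)
qed

lemma C_k_compose: "smooth1 m w \<Longrightarrow> C_k m p \<Longrightarrow> C_k m (\<lambda>x. w (p x))"
proof (induction m arbitrary: w)
  case 0
  then show ?case by (auto intro: continuous_on_compose2)
next
  case (Suc m)
  then obtain w' where w': "\<And>t. (w has_real_derivative w' t) (at t)" "smooth1 m w'" by auto
  have "(\<lambda>x. w (p x)) differentiable (at x)" for x
  proof -
    have "(p has_derivative frechet_derivative p (at x)) (at x)"
      using Suc.prems(2) by (simp add: frechet_derivative_works[symmetric])
    from has_derivative_compose[OF this w'(1)[unfolded has_field_derivative_def]]
    show ?thesis by (rule differentiableI)
  qed
  moreover have "C_k m (\<lambda>x. w' (p x) * partial i p x)" for i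
    using Suc.prems(2) by (intro C_k_mult[OF Suc.IH[OF w'(2) C_k_SucD[OF Suc.prems(2)]]]) simp
  moreover have "partial i (\<lambda>x. w (p x)) = (\<lambda>x. w' (p x) * partial i p x)" for i
    using Suc.prems(2) by (intro partial_compose w') auto
  ultimately show ?case by simp
qed

lemma partial_linear:
  assumes "\<And>x. f differentiable (at x)" "linear R"
  shows "partial i (\<lambda>x. f (R x)) = (\<lambda>x. \<Sum>j\<in>UNIV. (R (axis i 1) $ j) * partial j f (R x))"
proof
  fix x
  let ?D = "frechet_derivative f (at (R x))"
  have D: "(f has_derivative ?D) (at (R x))"
    using assms(1) by (simp add: frechet_derivative_works[symmetric])
  have R: "(R has_derivative R) (at x)"
    using assms(2) by (simp add: linear_imp_has_derivative)
  have lin: "linear ?D" using D has_derivative_linear by blast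
  have "partial i (\<lambda>x. f (R x)) x = ?D (R (axis i 1))"
    using has_derivative_compose[OF R D] by (rule partial_eqI)
  also have "R (axis i 1) = (\<Sum>j\<in>UNIV. (R (axis i 1) $ j) *\<^sub>R axis j 1)"
    using basis_expansion[of "R (axis i 1)"] by (simp add: scalar_mult_eq_scaleR)
  also have "?D \<dots> = (\<Sum>j\<in>UNIV. (R (axis i 1) $ j) * ?D (axis j 1))"
    using lin by (simp add: linear_sum linear_scale)
  finally show "partial i (\<lambda>x. f (R x)) x = (\<Sum>j\<in>UNIV. (R (axis i 1) $ j) * partial j f (R x))"
    by (simp add: partial_def)
qed

lemma C_k_linear: "linear R \<Longrightarrow> C_k m f \<Longrightarrow> C_k m (\<lambda>x. f (R x))"
proof (induction m arbitrary: f)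
  case 0
  then show ?case
    by (auto intro: continuous_on_compose2 linear_continuous_on simp: linear_conv_bounded_linear)
next
  case (Suc m)
  have "(\<lambda>x. f (R x)) differentiable (at x)" for x
    using Suc.prems
    by (intro differentiable_compose[of f R]) (auto intro: linear_imp_differentiable)
  with Suc show ?case by (auto simp: partial_linear intro!: C_k_sum C_k_mult C_k_const)
qed

text \<open>The derivative of \<open>t\<^sup>-\<^sup>j exp (-1/t)\<close> is a combination of functions of the same family, which
  makes the standard cut-off function smooth.\<close>

definition flat :: "nat \<Rightarrow> real \<Rightarrow> real" where
  "flat j t = (if t > 0 then (1/t)^j * exp (-1/t) else 0)"

lemma flat_deriv: "(flat j has_real_derivative flat (j+2) t - real j * flat (j+1) t) (at t)"
proof -
  consider "t < 0" | "t = 0" | "t > 0" by linarith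
  then show ?thesis
  proof cases
    case 1
    have "((\<lambda>t. 0) has_real_derivative 0) (at t)" by simp
    then have "(flat j has_real_derivative 0) (at t)"
      by (rule has_field_derivative_transform_within_open[where S="{..<0}"]) (use 1 in \<open>auto simp: flat_def\<close>)
    with 1 show ?thesis by (simp add: flat_def)
  next
    case 3
    have "((\<lambda>t. (1/t)^j * exp (-1/t)) has_real_derivative
       (1/t)^j * (exp (-1/t) * (1/t^2)) + (real j * (1/t)^(j-1) * (-1/t^2)) * exp (-1/t)) (at t)"
      using 3 by (auto intro!: derivative_eq_intros simp: power2_eq_square)
    also have "(1/t)^j * (exp (-1/t) * (1/t^2)) + (real j * (1/t)^(j-1) * (-1/t^2)) * exp (-1/t)
      = flat (j+2) t - real j * flat (j+1) t"
      using 3 by (cases j) (auto simp: flat_def field_simps power2_eq_square)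
    finally show ?thesis
      by (rule has_field_derivative_transform_within_open[where S="{0<..}"]) (use 3 in \<open>auto simp: flat_def\<close>)
  next
    case 2
    \<comment> \<open>With z = 1/y this is the right difference quotient of \<open>flat j\<close> at
      0, so the limit is the decay of powers against the exponential.\<close>
    have "((\<lambda>z::real. z ^ (j+1) / exp z) \<longlongrightarrow> 0) at_top"
      by (rule tendsto_power_div_exp_0)
    then have "((\<lambda>y. inverse y ^ (j+1) / exp (inverse y)) \<longlongrightarrow> 0) (at_right (0::real))"
      using filterlim_compose filterlim_inverse_at_top_right by blast
    then have "((\<lambda>y. (flat j y - flat j 0) / (y - 0)) \<longlongrightarrow> 0) (at_right 0)"
      by (rule Lim_transform_eventually)
        (auto simp: flat_def eventually_at_right_field exp_minus field_simps inverse_eq_divide intro!: exI[of _ 1])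
    moreover have "((\<lambda>y. (flat j y - flat j 0) / (y - 0)) \<longlongrightarrow> 0) (at_left (0::real))"
      by (rule Lim_transform_eventually[OF tendsto_const])
        (auto simp: flat_def eventually_at_left_field intro!: exI[of _ "-1"])
    ultimately have "(flat j has_real_derivative 0) (at 0)"
      unfolding has_field_derivative_iff by (auto simp: filterlim_at_split)
    with 2 show ?thesis by (simp add: flat_def)
  qed
qed

lemma smooth1_flat: "smooth1 m (flat j)"
proof (induction m arbitrary: j)
  case 0
  show ?case by (auto intro!: continuous_at_imp_continuous_on DERIV_isCont flat_deriv)
next
  case (Suc m)
  have "smooth1 m (\<lambda>t. flat (j+2) t + (- real j) * flat (j+1) t)"
    by (intro smooth1_add smooth1_mult smooth1_const Suc)
  then show ?case
    using flat_deriv[of j] by (auto intro!: exI[of _ "\<lambda>t. flat (j+2) t - real j * flat (j+1) t"])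
qed

text \<open>The parameter \<open>n\<close> steepens the flanks while the support stays in [a, b].
  The values lie between 0 and 1 and tend to the indicator of the open interval, so dominated
  convergence passes from smooth test functions to intervals.\<close>

definition bump :: "nat \<Rightarrow> real \<Rightarrow> real \<Rightarrow> real \<Rightarrow> real" where
  "bump n a b t = flat 0 (real n * (t - a)) * flat 0 (real n * (b - t))"

lemma smooth1_bump: "smooth1 m (bump n a b)"
proof -
  have *: "real n * (t - a) = real n * t + (- real n * a)"
    "real n * (b - t) = (- real n) * t + real n * b" for t
    by (auto simp: algebra_simps)
  show ?thesis unfolding bump_def *
    by (intro smooth1_mult smooth1_affine[of m "flat 0"] smooth1_flat)
qed

lemma bump_bounds: "0 \<le> bump n a b t" "bump n a b t \<le> 1"
proof -
  have *: "0 \<le> flat 0 t" "flat 0 t \<le> 1" for t by (auto simp: flat_def)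
  show "0 \<le> bump n a b t" "bump n a b t \<le> 1"
    using * unfolding bump_def by (auto intro!: mult_le_one)
qed

lemma bump_outside: "t \<notin> {a<..<b} \<Longrightarrow> bump n a b t = 0"
  by (auto simp: bump_def flat_def not_less mult_le_0_iff zero_less_mult_iff)

lemma bump_tendsto: "(\<lambda>n. bump n a b t) \<longlonglongrightarrow> indicator {a<..<b} t"
proof (cases "t \<in> {a<..<b}")
  case False
  then show ?thesis by (simp add: bump_outside)
next
  case True
  have *: "(\<lambda>n. flat 0 (real n * c)) \<longlonglongrightarrow> 1" if "c > 0" for c
  proof -
    have "(\<lambda>n. - (inverse (real n)) * (1/c)) \<longlonglongrightarrow> -0 * (1/c)"
      by (intro tendsto_intros LIMSEQ_inverse_real_of_nat lim_inverse_n)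
    then have "(\<lambda>n. exp (- (inverse (real n)) * (1/c))) \<longlonglongrightarrow> exp (-0 * (1/c))"
      by (intro tendsto_exp)
    then have "(\<lambda>n. exp (- (inverse (real n)) * (1/c))) \<longlonglongrightarrow> 1" by simp
    then show ?thesis
      by (rule Lim_transform_eventually)
        (use that in \<open>auto simp: flat_def eventually_sequentially inverse_eq_divide intro!: exI[of _ 1]\<close>)
  qed
  have "(\<lambda>n. bump n a b t) \<longlonglongrightarrow> 1 * 1"
    unfolding bump_def using True by (intro tendsto_mult *) auto
  with True show ?thesis by simp
qed

section \<open>Uniqueness of weak Hessians\<close>

text \<open>Open boxes form an intersection-stable generator of the Borel sets, so the finite
  measures with the positive and the negative part of \<open>u\<close> as densities agree as soon as
  they agree on boxes.\<close>

lemma AE_zero_if_box_integrals_zero_borel: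
  fixes u :: "'a::euclidean_space \<Rightarrow> real"
  assumes u: "integrable lborel u"
    and zero: "\<And>a b. (\<integral>x. indicator (box a b) x * u x \<partial>lborel) = 0"
  shows "AE x in lborel. u x = 0"
proof -
  have [measurable]: "u \<in> borel_measurable borel" using u by auto
  \<comment> \<open>\<open>ennreal\<close> sends negative numbers to 0, so these densities are the
    positive and the negative part of \<open>u\<close>.\<close>
  let ?M = "density lborel (\<lambda>x. ennreal (u x))" and ?N = "density lborel (\<lambda>x. ennreal (- u x))"
  have fin: "(\<integral>\<^sup>+x. ennreal (u x) \<partial>lborel) < \<infinity>" "(\<integral>\<^sup>+x. ennreal (- u x) \<partial>lborel) < \<infinity>"
    using u by (auto simp: real_integrable_def less_top)
  have fin': "emeasure ?M X < \<infinity>" "emeasure ?N X < \<infinity>" if "X \<in> sets borel" for X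
  proof -
    have "emeasure ?M X \<le> (\<integral>\<^sup>+x. ennreal (u x) \<partial>lborel)" "emeasure ?N X \<le> (\<integral>\<^sup>+x. ennreal (- u x) \<partial>lborel)"
      using that by (auto simp: emeasure_density intro!: nn_integral_mono split: split_indicator)
    with fin show "emeasure ?M X < \<infinity>" "emeasure ?N X < \<infinity>" by auto
  qed
  have int: "(\<integral>x. indicator X x * u x \<partial>lborel) = enn2real (emeasure ?M X) - enn2real (emeasure ?N X)"
    if [measurable]: "X \<in> sets borel" for X
  proof -
    have "integrable lborel (\<lambda>x. indicator X x * u x)"
      using integrable_mult_indicator[of X lborel u] u by simp
    then have "(\<integral>x. indicator X x * u x \<partial>lborel) =
      enn2real (\<integral>\<^sup>+x. ennreal (indicator X x * u x) \<partial>lborel)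
      - enn2real (\<integral>\<^sup>+x. ennreal (- (indicator X x * u x)) \<partial>lborel)"
      by (rule real_lebesgue_integral_def)
    also have "(\<integral>\<^sup>+x. ennreal (indicator X x * u x) \<partial>lborel) = emeasure ?M X"
      using that by (auto simp: emeasure_density intro!: nn_integral_cong split: split_indicator)
    also have "(\<integral>\<^sup>+x. ennreal (- (indicator X x * u x)) \<partial>lborel) = emeasure ?N X"
      using that by (auto simp: emeasure_density intro!: nn_integral_cong split: split_indicator)
    finally show ?thesis .
  qed
  have "?M = ?N"
  proof (rule measure_eqI_generator_eq)
    let ?E = "range (\<lambda>(a, b). box a b::'a set)"
    show "Int_stable ?E"
      by (auto simp: Int_stable_def box_Int_box)
    show "?E \<subseteq> Pow UNIV" "sets ?M = sigma_sets UNIV ?E" "sets ?N = sigma_sets UNIV ?E"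
      by (simp_all add: borel_eq_box)
    let ?A = "\<lambda>n::nat. box (- (real n *\<^sub>R One)) (real n *\<^sub>R One) :: 'a set"
    show "range ?A \<subseteq> ?E" "(\<Union>i. ?A i) = UNIV"
      unfolding UN_box_eq_UNIV by auto
    show "emeasure ?M (?A i) \<noteq> \<infinity>" for i using fin'(1)[of "?A i"] by simp
    show "emeasure ?M X = emeasure ?N X" if "X \<in> ?E" for X
    proof -
      from that obtain a b where X: "X = box a b" by auto
      then have "enn2real (emeasure ?M X) = enn2real (emeasure ?N X)"
        using int[of X] zero[of a b] by simp
      moreover have "emeasure ?M X < \<infinity>" "emeasure ?N X < \<infinity>" using fin' X by auto
      ultimately show ?thesis
        by (metis ennreal_enn2real infinity_ennreal_def)
    qed
  qed
  have "AE x in lborel. u x = (\<lambda>_. 0) x"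
  proof (rule density_unique_real[OF u])
    fix A assume "A \<in> sets (lborel :: 'a measure)"
    then show "(\<integral>x\<in>A. u x \<partial>lborel) = (\<integral>x\<in>A. 0 \<partial>lborel)"
      using int[of A] \<open>?M = ?N\<close> by (simp add: set_lebesgue_integral_def)
  qed simp
  then show ?thesis by simp
qed

lemma AE_zero_if_box_integrals_zero:
  fixes u :: "'a::euclidean_space \<Rightarrow> real"
  assumes u: "integrable lebesgue u"
    and zero: "\<And>a b. (\<integral>x. indicator (box a b) x * u x \<partial>lebesgue) = 0"
  shows "AE x in lebesgue. u x = 0"
proof -
  have um: "u \<in> borel_measurable lebesgue" using u by auto
  then obtain v where v[measurable]: "v \<in> borel_measurable lborel" and uv: "AE x in lborel. u x = v x"
    using completion_ex_borel_measurable_real by blast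
  have uv': "AE x in lebesgue. u x = v x" using uv by (rule AE_completion)
  have vm: "v \<in> borel_measurable lebesgue" using v by (rule measurable_completion)
  have "integrable lebesgue v"
    using integrable_cong_AE[OF um vm uv'] u by simp
  then have "integrable lborel v" using integrable_completion[OF v] by simp
  moreover have "(\<integral>x. indicator (box a b) x * v x \<partial>lborel) = 0" for a b
  proof -
    have "(\<integral>x. indicator (box a b) x * v x \<partial>lborel) = (\<integral>x. indicator (box a b) x * v x \<partial>lebesgue)"
      by (rule integral_completion[symmetric]) measurable
    also have "\<dots> = (\<integral>x. indicator (box a b) x * u x \<partial>lebesgue)"
    proof (rule integral_cong_AE)
      have b: "(indicator (box a b) :: 'a \<Rightarrow> real) \<in> borel_measurable lebesgue"
        by (intro borel_measurable_indicator) (simp add: borel_open)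
      show "(\<lambda>x. indicator (box a b) x * v x) \<in> borel_measurable lebesgue"
        "(\<lambda>x. indicator (box a b) x * u x) \<in> borel_measurable lebesgue"
        using b vm um by (auto intro: borel_measurable_times)
      show "AE x in lebesgue. indicator (box a b) x * v x = indicator (box a b) x * u x"
        using uv' by eventually_elim simp
    qed
    finally show ?thesis using zero by simp
  qed
  ultimately have "AE x in lborel. v x = 0" by (rule AE_zero_if_box_integrals_zero_borel)
  then have "AE x in lebesgue. v x = 0" by (rule AE_completion)
  with uv' show ?thesis by eventually_elim simp
qed

text \<open>An open set is a countable union of closed boxes. Cutting \<open>u\<close> off to one of
  them reduces to the global case, because boxes intersect in boxes, and the boundary of a box is a
  null set.\<close>

lemma AE_zero_if_subbox_integrals_zero:
  fixes u :: "'a::euclidean_space \<Rightarrow> real"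
  assumes \<Omega>: "open \<Omega>"
    and int: "\<And>a b. cbox a b \<subseteq> \<Omega> \<Longrightarrow> integrable lebesgue (\<lambda>x. indicator (box a b) x * u x)"
    and zero: "\<And>a b. cbox a b \<subseteq> \<Omega> \<Longrightarrow> (\<integral>x. indicator (box a b) x * u x \<partial>lebesgue) = 0"
  shows "AE x in lebesgue. x \<in> \<Omega> \<longrightarrow> u x = 0"
proof -
  have box: "AE x in lebesgue. x \<in> cbox a b \<longrightarrow> u x = 0" if ab: "cbox a b \<subseteq> \<Omega>" for a b
  proof -
    have "AE x in lebesgue. indicator (box a b) x * u x = 0"
    proof (rule AE_zero_if_box_integrals_zero[OF int[OF ab]])
      fix c d :: 'a
      obtain c' d' where cd: "box c d \<inter> box a b = box c' d'" using box_Int_box by blast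
      show "(\<integral>x. indicator (box c d) x * (indicator (box a b) x * u x) \<partial>lebesgue) = 0"
      \<comment> \<open>An empty open box can have a nonempty closed box with the same corners,
        which need not lie in \<open>cbox a b\<close>; the closure argument therefore applies to
        nonempty boxes only.\<close>
      proof (cases "box c' d' = {}")
        case True
        then have "(\<lambda>x. indicator (box c d) x * (indicator (box a b) x * u x)) = (\<lambda>x. 0)"
          using cd by (auto simp: fun_eq_iff split: split_indicator)
        then show ?thesis by (simp only: integral_zero)
      next
        case False
        then have "cbox c' d' \<subseteq> cbox a b"
          using cd closure_box[OF False] by (metis closure_minimal closed_cbox box_subset_cbox inf.cobounded2 order_trans)
        then have "(\<integral>x. indicator (box c' d') x * u x \<partial>lebesgue) = 0" using ab zero by blast
        then show ?thesis
          unfolding cd[symmetric] by (simp add: indicator_inter_arith mult.assoc)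
      qed
    qed
    moreover have "AE x in lebesgue. x \<notin> cbox a b - box a b"
      by (metis negligible_frontier_interval negligible_iff_null_sets AE_not_in)
    ultimately show ?thesis by eventually_elim auto
  qed
  obtain D where D: "countable D" "D \<subseteq> Pow \<Omega>" "\<And>X. X \<in> D \<Longrightarrow> \<exists>a b. X = cbox a b" "\<Union>D = \<Omega>"
    using open_countable_Union_open_cbox[OF \<Omega>] by blast
  have "AE x in lebesgue. x \<in> X \<longrightarrow> u x = 0" if X: "X \<in> D" for X
    using D(2) D(3)[OF X] X box by blast
  then have "AE x in lebesgue. \<forall>X\<in>D. x \<in> X \<longrightarrow> u x = 0"
    by (subst AE_ball_countable[OF D(1)]) blast
  then show ?thesis by eventually_elim (use D(4) in auto)
qed

lemma test_functionI:
  assumes "\<And>m. C_k m \<phi>" "compact K" "K \<subseteq> \<Omega>" "\<And>x. x \<notin> K \<Longrightarrow> \<phi> x = 0"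
  shows "test_function \<Omega> \<phi>"
proof -
  have "closure {x. \<phi> x \<noteq> 0} \<subseteq> K"
    using assms by (intro closure_minimal compact_imp_closed) auto
  moreover from this have "compact (closure {x. \<phi> x \<noteq> 0})"
    using assms(2) by (meson bounded_subset closed_closure compact_eq_bounded_closed)
  ultimately show ?thesis using assms by (auto simp: test_function_def)
qed

text \<open>The fundamental lemma of the calculus of variations. Products of one-dimensional bumps
  in the coordinates converge to the indicator of an open box, dominated by \<open>u\<close> on the
  closed box, which is integrable by local integrability.\<close>

lemma weak_derivative_unique:
  fixes u :: "real^'n \<Rightarrow> real"
  assumes \<Omega>: "open \<Omega>" and u: "locally_integrable \<Omega> u"
    and zero: "\<And>\<phi>. test_function \<Omega> \<phi> \<Longrightarrow> (\<integral>x. u x * \<phi> x \<partial>lebesgue_on \<Omega>) = 0"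
  shows "AE x in lebesgue_on \<Omega>. u x = 0"
proof -
  have \<Omega>s: "\<Omega> \<in> sets lebesgue" using \<Omega> by (simp add: borel_open)
  have sets_box: "box a b \<in> sets lebesgue" for a b :: "real^'n" by (simp add: borel_open)
  have cint: "integrable lebesgue (\<lambda>x. indicator (cbox a b) x * u x)" if "cbox a b \<subseteq> \<Omega>" for a b
    using u that compact_cbox unfolding locally_integrable_def set_integrable_def by simp
  have int: "integrable lebesgue (\<lambda>x. indicator (box a b) x * u x)" if "cbox a b \<subseteq> \<Omega>" for a b
  proof -
    have "integrable lebesgue (\<lambda>x. indicator (box a b) x *\<^sub>R (indicator (cbox a b) x * u x))"
      by (rule integrable_mult_indicator[OF sets_box cint[OF that]])
    also have "(\<lambda>x. indicator (box a b) x *\<^sub>R (indicator (cbox a b) x * u x)) =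
       (\<lambda>x. indicator (box a b) x * u x)"
      using box_subset_cbox[of a b] by (auto simp: fun_eq_iff split: split_indicator)
    finally show ?thesis .
  qed
  have "AE x in lebesgue. x \<in> \<Omega> \<longrightarrow> u x = 0"
  proof (rule AE_zero_if_subbox_integrals_zero[OF \<Omega> int])
    fix a b :: "real^'n" assume ab: "cbox a b \<subseteq> \<Omega>"
    define \<phi> where "\<phi> n x = (\<Prod>i\<in>UNIV. bump n (a $ i) (b $ i) (x $ i))" for n and x :: "real^'n"
    have outside: "\<phi> n x = 0" if x: "x \<notin> cbox a b" for n x
    proof -
      from x obtain i where "\<not> (a $ i \<le> x $ i \<and> x $ i \<le> b $ i)"
        by (auto simp: mem_box_cart)
      then have "x $ i \<notin> {a $ i<..<b $ i}" by auto
      then show ?thesis unfolding \<phi>_def by (intro prod_zero bexI[of _ i] bump_outside) auto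
    qed
    have smooth: "C_k m (\<phi> n)" for m n
      unfolding \<phi>_def by (intro C_k_prod C_k_compose[OF smooth1_bump C_k_nth])
    have "test_function \<Omega> (\<phi> n)" for n
      using smooth compact_cbox ab outside by (rule test_functionI)
    then have z: "(\<integral>x. u x * \<phi> n x \<partial>lebesgue_on \<Omega>) = 0" for n by (rule zero)
    have eq: "(\<integral>x. u x * \<phi> n x \<partial>lebesgue_on \<Omega>) = (\<integral>x. (indicator (cbox a b) x * u x) * \<phi> n x \<partial>lebesgue)" for n
    proof -
      have "(\<integral>x. u x * \<phi> n x \<partial>lebesgue_on \<Omega>) = (\<integral>x. indicator \<Omega> x *\<^sub>R (u x * \<phi> n x) \<partial>lebesgue)"
        using \<Omega>s by (intro integral_restrict_space) simp
      also have "\<dots> = (\<integral>x. (indicator (cbox a b) x * u x) * \<phi> n x \<partial>lebesgue)"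
        using ab outside[of _ n] by (intro Bochner_Integration.integral_cong) (auto split: split_indicator)
      finally show ?thesis .
    qed
    have bound: "\<bar>\<phi> n x\<bar> \<le> 1" for n x
      unfolding \<phi>_def by (auto simp: abs_prod abs_of_nonneg bump_bounds intro!: prod_le_1)
    have lim: "(\<lambda>n. \<phi> n x) \<longlonglongrightarrow> indicator (box a b) x" for x
    proof -
      have "(\<lambda>n. \<phi> n x) \<longlonglongrightarrow> (\<Prod>i\<in>UNIV. indicator {a $ i<..<b $ i} (x $ i))"
        unfolding \<phi>_def by (intro tendsto_prod bump_tendsto)
      also have "(\<Prod>i\<in>UNIV. indicator {a $ i<..<b $ i} (x $ i)) = (indicator (box a b) x :: real)"
      proof (cases "x \<in> box a b")
        case True
        then show ?thesis by (auto simp: mem_box_cart indicator_def)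
      next
        case False
        then obtain i where "x $ i \<notin> {a $ i<..<b $ i}" by (auto simp: mem_box_cart)
        then have "(\<Prod>i\<in>UNIV. indicator {a $ i<..<b $ i} (x $ i)) = (0::real)"
          by (intro prod_zero bexI[of _ i]) auto
        with False show ?thesis by simp
      qed
      finally show ?thesis .
    qed
    have meas: "\<phi> n \<in> borel_measurable lebesgue" for n
      using borel_measurable_continuous_onI[OF C_k_continuous[OF smooth[of 0 n]]]
      by (simp add: measurable_completion)
    have cm: "(\<lambda>x. indicator (cbox a b) x * u x) \<in> borel_measurable lebesgue"
      using cint[OF ab] by auto
    have "(\<lambda>n. \<integral>x. (indicator (cbox a b) x * u x) * \<phi> n x \<partial>lebesgue) \<longlonglongrightarrow>
       (\<integral>x. (indicator (cbox a b) x * u x) * indicator (box a b) x \<partial>lebesgue)"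
    proof (rule integral_dominated_convergence[where w="\<lambda>x. \<bar>indicator (cbox a b) x * u x\<bar>"])
      show "AE x in lebesgue. (\<lambda>n. (indicator (cbox a b) x * u x) * \<phi> n x) \<longlonglongrightarrow>
         (indicator (cbox a b) x * u x) * indicator (box a b) x"
        by (intro AE_I2 tendsto_intros lim)
      show "AE x in lebesgue. norm ((indicator (cbox a b) x * u x) * \<phi> n x) \<le> \<bar>indicator (cbox a b) x * u x\<bar>" for n
        using bound by (intro AE_I2) (simp add: abs_mult mult_left_le)
      show "integrable lebesgue (\<lambda>x. \<bar>indicator (cbox a b) x * u x\<bar>)"
        using cint[OF ab] by (rule integrable_abs)
      show "(\<lambda>x. (indicator (cbox a b) x * u x) * \<phi> n x) \<in> borel_measurable lebesgue" for n
        using cm meas by (rule borel_measurable_times)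
      show "(\<lambda>x. (indicator (cbox a b) x * u x) * indicator (box a b) x) \<in> borel_measurable lebesgue"
        using cm borel_measurable_indicator[OF sets_box] by (rule borel_measurable_times)
    qed
    then have "(\<integral>x. (indicator (cbox a b) x * u x) * indicator (box a b) x \<partial>lebesgue) = 0"
      using z eq by (simp add: LIMSEQ_const_iff)
    also have "(\<lambda>x. (indicator (cbox a b) x * u x) * indicator (box a b) x) =
       (\<lambda>x. indicator (box a b) x * u x)"
      using box_subset_cbox[of a b] by (auto simp: fun_eq_iff split: split_indicator)
    finally show "(\<integral>x. indicator (box a b) x * u x \<partial>lebesgue) = 0" .
  qed
  then show ?thesis using \<Omega>s by (simp add: AE_restrict_space_iff)
qed

section \<open>Disintegration of the disk into circles\<close>

text \<open>Encoding the restriction as a density keeps the whole plane as space and the Borel sets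
  as sigma-algebra, so that rotations and product measures are handled by plain Borel
  measurability.\<close>

definition disk :: "(real^2) measure" where
  "disk = density lborel (\<lambda>x. ennreal (indicator B x))"

definition unit_interval :: "real measure" where
  "unit_interval = density lborel (\<lambda>s. ennreal (indicator {0<..<1} s))"

lemma sets_disk [simp, measurable_cong]: "sets disk = sets borel"
  by (simp add: disk_def)

lemma space_disk [simp]: "space disk = UNIV"
  by (simp add: disk_def)

lemma sets_unit_interval [simp, measurable_cong]: "sets unit_interval = sets borel"
  by (simp add: unit_interval_def)

lemma space_unit_interval [simp]: "space unit_interval = UNIV"
  by (simp add: unit_interval_def)

lemma B_borel [measurable]: "B \<in> sets borel"
  by (simp add: borel_open)

lemma AE_disk: "(AE x in disk. P x) \<longleftrightarrow> (AE x in lborel. x \<in> B \<longrightarrow> P x)"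
  unfolding disk_def by (subst AE_density) (auto simp: indicator_def)

lemma AE_unit_interval: "(AE s in unit_interval. P s) \<longleftrightarrow> (AE s in lborel. s \<in> {0<..<1} \<longrightarrow> P s)"
  unfolding unit_interval_def by (subst AE_density) (auto simp: indicator_def)

lemma AE_unit_intervalI: "AE s in unit_interval. 0 < s \<and> s < 1"
  by (simp add: AE_unit_interval)

lemma AE_disk_nonzero: "AE x in disk. x \<noteq> 0"
  unfolding AE_disk using AE_lborel_singleton[of 0] by eventually_elim simp

lemma nn_integral_disk:
  "h \<in> borel_measurable borel \<Longrightarrow> (\<integral>\<^sup>+x. h x \<partial>disk) = (\<integral>\<^sup>+x. h x * indicator B x \<partial>lborel)"
  unfolding disk_def by (subst nn_integral_density) (auto simp: ennreal_indicator mult.commute)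

lemma emeasure_disk_UNIV: "emeasure disk UNIV = ennreal pi"
proof -
  have "emeasure disk UNIV = emeasure lborel B"
    unfolding disk_def by (subst emeasure_density) (auto simp: ennreal_indicator)
  then show ?thesis by (simp add: emeasure_ball unit_ball_vol_2)
qed

lemma finite_measure_disk: "finite_measure disk"
  by (rule finite_measureI) (simp add: emeasure_disk_UNIV)

lemma measure_disk: "measure disk UNIV = pi"
  by (simp add: measure_def emeasure_disk_UNIV)

lemma emeasure_unit_interval_UNIV: "emeasure unit_interval UNIV = 1"
  unfolding unit_interval_def by (subst emeasure_density) (auto simp: ennreal_indicator)

lemma finite_measure_unit_interval: "finite_measure unit_interval"
  by (rule finite_measureI) (simp add: emeasure_unit_interval_UNIV)

interpretation disk: finite_measure disk by (rule finite_measure_disk)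
interpretation unit_interval: finite_measure unit_interval by (rule finite_measure_unit_interval)
interpretation interval_disk: pair_sigma_finite unit_interval disk ..
interpretation disk_disk: pair_sigma_finite disk disk ..
interpretation interval_interval: pair_sigma_finite unit_interval unit_interval ..

lemma borel_measurable_nth [measurable]: "(\<lambda>x. x $ i) \<in> borel_measurable (borel :: (real^'n) measure)"
  by (intro borel_measurable_continuous_onI continuous_intros)

section \<open>Invariance of the disk under orthogonal transformations\<close>

lemma emeasure_lborel_orthogonal_vimage:
  fixes f :: "real^'n::{finite,wellorder} \<Rightarrow> real^'n::_"
  assumes "orthogonal_transformation f"
  shows "emeasure lborel (f -` box a b) = emeasure lborel (box a b)"
proof -
  have inv: "orthogonal_transformation (inv f)" by (rule orthogonal_transformation_inv[OF assms])
  have eq: "f -` box a b = inv f ` box a b"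
    by (rule bij_vimage_eq_inv_image) (rule orthogonal_transformation_bij[OF assms])
  have box: "box a b \<in> lmeasurable" by simp
  have "f -` box a b \<in> sets borel"
    using measurable_sets_borel[of f borel "box a b"]
      borel_measurable_continuous_onI[OF linear_continuous_on[of f UNIV]]
      orthogonal_transformation_linear[OF assms]
    by (simp add: linear_conv_bounded_linear)
  then have "emeasure lborel (f -` box a b) = emeasure lebesgue (f -` box a b)" by simp
  also have "\<dots> = ennreal (measure lebesgue (inv f ` box a b))"
    unfolding eq using measurable_orthogonal_image[OF inv box] by (simp add: emeasure_eq_measure2)
  also have "\<dots> = emeasure lebesgue (box a b)"
    using measure_orthogonal_image[OF inv box] box by (simp add: emeasure_eq_measure2)
  finally show ?thesis by simp
qed

lemma orthogonal_measurable:
  "orthogonal_transformation f \<Longrightarrow> f \<in> borel_measurable (borel :: (real^'n) measure)"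
  using orthogonal_transformation_linear[of f]
  by (intro borel_measurable_continuous_onI linear_continuous_on) (simp add: linear_conv_bounded_linear)

lemma distr_lborel_orthogonal:
  fixes f :: "real^'n::{finite,wellorder} \<Rightarrow> real^'n::_"
  assumes f: "orthogonal_transformation f"
  shows "distr lborel borel f = lborel"
proof (rule lborel_eqI[symmetric])
  fix l u :: "real^'n::_" assume "\<And>b. b \<in> Basis \<Longrightarrow> l \<bullet> b \<le> u \<bullet> b"
  then show "emeasure (distr lborel borel f) (box l u) = (\<Prod>b\<in>Basis. (u - l) \<bullet> b)"
    using orthogonal_measurable[OF f]
    by (simp add: emeasure_distr emeasure_lborel_orthogonal_vimage[OF f] emeasure_lborel_box)
qed simp

lemma distr_disk_orthogonal:
  assumes f: "orthogonal_transformation f"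
  shows "distr disk borel f = disk"
proof (rule measure_eqI)
  note [measurable] = orthogonal_measurable[OF f]
  fix A assume "A \<in> sets (distr disk borel f)"
  then have [measurable]: "A \<in> sets borel" by simp
  have "emeasure (distr disk borel f) A = (\<integral>\<^sup>+x. indicator A x \<partial>distr disk borel f)"
    by simp
  also have "\<dots> = (\<integral>\<^sup>+x. indicator A (f x) \<partial>disk)"
    by (subst nn_integral_distr) auto
  also have "\<dots> = (\<integral>\<^sup>+x. indicator A (f x) * indicator B (f x) \<partial>lborel)"
    using orthogonal_transformation_norm[OF f]
    by (subst nn_integral_disk) (auto intro!: nn_integral_cong simp: indicator_def)
  also have "\<dots> = (\<integral>\<^sup>+x. indicator A x * indicator B x \<partial>distr lborel borel f)"
    by (subst nn_integral_distr) auto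
  also have "\<dots> = (\<integral>\<^sup>+x. indicator A x \<partial>disk)"
    unfolding distr_lborel_orthogonal[OF f] by (subst nn_integral_disk) auto
  also have "\<dots> = emeasure disk A" by simp
  finally show "emeasure (distr disk borel f) A = emeasure disk A" .
qed simp

lemma nn_integral_disk_orthogonal:
  assumes f: "orthogonal_transformation f" and [measurable]: "h \<in> borel_measurable borel"
  shows "(\<integral>\<^sup>+x. h (f x) \<partial>disk) = (\<integral>\<^sup>+x. h x \<partial>disk)"
proof -
  note [measurable] = orthogonal_measurable[OF f]
  have "(\<integral>\<^sup>+x. h (f x) \<partial>disk) = (\<integral>\<^sup>+x. h x \<partial>distr disk borel f)"
    by (subst nn_integral_distr) auto
  then show ?thesis by (simp add: distr_disk_orthogonal[OF f])
qed

lemma integral_disk_orthogonal: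
  fixes h :: "real^2 \<Rightarrow> real"
  assumes f: "orthogonal_transformation f" and [measurable]: "h \<in> borel_measurable borel"
  shows "(\<integral>x. h (f x) \<partial>disk) = (\<integral>x. h x \<partial>disk)"
proof -
  note [measurable] = orthogonal_measurable[OF f]
  have "(\<integral>x. h (f x) \<partial>disk) = (\<integral>x. h x \<partial>distr disk borel f)"
    by (subst integral_distr) auto
  then show ?thesis by (simp add: distr_disk_orthogonal[OF f])
qed

lemma AE_disk_orthogonal:
  assumes f: "orthogonal_transformation f" and ae: "AE x in disk. P x"
  shows "AE x in disk. P (f x)"
proof -
  note [measurable] = orthogonal_measurable[OF f]
  have "AE x in distr disk borel f. P x" using ae unfolding distr_disk_orthogonal[OF f] .
  then show ?thesis by (rule AE_distrD[rotated]) measurable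
qed

text \<open>The disk of radius \<open>sqrt a\<close> has area \<open>pi * a\<close>, so area has
  constant density in the squared radius. This is why circles are indexed by the squared radius: no
  Jacobian factor appears. Comparing the two measures on half-lines suffices.\<close>

lemma distr_disk_norm_squared:
  "distr disk borel (\<lambda>x. (norm x)\<^sup>2) = density unit_interval (\<lambda>_. ennreal pi)"
proof (rule measure_eqI_lessThan)
  have E: "emeasure (distr disk borel (\<lambda>x. (norm x)\<^sup>2)) {a<..} = emeasure lborel {x\<in>B. a < (norm x)\<^sup>2}" for a
  proof -
    have "emeasure (distr disk borel (\<lambda>x. (norm x)\<^sup>2)) {a<..} = emeasure disk {x. a < (norm x)\<^sup>2}"
      by (subst emeasure_distr) (auto simp: vimage_def)
    also have "\<dots> = emeasure lborel {x\<in>B. a < (norm x)\<^sup>2}"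
      unfolding disk_def by (subst emeasure_density)
        (auto simp: nn_integral_indicator[symmetric] ennreal_indicator indicator_def
          simp del: nn_integral_indicator intro!: nn_integral_cong)
    finally show ?thesis .
  qed
  have F: "emeasure (density unit_interval (\<lambda>_. ennreal pi)) {a<..} = ennreal pi * emeasure lborel ({0<..<1} \<inter> {a<..})" for a
  proof -
    have "emeasure (density unit_interval (\<lambda>_. ennreal pi)) {a<..} = ennreal pi * emeasure unit_interval {a<..}"
      by (subst emeasure_density) (auto simp: nn_integral_cmult)
    also have "emeasure unit_interval {a<..} = emeasure lborel ({0<..<1} \<inter> {a<..})"
      unfolding unit_interval_def by (subst emeasure_density)
        (auto simp: nn_integral_indicator[symmetric] ennreal_indicator indicator_def
          simp del: nn_integral_indicator intro!: nn_integral_cong)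
    finally show ?thesis .
  qed
  fix a :: real
  show "emeasure (distr disk borel (\<lambda>x. (norm x)\<^sup>2)) {a <..} < \<infinity>"
  proof -
    have "emeasure lborel {x\<in>B. a < (norm x)\<^sup>2} \<le> emeasure lborel B" by (rule emeasure_mono) auto
    then show ?thesis using E by (simp add: emeasure_ball le_less_trans)
  qed
  consider "a < 0" | "0 \<le> a" "a < 1" | "1 \<le> a" by linarith
  then show "emeasure (distr disk borel (\<lambda>x. (norm x)\<^sup>2)) {a<..} =
    emeasure (density unit_interval (\<lambda>_. ennreal pi)) {a<..}"
  proof cases
    case 1
    then have "{x\<in>B. a < (norm x)\<^sup>2} = B" by (auto intro: less_le_trans)
    moreover have "{0<..<1} \<inter> {a<..} = {0<..<1::real}" using 1 by auto
    ultimately show ?thesis unfolding E F by (simp add: emeasure_ball unit_ball_vol_2)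
  next
    case 2
    have "{x\<in>B. a < (norm x)\<^sup>2} = B - cball 0 (sqrt a)"
    proof -
      have "a < (norm x)\<^sup>2 \<longleftrightarrow> sqrt a < norm x" for x :: "real^2"
        using real_sqrt_less_iff[of a "(norm x)\<^sup>2"] by simp
      then have "{x\<in>B. a < (norm x)\<^sup>2} = {x\<in>B. sqrt a < norm x}" by (simp only:)
      then show ?thesis by (simp add: set_diff_eq not_le)
    qed
    moreover have "emeasure lborel (B - cball 0 (sqrt a)) = emeasure lborel B - emeasure lborel (cball 0 (sqrt a) :: (real^2) set)"
    proof (rule emeasure_Diff)
      have "sqrt a < 1" using 2 by simp
      then show "cball 0 (sqrt a) \<subseteq> B" by (force simp del: real_sqrt_lt_1_iff)
    qed (auto simp: emeasure_cball 2)
    moreover have "\<dots> = ennreal (pi - pi * a)"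
      using 2 by (simp add: emeasure_ball emeasure_cball unit_ball_vol_2 ennreal_minus)
    moreover have "{0<..<1} \<inter> {a<..} = {a<..<1}" using 2 by auto
    ultimately show ?thesis unfolding E F using 2
      by (simp add: ennreal_mult[symmetric] algebra_simps)
  next
    case 3
    have "(norm x)\<^sup>2 < a" if "x \<in> B" for x
      using that 3 abs_square_less_1[of "norm x"] by simp
    then have "{x\<in>B. a < (norm x)\<^sup>2} = {}" by (force simp: not_less)
    moreover have "{0<..<1} \<inter> {a<..} = {}" using 3 by auto
    ultimately show ?thesis unfolding E F by (simp only: emeasure_empty mult_zero_right)
  qed
qed auto

lemma nn_integral_disk_radial:
  assumes [measurable]: "h \<in> borel_measurable borel"
  shows "(\<integral>\<^sup>+x. h ((norm x)\<^sup>2) \<partial>disk) = ennreal pi * (\<integral>\<^sup>+s. h s \<partial>unit_interval)"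
proof -
  have "(\<integral>\<^sup>+x. h ((norm x)\<^sup>2) \<partial>disk) = (\<integral>\<^sup>+s. h s \<partial>distr disk borel (\<lambda>x. (norm x)\<^sup>2))"
    by (subst nn_integral_distr) auto
  then show ?thesis
    unfolding distr_disk_norm_squared by (simp add: nn_integral_density nn_integral_cmult)
qed

section \<open>Rotations and circles\<close>

definition perp :: "real^2 \<Rightarrow> real^2" where
  "perp x = vector [- x $ 2, x $ 1]"

lemma perp_nth [simp]: "perp x $ 1 = - x $ 2" "perp x $ 2 = x $ 1"
  by (simp_all add: perp_def)

lemma perp_measurable [measurable]: "perp \<in> borel_measurable borel"
proof -
  have "linear perp" by (rule linearI) (auto simp: vec_eq_iff forall_2)
  then show ?thesis
    by (intro borel_measurable_continuous_onI linear_continuous_on) (simp add: linear_conv_bounded_linear)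
qed

text \<open>The rotation that takes the first basis vector to \<open>z / \<bar>z\<bar>\<close>.\<close>

definition rot :: "real^2 \<Rightarrow> real^2 \<Rightarrow> real^2" where
  "rot z x = (1 / norm z) *\<^sub>R (x $ 1 *\<^sub>R z + x $ 2 *\<^sub>R perp z)"

text \<open>The point of the circle of radius \<open>\<surd>s\<close> in the direction of \<open>y\<close>. Integrating over \<open>y\<close> in the
  disk amounts to integrating over the angle, up to the factor 1/2.\<close>

definition on_circle :: "real \<Rightarrow> real^2 \<Rightarrow> real^2" where
  "on_circle s y = (sqrt s / norm y) *\<^sub>R y"

definition circle_integral :: "(real^2 \<Rightarrow> real) \<Rightarrow> real \<Rightarrow> real" where
  "circle_integral u s = (\<integral>y. u (on_circle s y) \<partial>disk)"

lemma rot_measurable [measurable]: "case_prod rot \<in> borel_measurable (borel \<Otimes>\<^sub>M borel)"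
  unfolding rot_def case_prod_beta by measurable

lemma on_circle_measurable [measurable]: "case_prod on_circle \<in> borel_measurable (borel \<Otimes>\<^sub>M borel)"
  unfolding on_circle_def case_prod_beta by measurable

lemma norm_2: "(norm x)\<^sup>2 = (x $ 1)\<^sup>2 + (x $ 2)\<^sup>2" for x :: "real^2"
  unfolding power2_norm_eq_inner by (simp add: inner_vec_def sum_2 power2_eq_square)

lemma orthogonal_rot: "z \<noteq> 0 \<Longrightarrow> orthogonal_transformation (rot z)"
proof -
  assume z: "z \<noteq> 0"
  have "linear (rot z)"
    by (rule linearI) (auto simp: rot_def algebra_simps)
  moreover have "rot z v \<bullet> rot z w = v \<bullet> w" for v w
  proof -
    define c where "c = 1 / norm z"
    have "rot z v \<bullet> rot z w = c\<^sup>2 * (((z $ 1)\<^sup>2 + (z $ 2)\<^sup>2) * (v \<bullet> w))"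
      unfolding rot_def c_def[symmetric]
      by (simp add: inner_vec_def sum_2 power2_eq_square algebra_simps)
    then show ?thesis using z by (simp add: norm_2[symmetric] power_divide c_def)
  qed
  ultimately show ?thesis by (simp add: orthogonal_transformation_def)
qed

lemma norm_on_circle: "y \<noteq> 0 \<Longrightarrow> 0 \<le> s \<Longrightarrow> (norm (on_circle s y))\<^sup>2 = s"
  by (simp add: on_circle_def power_divide power_mult_distrib)

text \<open>Rotating \<open>x\<close> by \<open>z\<close> or \<open>z\<close> by \<open>x\<close> gives the same direction: both are complex multiplication.\<close>

lemma rot_eq_on_circle: "x \<noteq> 0 \<Longrightarrow> z \<noteq> 0 \<Longrightarrow> rot z x = on_circle ((norm x)\<^sup>2) (rot x z)"
proof -
  assume "x \<noteq> 0" "z \<noteq> 0"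
  then have "norm (rot x z) = norm z"
    using orthogonal_transformation_norm[OF orthogonal_rot] by blast
  then show ?thesis using \<open>x \<noteq> 0\<close> \<open>z \<noteq> 0\<close>
    by (simp add: on_circle_def rot_def vec_eq_iff forall_2 algebra_simps)
qed

text \<open>Integrate \<open>h (rot z x)\<close> over both variables. For fixed \<open>z\<close> the
  invariance of the disk in \<open>x\<close> gives the integral of \<open>h\<close>. For fixed
  \<open>x\<close> the point is \<open>on_circle ((norm x)\<^sup>2) (rot x z)\<close>, and
  invariance in \<open>z\<close> gives the circle integral. Fubini equates the two results up to the
  same factor \<open>pi\<close>, which cancels.\<close>

lemma nn_integral_on_circle:
  assumes h[measurable]: "h \<in> borel_measurable borel"
  shows "(\<integral>\<^sup>+s. \<integral>\<^sup>+y. h (on_circle s y) \<partial>disk \<partial>unit_interval) = (\<integral>\<^sup>+x. h x \<partial>disk)"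
proof -
  let ?g = "\<lambda>s. \<integral>\<^sup>+y. h (on_circle s y) \<partial>disk"
  have [measurable]: "?g \<in> borel_measurable borel"
  proof -
    have "(\<lambda>s. \<integral>\<^sup>+y. h (case_prod on_circle (s, y)) \<partial>disk) \<in> borel_measurable borel"
      by measurable
    then show ?thesis by simp
  qed
  have "ennreal pi * (\<integral>\<^sup>+s. ?g s \<partial>unit_interval) = (\<integral>\<^sup>+x. ?g ((norm x)\<^sup>2) \<partial>disk)"
    by (rule nn_integral_disk_radial[symmetric]) measurable
  also have "\<dots> = (\<integral>\<^sup>+x. \<integral>\<^sup>+z. h (rot z x) \<partial>disk \<partial>disk)"
  proof (rule nn_integral_cong_AE)
    show "AE x in disk. ?g ((norm x)\<^sup>2) = (\<integral>\<^sup>+z. h (rot z x) \<partial>disk)"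
      using AE_disk_nonzero
    proof eventually_elim
      case (elim x)
      have [measurable]: "(\<lambda>y. on_circle ((norm x)\<^sup>2) y) \<in> borel_measurable borel"
        unfolding on_circle_def by measurable
      have "?g ((norm x)\<^sup>2) = (\<integral>\<^sup>+z. h (on_circle ((norm x)\<^sup>2) (rot x z)) \<partial>disk)"
        by (rule nn_integral_disk_orthogonal[OF orthogonal_rot[OF elim], symmetric]) measurable
      also have "\<dots> = (\<integral>\<^sup>+z. h (rot z x) \<partial>disk)"
      proof (rule nn_integral_cong_AE)
        show "AE z in disk. h (on_circle ((norm x)\<^sup>2) (rot x z)) = h (rot z x)"
          using AE_disk_nonzero by eventually_elim (metis rot_eq_on_circle[OF elim])
      qed
      finally show ?case .
    qed
  qed
  also have "\<dots> = (\<integral>\<^sup>+z. \<integral>\<^sup>+x. h (rot z x) \<partial>disk \<partial>disk)"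
  proof (rule disk_disk.Fubini')
    have "(\<lambda>p. h (case_prod rot p)) \<in> borel_measurable (borel \<Otimes>\<^sub>M borel)" by measurable
    then show "(\<lambda>(z, x). h (rot z x)) \<in> borel_measurable (disk \<Otimes>\<^sub>M disk)"
      by (simp add: case_prod_beta' cong: measurable_cong_sets)
  qed
  also have "\<dots> = (\<integral>\<^sup>+z. (\<integral>\<^sup>+x. h x \<partial>disk) \<partial>disk)"
  proof (rule nn_integral_cong_AE)
    show "AE z in disk. (\<integral>\<^sup>+x. h (rot z x) \<partial>disk) = (\<integral>\<^sup>+x. h x \<partial>disk)"
      using AE_disk_nonzero by eventually_elim (simp add: nn_integral_disk_orthogonal orthogonal_rot)
  qed
  also have "\<dots> = ennreal pi * (\<integral>\<^sup>+x. h x \<partial>disk)"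
    by (simp add: emeasure_disk_UNIV mult.commute)
  finally show ?thesis by (simp add: ennreal_mult_cancel_left)
qed

text \<open>As an image measure, the disintegration carries over integrability, integrals and null
  sets by the general rules for \<open>distr\<close> and product measures.\<close>

lemma distr_on_circle: "distr (unit_interval \<Otimes>\<^sub>M disk) borel (case_prod on_circle) = disk"
proof (rule measure_eqI)
  fix A assume "A \<in> sets (distr (unit_interval \<Otimes>\<^sub>M disk) borel (case_prod on_circle))"
  then have [measurable]: "A \<in> sets borel" by simp
  have "emeasure (distr (unit_interval \<Otimes>\<^sub>M disk) borel (case_prod on_circle)) A =
    (\<integral>\<^sup>+x. indicator A x \<partial>distr (unit_interval \<Otimes>\<^sub>M disk) borel (case_prod on_circle))"
    by simp
  also have "\<dots> = (\<integral>\<^sup>+p. indicator A (case_prod on_circle p) \<partial>(unit_interval \<Otimes>\<^sub>M disk))"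
    by (subst nn_integral_distr) measurable
  also have "\<dots> = (\<integral>\<^sup>+s. \<integral>\<^sup>+y. indicator A (on_circle s y) \<partial>disk \<partial>unit_interval)"
    by (subst disk.nn_integral_fst[symmetric]) auto
  also have "\<dots> = emeasure disk A"
    by (subst nn_integral_on_circle) auto
  finally show "emeasure (distr (unit_interval \<Otimes>\<^sub>M disk) borel (case_prod on_circle)) A = emeasure disk A" .
qed simp

section \<open>Fubini and null sets on circles\<close>

lemma integrable_on_circle:
  fixes u :: "real^2 \<Rightarrow> real"
  assumes "integrable disk u"
  shows "integrable (unit_interval \<Otimes>\<^sub>M disk) (\<lambda>p. u (case_prod on_circle p))"
proof -
  have "integrable (distr (unit_interval \<Otimes>\<^sub>M disk) borel (case_prod on_circle)) u"
    using assms by (simp add: distr_on_circle)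
  then show ?thesis
    by (intro integrable_distr[where T="case_prod on_circle" and M'=borel]) measurable
qed

lemma AE_integrable_on_circle:
  fixes u :: "real^2 \<Rightarrow> real"
  shows "integrable disk u \<Longrightarrow> AE s in unit_interval. integrable disk (\<lambda>y. u (on_circle s y))"
  using interval_disk.AE_integrable_fst'[OF integrable_on_circle, of u] by simp

lemma integrable_circle_integral:
  fixes u :: "real^2 \<Rightarrow> real"
  shows "integrable disk u \<Longrightarrow> integrable unit_interval (circle_integral u)"
  using interval_disk.integrable_fst'[OF integrable_on_circle, of u] by (simp add: circle_integral_def[abs_def])

lemma integral_circle_integral:
  fixes u :: "real^2 \<Rightarrow> real"
  assumes u: "integrable disk u"
  shows "(\<integral>s. circle_integral u s \<partial>unit_interval) = (\<integral>x. u x \<partial>disk)"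
proof -
  have [measurable]: "u \<in> borel_measurable borel" using borel_measurable_integrable[OF u] by simp
  have "(\<integral>s. circle_integral u s \<partial>unit_interval) = (\<integral>p. u (case_prod on_circle p) \<partial>(unit_interval \<Otimes>\<^sub>M disk))"
    using interval_disk.integral_fst'[OF integrable_on_circle[OF u]] by (simp add: circle_integral_def)
  also have "\<dots> = (\<integral>x. u x \<partial>distr (unit_interval \<Otimes>\<^sub>M disk) borel (case_prod on_circle))"
    by (subst integral_distr) auto
  finally show ?thesis by (simp add: distr_on_circle)
qed

lemma AE_on_circle:
  assumes "AE x in disk. P x"
  shows "AE s in unit_interval. AE y in disk. P (on_circle s y)"
proof -
  have "AE x in distr (unit_interval \<Otimes>\<^sub>M disk) borel (case_prod on_circle). P x"
    using assms unfolding distr_on_circle .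
  then have "AE p in unit_interval \<Otimes>\<^sub>M disk. P (case_prod on_circle p)"
    by (rule AE_distrD[rotated]) measurable
  from interval_disk.AE_pair[OF this] show ?thesis by simp
qed

lemma circle_integral_measurable [measurable]:
  assumes [measurable]: "u \<in> borel_measurable borel"
  shows "circle_integral u \<in> borel_measurable borel"
proof -
  have "(\<lambda>s. \<integral>y. u (case_prod on_circle (s, y)) \<partial>disk) \<in> borel_measurable borel"
    by measurable
  then show ?thesis by (simp add: circle_integral_def[abs_def])
qed

lemma on_circle_measurable' [measurable]: "on_circle s \<in> borel_measurable borel"
  unfolding on_circle_def by measurable

lemma AE_circle_eqI:
  assumes "0 \<le> s" and eq: "\<And>x. x \<noteq> 0 \<or> s = 0 \<Longrightarrow> (norm x)\<^sup>2 = s \<Longrightarrow> P x"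
  shows "AE y in disk. P (on_circle s y)"
  using AE_disk_nonzero
proof eventually_elim
  case (elim y)
  then show ?case using norm_on_circle[OF elim assms(1)] by (intro eq) auto
qed

lemma circle_integral_radial_mult:
  assumes [measurable]: "u \<in> borel_measurable borel" "g \<in> borel_measurable borel" and "0 \<le> s"
  shows "circle_integral (\<lambda>x. g ((norm x)\<^sup>2) * u x) s = g s * circle_integral u s"
proof -
  have "circle_integral (\<lambda>x. g ((norm x)\<^sup>2) * u x) s = (\<integral>y. g s * u (on_circle s y) \<partial>disk)"
    unfolding circle_integral_def
  proof (rule integral_cong_AE)
    show "AE y in disk. g ((norm (on_circle s y))\<^sup>2) * u (on_circle s y) = g s * u (on_circle s y)"
      by (rule AE_circle_eqI[OF \<open>0 \<le> s\<close>]) simp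
  qed measurable
  then show ?thesis by (simp add: circle_integral_def)
qed

text \<open>Averaging over all rotations \<open>rot z\<close> by Fubini shows that a function invariant under every
  single rotation up to null sets is a function of \<open>\<bar>x\<bar>\<close> almost everywhere.\<close>

lemma AE_radial_if_rotation_invariant:
  fixes u :: "real^2 \<Rightarrow> real"
  assumes [measurable]: "u \<in> borel_measurable borel"
    and inv: "\<And>z. z \<noteq> 0 \<Longrightarrow> AE x in disk. u (rot z x) = u x"
  shows "AE x in disk. u x = circle_integral u ((norm x)\<^sup>2) / pi"
proof -
  have "AE z in disk. AE x in disk. u (rot z x) = u x"
    using AE_disk_nonzero by eventually_elim (rule inv)
  moreover have "{p \<in> space (disk \<Otimes>\<^sub>M disk). u (rot (fst p) (snd p)) = u (snd p)} \<in> sets (disk \<Otimes>\<^sub>M disk)"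
  proof -
    have "Measurable.pred (disk \<Otimes>\<^sub>M disk) (\<lambda>p. u (case_prod rot p) = u (snd p))" by measurable
    then show ?thesis by (simp add: pred_def case_prod_beta')
  qed
  ultimately have "AE x in disk. AE z in disk. u (rot z x) = u x"
    using disk_disk.AE_commute[of "\<lambda>z x. u (rot z x) = u x"] by simp
  then show ?thesis using AE_disk_nonzero
  proof eventually_elim
    case (elim x)
    have [measurable]: "(\<lambda>z. rot z x) \<in> borel_measurable borel"
      unfolding rot_def by measurable
    have "circle_integral u ((norm x)\<^sup>2) = (\<integral>z. u (on_circle ((norm x)\<^sup>2) (rot x z)) \<partial>disk)"
      unfolding circle_integral_def
      by (rule integral_disk_orthogonal[OF orthogonal_rot[OF elim(2)], symmetric]) measurable
    also have "\<dots> = (\<integral>z. u x \<partial>disk)"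
    proof (rule integral_cong_AE)
      show "AE z in disk. u (on_circle ((norm x)\<^sup>2) (rot x z)) = u x"
        using elim(1) AE_disk_nonzero by eventually_elim (simp add: rot_eq_on_circle elim(2) flip: rot_eq_on_circle)
      have [measurable]: "rot x \<in> borel_measurable borel"
        by (rule orthogonal_measurable[OF orthogonal_rot[OF elim(2)]])
      show "(\<lambda>z. u (on_circle ((norm x)\<^sup>2) (rot x z))) \<in> borel_measurable disk" by measurable
    qed measurable
    also have "\<dots> = pi * u x" by (simp add: measure_disk)
    finally show ?case by simp
  qed
qed

section \<open>Primitives on the unit interval\<close>

lemma integrable_mult_bounded:
  fixes f g :: "'a \<Rightarrow> real"
  assumes f: "integrable M f" and g: "g \<in> borel_measurable M" and bound: "\<And>x. \<bar>g x\<bar> \<le> C"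
  shows "integrable M (\<lambda>x. f x * g x)"
proof (rule Bochner_Integration.integrable_bound[OF integrable_mult_left[OF integrable_abs[OF f], of C]])
  show "(\<lambda>x. f x * g x) \<in> borel_measurable M"
    using borel_measurable_integrable[OF f] g by (rule borel_measurable_times)
  have "norm (f x * g x) \<le> norm (\<bar>f x\<bar> * C)" for x
  proof -
    have "norm (f x * g x) = \<bar>f x\<bar> * \<bar>g x\<bar>" by (simp add: abs_mult)
    also have "\<dots> \<le> \<bar>f x\<bar> * C" using bound by (rule mult_left_mono) simp
    also have "\<dots> \<le> norm (\<bar>f x\<bar> * C)" by simp
    finally show ?thesis .
  qed
  then show "AE x in M. norm (f x * g x) \<le> norm (\<bar>f x\<bar> * C)" by simp
qed

text \<open>Integrating against \<open>unit_interval\<close> makes this meaningful for every real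
  \<open>s\<close>, constant to the left of 0 and to the right of 1, so that no range conditions
  have to be carried along.\<close>

definition primitive :: "(real \<Rightarrow> real) \<Rightarrow> real \<Rightarrow> real" where
  "primitive h s = (\<integral>t. indicator {..s} t * h t \<partial>unit_interval)"

lemma integrable_indicator_times:
  "integrable unit_interval h \<Longrightarrow> A \<in> sets borel \<Longrightarrow> integrable unit_interval (\<lambda>t. indicator A t * h t)"
  for h :: "real \<Rightarrow> real"
  using integrable_mult_indicator[of A unit_interval h] by simp

lemma primitive_add:
  "integrable unit_interval f \<Longrightarrow> integrable unit_interval g \<Longrightarrow>
    primitive (\<lambda>t. f t + g t) s = primitive f s + primitive g s"
  unfolding primitive_def distrib_left
  by (intro Bochner_Integration.integral_add integrable_indicator_times) auto

lemma primitive_cmult: "primitive (\<lambda>t. c * f t) s = c * primitive f s"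
  unfolding primitive_def by (simp add: mult.left_commute)

lemma primitive_bound:
  assumes h: "integrable unit_interval h"
  shows "\<bar>primitive h s\<bar> \<le> (\<integral>t. \<bar>h t\<bar> \<partial>unit_interval)"
proof -
  have "\<bar>primitive h s\<bar> \<le> (\<integral>t. \<bar>indicator {..s} t * h t\<bar> \<partial>unit_interval)"
    unfolding primitive_def by (rule integral_abs_bound)
  also have "\<dots> \<le> (\<integral>t. \<bar>h t\<bar> \<partial>unit_interval)"
    using h by (intro integral_mono integrable_abs integrable_indicator_times)
      (auto simp: indicator_def)
  finally show ?thesis .
qed

lemma AE_unit_interval_neq: "AE t in unit_interval. t \<noteq> (s :: real)"
  unfolding AE_unit_interval using AE_lborel_singleton[of s] by eventually_elim simp

lemma primitive_continuous:
  assumes h: "integrable unit_interval h"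
  shows "continuous_on UNIV (primitive h)"
proof (rule continuous_on_sequentiallyI)
  fix x :: "nat \<Rightarrow> real" and s assume x: "x \<longlonglongrightarrow> s"
  show "(\<lambda>n. primitive h (x n)) \<longlonglongrightarrow> primitive h s"
    unfolding primitive_def
  proof (rule integral_dominated_convergence[where w="\<lambda>t. \<bar>h t\<bar>"])
    show "AE t in unit_interval. (\<lambda>n. indicator {..x n} t * h t) \<longlonglongrightarrow> indicator {..s} t * h t"
      using AE_unit_interval_neq[of s]
    proof eventually_elim
      case (elim t)
      have "\<forall>\<^sub>F n in sequentially. indicator {..s} t * h t = indicator {..x n} t * h t"
      proof (cases "t < s")
        case True
        with x have "\<forall>\<^sub>F n in sequentially. t < x n" by (rule order_tendstoD)
        then show ?thesis by eventually_elim (use True in \<open>auto simp: indicator_def\<close>)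
      next
        case False
        with elim have "s < t" by simp
        with x have "\<forall>\<^sub>F n in sequentially. x n < t" by (rule order_tendstoD)
        then show ?thesis by eventually_elim (use \<open>s < t\<close> in \<open>auto simp: indicator_def\<close>)
      qed
      then show ?case by (rule Lim_transform_eventually[OF tendsto_const])
    qed
    show "integrable unit_interval (\<lambda>t. \<bar>h t\<bar>)" using h by (rule integrable_abs)
    show "AE t in unit_interval. norm (indicator {..x n} t * h t) \<le> \<bar>h t\<bar>" for n
      by (intro AE_I2) (auto simp: indicator_def)
  qed (use integrable_indicator_times[OF h] in auto)
qed

lemma primitive_measurable: "integrable unit_interval h \<Longrightarrow> primitive h \<in> borel_measurable borel"
  by (intro borel_measurable_continuous_onI primitive_continuous)

lemma primitive_0: "s \<le> 0 \<Longrightarrow> primitive h s = 0"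
proof -
  assume s: "s \<le> 0"
  have "AE t in unit_interval. indicator {..s} t * h t = 0"
    using AE_unit_intervalI by eventually_elim (use s in \<open>auto simp: indicator_def\<close>)
  then have "(\<integral>t. indicator {..s} t * h t \<partial>unit_interval) = 0"
    by (rule integral_eq_zero_AE)
  then show ?thesis by (simp add: primitive_def)
qed

lemma integrable_mult_primitive:
  assumes h: "integrable unit_interval h" and k: "integrable unit_interval k"
  shows "integrable unit_interval (\<lambda>t. h t * primitive k t)"
proof (rule integrable_mult_bounded[OF h])
  show "primitive k \<in> borel_measurable unit_interval"
    using primitive_measurable[OF k] by simp
  show "\<bar>primitive k t\<bar> \<le> (\<integral>t. \<bar>k t\<bar> \<partial>unit_interval)" for t
    by (rule primitive_bound[OF k])
qed

text \<open>Fubini on the two triangles \<open>r \<le> t\<close> and \<open>t < r\<close> of the square.\<close>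

lemma primitive_mult:
  assumes h: "integrable unit_interval h" and k: "integrable unit_interval k"
  shows "primitive h s * primitive k s = primitive (\<lambda>t. h t * primitive k t + primitive h t * k t) s"
proof -
  have hm[measurable]: "h \<in> borel_measurable borel" "k \<in> borel_measurable borel"
    using borel_measurable_integrable[OF h] borel_measurable_integrable[OF k] by simp_all
  let ?h = "\<lambda>t. indicator {..s} t * h t" and ?k = "\<lambda>t. indicator {..s} t * k t"
  have hi: "integrable unit_interval ?h" and ki: "integrable unit_interval ?k"
    using integrable_indicator_times h k by auto
  have prod: "integrable (unit_interval \<Otimes>\<^sub>M unit_interval) (\<lambda>(t, r). ?h t * ?k r)"
  proof (rule interval_interval.Fubini_integrable)
    show "integrable unit_interval (\<lambda>t. \<integral>r. norm (case (t, r) of (t, r) \<Rightarrow> ?h t * ?k r) \<partial>unit_interval)"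
    proof -
      have "(\<lambda>t. \<integral>r. norm (case (t, r) of (t, r) \<Rightarrow> ?h t * ?k r) \<partial>unit_interval)
        = (\<lambda>t. \<bar>?h t\<bar> * (\<integral>r. \<bar>?k r\<bar> \<partial>unit_interval))"
        by (simp only: prod.case real_norm_def abs_mult[of "?h _" "?k _"] integral_mult_right_zero)
      then show ?thesis using integrable_mult_left[OF integrable_abs[OF hi]] by simp
    qed
    show "AE t in unit_interval. integrable unit_interval (\<lambda>r. case (t, r) of (t, r) \<Rightarrow> ?h t * ?k r)"
      using ki by simp
  qed measurable
  have lower: "integrable (unit_interval \<Otimes>\<^sub>M unit_interval) (\<lambda>(t, r). if r \<le> t then ?h t * ?k r else 0)"
    by (rule Bochner_Integration.integrable_bound[OF prod]) (auto intro!: AE_I2)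
  have upper: "integrable (unit_interval \<Otimes>\<^sub>M unit_interval) (\<lambda>(t, r). if r \<le> t then 0 else ?h t * ?k r)"
    by (rule Bochner_Integration.integrable_bound[OF prod]) (auto intro!: AE_I2)
  have low: "(\<integral>r. (if r \<le> t then ?h t * ?k r else 0) \<partial>unit_interval) = indicator {..s} t * (h t * primitive k t)" for t
  proof -
    have "(\<integral>r. (if r \<le> t then ?h t * ?k r else 0) \<partial>unit_interval) =
       (\<integral>r. indicator {..s} t * h t * (indicator {..t} r * k r) \<partial>unit_interval)"
      by (intro Bochner_Integration.integral_cong) (auto simp: indicator_def)
    then show ?thesis by (simp add: primitive_def)
  qed
  have up: "(\<integral>t. (if r \<le> t then 0 else ?h t * ?k r) \<partial>unit_interval) = indicator {..s} r * (primitive h r * k r)" for r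
  proof -
    have "(\<integral>t. (if r \<le> t then 0 else ?h t * ?k r) \<partial>unit_interval) =
       (\<integral>t. indicator {..s} r * k r * (indicator {..r} t * h t) \<partial>unit_interval)"
    proof (rule integral_cong_AE)
      \<comment> \<open>The triangle excludes the diagonal while \<open>primitive h r\<close>
        includes the end point; the two differ in the single point \<open>t = r\<close>.\<close>
      show "AE t in unit_interval. (if r \<le> t then 0 else ?h t * ?k r) = indicator {..s} r * k r * (indicator {..r} t * h t)"
        using AE_unit_interval_neq[of r] by eventually_elim (auto simp: indicator_def)
    qed measurable
    then show ?thesis by (simp add: primitive_def)
  qed
  have "primitive h s * primitive k s = (\<integral>t. (\<integral>r. ?h t * ?k r \<partial>unit_interval) \<partial>unit_interval)"
    by (simp add: primitive_def)
  also have "\<dots> = (\<integral>p. (case p of (t, r) \<Rightarrow> ?h t * ?k r) \<partial>(unit_interval \<Otimes>\<^sub>M unit_interval))"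
    using interval_interval.integral_fst'[OF prod] by simp
  also have "\<dots> = (\<integral>p. (case p of (t, r) \<Rightarrow> if r \<le> t then ?h t * ?k r else 0)
      + (case p of (t, r) \<Rightarrow> if r \<le> t then 0 else ?h t * ?k r) \<partial>(unit_interval \<Otimes>\<^sub>M unit_interval))"
    by (intro Bochner_Integration.integral_cong) auto
  also have "\<dots> = (\<integral>p. (case p of (t, r) \<Rightarrow> if r \<le> t then ?h t * ?k r else 0) \<partial>(unit_interval \<Otimes>\<^sub>M unit_interval))
      + (\<integral>p. (case p of (t, r) \<Rightarrow> if r \<le> t then 0 else ?h t * ?k r) \<partial>(unit_interval \<Otimes>\<^sub>M unit_interval))"
    by (rule Bochner_Integration.integral_add[OF lower upper])
  also have "(\<integral>p. (case p of (t, r) \<Rightarrow> if r \<le> t then ?h t * ?k r else 0) \<partial>(unit_interval \<Otimes>\<^sub>M unit_interval))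
      = primitive (\<lambda>t. h t * primitive k t) s"
    using interval_interval.integral_fst'[OF lower] by (simp add: low) (simp add: primitive_def)
  also have "(\<integral>p. (case p of (t, r) \<Rightarrow> if r \<le> t then 0 else ?h t * ?k r) \<partial>(unit_interval \<Otimes>\<^sub>M unit_interval))
      = primitive (\<lambda>t. primitive h t * k t) s"
    using interval_interval.integral_snd[of "\<lambda>t r. if r \<le> t then 0 else ?h t * ?k r"] upper by (simp add: up) (simp add: primitive_def)
  finally show ?thesis
    using integrable_mult_primitive[OF h k] integrable_mult_primitive[OF k h]
    by (subst primitive_add) (auto simp: mult.commute)
qed

text \<open>Absolute continuity in integral form. The derivative is an explicit argument because it
  is determined only almost everywhere; the calculus rules become identities between
  integrals.\<close>

definition abs_cont :: "(real \<Rightarrow> real) \<Rightarrow> (real \<Rightarrow> real) \<Rightarrow> bool" where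
  "abs_cont F f \<longleftrightarrow> integrable unit_interval f \<and> (\<forall>s. F s = F 0 + primitive f s)"

lemma abs_cont_integrable: "abs_cont F f \<Longrightarrow> integrable unit_interval f"
  by (simp add: abs_cont_def)

lemma abs_cont_const: "abs_cont (\<lambda>s. c) (\<lambda>s. 0)"
  by (simp add: abs_cont_def primitive_def)

lemma abs_cont_primitive: "integrable unit_interval h \<Longrightarrow> abs_cont (primitive h) h"
  by (simp add: abs_cont_def primitive_0)

lemma abs_cont_mult:
  assumes F: "abs_cont F f" and G: "abs_cont G g"
  shows "abs_cont (\<lambda>s. F s * G s) (\<lambda>s. f s * G s + F s * g s)"
proof -
  have f: "integrable unit_interval f" and g: "integrable unit_interval g"
    using F G by (auto simp: abs_cont_def)
  define c d where "c = F 0" and "d = G 0"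
  have Fe: "F s = c + primitive f s" and Ge: "G s = d + primitive g s" for s
    using F G unfolding abs_cont_def c_def d_def by blast+
  have eq: "(\<lambda>s. f s * G s + F s * g s) =
    (\<lambda>s. d * f s + (c * g s + (f s * primitive g s + primitive f s * g s)))"
    unfolding Fe Ge by (auto simp: fun_eq_iff algebra_simps)
  have i: "integrable unit_interval (\<lambda>s. f s * primitive g s + primitive f s * g s)"
    using integrable_mult_primitive[OF f g] integrable_mult_primitive[OF g f] by (auto simp: mult.commute)
  have i1: "integrable unit_interval (\<lambda>s. c * g s)" using g by auto
  have i2: "integrable unit_interval (\<lambda>s. c * g s + (f s * primitive g s + primitive f s * g s))"
    using i1 i by (rule Bochner_Integration.integrable_add)
  have i3: "integrable unit_interval (\<lambda>s. d * f s)" using f by auto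
  have "F s * G s = F 0 * G 0 + primitive (\<lambda>s. f s * G s + F s * g s) s" for s
    unfolding eq primitive_add[OF i3 i2] primitive_add[OF i1 i] primitive_cmult
      primitive_mult[OF f g, symmetric] c_def[symmetric] d_def[symmetric] Fe[of s] Ge[of s]
    by (simp add: algebra_simps)
  moreover have "integrable unit_interval (\<lambda>s. f s * G s + F s * g s)"
    unfolding eq using i3 i2 by (rule Bochner_Integration.integrable_add)
  ultimately show ?thesis unfolding abs_cont_def by blast
qed

lemma abs_cont_power:
  assumes F: "abs_cont F f"
  shows "abs_cont (\<lambda>s. F s ^ n) (\<lambda>s. real n * F s ^ (n - 1) * f s)"
proof (induction n)
  case 0
  show ?case using abs_cont_const[of 1] by simp
next
  case (Suc n)
  have "(\<lambda>s. f s * F s ^ n + F s * (real n * F s ^ (n - 1) * f s)) =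
    (\<lambda>s. real (Suc n) * F s ^ (Suc n - 1) * f s)"
    by (cases n) (auto simp: fun_eq_iff algebra_simps)
  with abs_cont_mult[OF F Suc] show ?case by simp
qed

lemma abs_cont_diff:
  assumes F: "abs_cont F f" and G: "abs_cont G g"
  shows "abs_cont (\<lambda>s. F s - G s) (\<lambda>s. f s - g s)"
proof -
  have f: "integrable unit_interval f" and g: "integrable unit_interval g"
    using F G by (auto simp: abs_cont_def)
  have P: "primitive (\<lambda>s. f s - g s) s = primitive f s - primitive g s" for s
    using primitive_add[OF f, of "\<lambda>t. - 1 * g t" s] g primitive_cmult[of "-1" g s] by simp
  have "F s = F 0 + primitive f s" "G s = G 0 + primitive g s" for s
    using F G unfolding abs_cont_def by blast+
  then have "F s - G s = F 0 - G 0 + primitive (\<lambda>s. f s - g s) s" for s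
    unfolding P by (smt (verit))
  then show ?thesis
    using Bochner_Integration.integrable_diff[OF f g] unfolding abs_cont_def by blast
qed

lemma AE_zero_if_primitive_zero:
  assumes h: "integrable unit_interval h" and zero: "\<And>s. primitive h s = 0"
  shows "AE s in unit_interval. h s = 0"
proof -
  have hm[measurable]: "h \<in> borel_measurable borel" using borel_measurable_integrable[OF h] by simp
  let ?h = "\<lambda>t. indicator {0<..<1} t * h t"
  have conv: "(\<integral>t. f t \<partial>unit_interval) = (\<integral>t. indicator {0<..<1} t * f t \<partial>lborel)"
    if "f \<in> borel_measurable borel" for f :: "real \<Rightarrow> real"
    unfolding unit_interval_def using that by (subst integral_density) auto
  have int: "integrable lborel ?h"
    using h unfolding unit_interval_def by (subst (asm) integrable_density) auto
  have "AE t in lborel. ?h t = 0"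
  proof (rule AE_zero_if_box_integrals_zero_borel[OF int])
    fix a b :: real
    have ig: "integrable unit_interval (\<lambda>t. indicator {..c} t * h t)" for c
      using h by (intro integrable_indicator_times) auto
    have "(\<integral>t. indicator (box a b) t * ?h t \<partial>lborel) = (\<integral>t. indicator {0<..<1} t * (indicator (box a b) t * h t) \<partial>lborel)"
      by (simp add: mult.left_commute)
    also have "\<dots> = (\<integral>t. indicator (box a b) t * h t \<partial>unit_interval)"
      by (rule conv[symmetric]) measurable
    \<comment> \<open>The maximum makes the difference vanish when the interval is empty. For a < b
      the two integrands differ only at the point \<open>b\<close>.\<close>
    also have "\<dots> = (\<integral>t. indicator {..max a b} t * h t - indicator {..a} t * h t \<partial>unit_interval)"
    proof (rule integral_cong_AE)
      show "AE t in unit_interval. indicator (box a b) t * h t = indicator {..max a b} t * h t - indicator {..a} t * h t"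
        using AE_unit_interval_neq[of b] by eventually_elim (auto simp: indicator_def box_real)
    qed measurable
    also have "\<dots> = primitive h (max a b) - primitive h a"
      unfolding primitive_def by (rule Bochner_Integration.integral_diff[OF ig ig])
    finally show "(\<integral>t. indicator (box a b) t * ?h t \<partial>lborel) = 0" by (simp add: zero)
  qed
  then show ?thesis unfolding AE_unit_interval by eventually_elim (auto simp: indicator_def)
qed

text \<open>The geometric sum of the terms \<open>x * (1 - x) ^ i\<close> for
  \<open>i \<le> n\<close> telescopes to at most 1, and its last term is the smallest. The estimate
  bounds the derivatives of \<open>F * (1 - F\<^sup>2) ^ n\<close> uniformly in
  \<open>n\<close>.\<close>

lemma of_nat_mult_power_le_1:
  fixes x :: real
  assumes "0 \<le> x" "x \<le> 1"
  shows "real (Suc n) * (x * (1 - x) ^ n) \<le> 1"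
proof -
  have "real (Suc n) * (x * (1 - x) ^ n) = (\<Sum>i<Suc n. x * (1 - x) ^ n)" by simp
  also have "\<dots> \<le> (\<Sum>i<Suc n. x * (1 - x) ^ i)"
    using assms by (intro sum_mono mult_left_mono power_decreasing) auto
  also have "\<dots> = 1 - (1 - x) ^ Suc n"
    unfolding one_diff_power_eq by (simp add: sum_distrib_left del: sum.lessThan_Suc)
  also have "\<dots> \<le> 1" using assms by simp
  finally show ?thesis .
qed

text \<open>The derivatives of \<open>F (1 - F\<^sup>2)\<^sup>n\<close> stay bounded and tend to the derivative of \<open>F\<close> on the zero
  set of \<open>F\<close> and to 0 elsewhere, while the functions themselves tend to 0.\<close>

lemma AE_derivative_zero_on_zero_set:
  assumes F: "abs_cont F f" and F0: "F 0 = 0" and bound: "\<And>s. \<bar>F s\<bar> \<le> 1/2"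
  shows "AE s in unit_interval. F s = 0 \<longrightarrow> f s = 0"
proof -
  have f: "integrable unit_interval f" using F by (simp add: abs_cont_def)
  have F_eq: "F s = primitive f s" for s
    using F F0 unfolding abs_cont_def by (metis add_0)
  then have F_eq: "F = primitive f" by blast
  have [measurable]: "f \<in> borel_measurable borel" "F \<in> borel_measurable borel"
    using borel_measurable_integrable[OF f] primitive_measurable[OF f] by (simp_all add: F_eq)
  \<comment> \<open>The bound 1/2 on \<open>F\<close> keeps \<open>G\<close> between 3/4 and 1, with
    the value 1 exactly on the zero set of \<open>F\<close>; elsewhere its powers decay.\<close>
  define G where "G s = 1 - F s ^ 2" for s
  have G: "abs_cont G (\<lambda>s. - (2 * F s * f s))"
    using abs_cont_diff[OF abs_cont_const[of 1] abs_cont_power[OF F, of 2]] by (simp add: G_def[abs_def])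
  \<comment> \<open>By the product rule \<open>w n * f\<close> is the derivative of
    \<open>F * G ^ Suc n\<close>: the derivative of \<open>G\<close> is \<open>-2 * F * f\<close>,
    which supplies the factor \<open>F\<^sup>2\<close>.\<close>
  define w where "w n s = G s ^ Suc n - 2 * (real (Suc n) * (F s ^ 2 * G s ^ n))" for n s
  have [measurable]: "w n \<in> borel_measurable borel" for n
    unfolding w_def G_def by measurable
  have F2: "0 \<le> F s ^ 2" "F s ^ 2 \<le> 1/4" for s
    using power_mono[OF bound[of s], of 2] by (auto simp: power_divide)
  have G01: "0 \<le> G s" "G s \<le> 1" for s using F2[of s] by (auto simp: G_def)
  have "abs_cont (\<lambda>s. F s * G s ^ Suc n)
     (\<lambda>s. f s * G s ^ Suc n + F s * (real (Suc n) * G s ^ (Suc n - 1) * (- (2 * F s * f s))))" for n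
    by (rule abs_cont_mult[OF F abs_cont_power[OF G]])
  moreover have "(\<lambda>s. f s * G s ^ Suc n + F s * (real (Suc n) * G s ^ (Suc n - 1) * (- (2 * F s * f s))))
     = (\<lambda>s. w n s * f s)" for n
    by (auto simp: w_def fun_eq_iff algebra_simps power2_eq_square)
  ultimately have AC: "abs_cont (\<lambda>s. F s * G s ^ Suc n) (\<lambda>s. w n s * f s)" for n by simp
  have P: "primitive (\<lambda>s. w n s * f s) s = F s * G s ^ Suc n" for n s
  proof -
    have "F s * G s ^ Suc n = F 0 * G 0 ^ Suc n + primitive (\<lambda>s. w n s * f s) s"
      using AC[of n] unfolding abs_cont_def by blast
    then show ?thesis using F0 by simp
  qed
  \<comment> \<open>At most 1 from the power of \<open>G\<close> and twice 1 from the geometric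
    estimate with x = F^2.\<close>
  have wb: "\<bar>w n s\<bar> \<le> 3" for n s
  proof -
    have "\<bar>G s ^ Suc n\<bar> \<le> 1" using G01[of s] by (simp add: abs_of_nonneg mult_le_one power_le_one)
    moreover have "real (Suc n) * (F s ^ 2 * G s ^ n) \<le> 1"
      using of_nat_mult_power_le_1[of "F s ^ 2" n] F2[of s] by (simp add: G_def)
    moreover have "0 \<le> real (Suc n) * (F s ^ 2 * G s ^ n)" using G01 by simp
    ultimately show ?thesis unfolding w_def by linarith
  qed
  have wlim: "(\<lambda>n. w n s) \<longlonglongrightarrow> indicator {0} (F s)" for s
  proof (cases "F s = 0")
    case True
    then show ?thesis by (simp add: w_def G_def)
  next
    case False
    then have G1: "\<bar>G s\<bar> < 1" using F2[of s] by (auto simp: G_def abs_if)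
    have a: "(\<lambda>n. G s ^ n) \<longlonglongrightarrow> 0" using G1 by (intro LIMSEQ_power_zero) simp
    have b: "(\<lambda>n. real n * G s ^ n) \<longlonglongrightarrow> 0" using G1 powser_times_n_limit_0[of "G s"] by simp
    have "(\<lambda>n. G s * G s ^ n - 2 * F s ^ 2 * (real n * G s ^ n + G s ^ n)) \<longlonglongrightarrow> G s * 0 - 2 * F s ^ 2 * (0 + 0)"
      by (intro tendsto_intros a b)
    moreover have "w n s = G s * G s ^ n - 2 * F s ^ 2 * (real n * G s ^ n + G s ^ n)" for n
      by (simp add: w_def algebra_simps)
    ultimately show ?thesis using False by simp
  qed
  let ?g = "\<lambda>s. indicator {0} (F s) * f s"
  have gi: "integrable unit_interval ?g"
    by (rule Bochner_Integration.integrable_bound[OF f]) (auto simp: indicator_def)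
  have "primitive ?g s = 0" for s
  proof -
    have "(\<lambda>n. primitive (\<lambda>t. w n t * f t) s) \<longlonglongrightarrow> primitive ?g s"
      unfolding primitive_def
    proof (rule integral_dominated_convergence[where w="\<lambda>t. 3 * \<bar>f t\<bar>"])
      show "AE t in unit_interval. (\<lambda>n. indicator {..s} t * (w n t * f t)) \<longlonglongrightarrow> indicator {..s} t * ?g t"
        by (intro AE_I2 tendsto_intros wlim)
      show "AE t in unit_interval. norm (indicator {..s} t * (w n t * f t)) \<le> 3 * \<bar>f t\<bar>" for n
        using wb by (intro AE_I2) (auto simp: abs_mult indicator_def intro!: mult_right_mono)
      show "integrable unit_interval (\<lambda>t. 3 * \<bar>f t\<bar>)" using f by auto
    qed measurable
    moreover have "(\<lambda>n. primitive (\<lambda>t. w n t * f t) s) \<longlonglongrightarrow> 0"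
    proof (cases "F s = 0")
      case True
      then show ?thesis by (simp add: P)
    next
      case False
      then have "\<bar>G s\<bar> < 1" using F2[of s] by (auto simp: G_def abs_if)
      then have "(\<lambda>n. F s * G s ^ Suc n) \<longlonglongrightarrow> F s * 0"
        by (intro tendsto_intros LIMSEQ_Suc LIMSEQ_power_zero) simp
      then show ?thesis by (simp add: P)
    qed
    ultimately show ?thesis by (rule LIMSEQ_unique)
  qed
  from AE_zero_if_primitive_zero[OF gi this] show ?thesis
    by eventually_elim (auto simp: indicator_def)
qed

lemma AE_zero_on_zero_set_of_primitive:
  assumes h: "integrable unit_interval h"
  shows "AE s in unit_interval. primitive h s = 0 \<longrightarrow> h s = 0"
proof -
  \<comment> \<open>The primitive is at most the integral of \<open>\<bar>h\<bar>\<close>, so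
    division by \<open>K\<close> brings it below 1/2. The summand 1 keeps \<open>K\<close> positive
    when that integral is 0.\<close>
  define K where "K = 2 * (\<integral>t. \<bar>h t\<bar> \<partial>unit_interval) + 1"
  have K: "K > 0" unfolding K_def by (rule add_nonneg_pos) auto
  have eq: "primitive (\<lambda>t. 1 / K * h t) s = 1 / K * primitive h s" for s
    by (rule primitive_cmult)
  have "AE s in unit_interval. primitive (\<lambda>t. 1 / K * h t) s = 0 \<longrightarrow> 1 / K * h s = 0"
  proof (rule AE_derivative_zero_on_zero_set)
    show "abs_cont (primitive (\<lambda>t. 1 / K * h t)) (\<lambda>t. 1 / K * h t)"
      using h by (intro abs_cont_primitive) auto
    show "primitive (\<lambda>t. 1 / K * h t) 0 = 0" by (simp add: primitive_0)
    fix s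
    have "\<bar>primitive h s\<bar> \<le> K / 2" using primitive_bound[OF h, of s] by (simp add: K_def)
    then show "\<bar>primitive (\<lambda>t. 1 / K * h t) s\<bar> \<le> 1/2"
      unfolding eq using K by (simp add: abs_mult field_simps)
  qed
  then show ?thesis unfolding eq by eventually_elim (use K in auto)
qed

section \<open>Divergence at the origin and the equation for the product\<close>

lemma not_integrable_inverse_unit_interval: "\<not> integrable unit_interval (\<lambda>s. 1 / s)"
proof
  assume "integrable unit_interval (\<lambda>s. 1 / s)"
  then have int: "integrable lborel (\<lambda>s::real. indicator {0<..<1} s * (1 / s))"
    unfolding unit_interval_def by (subst (asm) integrable_density) auto
  define C where "C = (\<integral>s. indicator {0<..<1} s * (1 / s) \<partial>lborel :: real)"
  have bound: "ln (1/2) - ln e \<le> C" if e: "0 < e" "e < 1/2" for e :: real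
  proof -
    have "((\<lambda>s. 1 / s) has_integral (ln (1/2) - ln e)) {e..1/2}"
      using e by (intro fundamental_theorem_of_calculus)
        (auto intro!: derivative_eq_intros simp: has_real_derivative_iff_has_vector_derivative[symmetric])
    then have "ln (1/2) - ln e = integral {e..1/2} (\<lambda>s. 1 / s)"
      by (rule integral_unique[symmetric])
    also have "\<dots> = (LINT s:{e..1/2}|lborel. 1 / s)"
      using e by (intro set_borel_integral_eq_integral(2)[symmetric] borel_integrable_atLeastAtMost')
        (auto intro!: continuous_intros)
    also have "\<dots> \<le> C"
      unfolding C_def set_lebesgue_integral_def
    proof (rule integral_mono[OF _ int])
      have "set_integrable lborel {e..1/2} (\<lambda>s::real. 1 / s)"
        using e by (intro borel_integrable_atLeastAtMost') (auto intro!: continuous_intros)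
      then show "integrable lborel (\<lambda>s. indicator {e..1/2} s *\<^sub>R (1 / s))" by (simp add: set_integrable_def)
      show "indicator {e..1/2} s *\<^sub>R (1 / s) \<le> indicator {0<..<1} s * (1 / s)" for s :: real
        using e by (auto simp: indicator_def)
    qed
    finally show ?thesis .
  qed
  \<comment> \<open>Then \<open>ln (1/2) - ln e\<close> equals
    \<open>\<bar>C\<bar> + 2 - ln 2\<close>, which exceeds \<open>C\<close> because
    \<open>ln 2 \<le> 1\<close>; the 2 also ensures \<open>e < 1/2\<close>.\<close>
  define e where "e = exp (- \<bar>C\<bar> - 2)"
  have "e \<le> exp (-2)" by (simp add: e_def)
  also have "exp (-2) < (1/2 :: real)"
  proof -
    have "(2::real) < 1 + 2" by simp
    also have "\<dots> \<le> exp 2" by (rule exp_ge_add_one_self)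
    finally show ?thesis by (simp add: exp_minus field_simps)
  qed
  finally have "ln (1/2) - ln e \<le> C" by (intro bound) (auto simp: e_def)
  then have "\<bar>C\<bar> + 2 - ln 2 \<le> C" by (simp add: e_def ln_div)
  moreover have "ln 2 \<le> (1::real)" using ln_le_minus_one[of 2] by simp
  ultimately show False by linarith
qed

text \<open>The equation says that \<open>y = m n\<close> satisfies \<open>y' = y / s\<close>, so \<open>y = c s\<close>, and the integrability
  of \<open>y / s\<^sup>2\<close> forces \<open>c = 0\<close>.\<close>

lemma AE_mult_zero_if_product_ode:
  fixes h k :: "real \<Rightarrow> real"
  defines "m \<equiv> primitive h" and "n \<equiv> primitive k"
  assumes h: "integrable unit_interval h" and k: "integrable unit_interval k"
    and ode: "AE s in unit_interval. m s * k s + h s * n s = m s * n s / s"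
    and int: "integrable unit_interval (\<lambda>s. m s * n s / s\<^sup>2)"
  shows "AE s in unit_interval. h s * k s = 0"
proof -
  define y where "y s = m s * n s" for s
  define g where "g s = h s * n s + m s * k s" for s
  have AC: "abs_cont y g"
    using abs_cont_mult[OF abs_cont_primitive[OF h] abs_cont_primitive[OF k]]
    unfolding y_def g_def m_def n_def .
  have gi: "integrable unit_interval g" using AC by (simp add: abs_cont_def)
  have [measurable]: "g \<in> borel_measurable borel" using borel_measurable_integrable[OF gi] by simp
  have cont: "continuous_on UNIV y"
    unfolding y_def m_def n_def by (intro continuous_intros primitive_continuous h k)
  then have [measurable]: "y \<in> borel_measurable borel" by (rule borel_measurable_continuous_onI)
  have gy: "AE s in unit_interval. g s = y s / s"
    using ode by eventually_elim (simp add: g_def y_def)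
  \<comment> \<open>The equation is known only almost everywhere. Its integrated form has the
    continuous integrand \<open>y s / s\<close>, so the fundamental theorem then yields a derivative
    at every point of the open interval.\<close>
  have diff: "y b - y a = integral {a..b} (\<lambda>s. y s / s)" if ab: "0 < a" "a \<le> b" "b < 1" for a b
  proof -
    have ig: "integrable unit_interval (\<lambda>t. indicator {..c} t * g t)" for c
      using gi by (intro integrable_indicator_times) auto
    have "y b = y 0 + primitive g b" "y a = y 0 + primitive g a"
      using AC unfolding abs_cont_def by blast+
    then have "y b - y a = primitive g b - primitive g a" by simp
    also have "\<dots> = (\<integral>t. indicator {..b} t * g t - indicator {..a} t * g t \<partial>unit_interval)"
      unfolding primitive_def by (rule Bochner_Integration.integral_diff[OF ig ig, symmetric])
    also have "\<dots> = (\<integral>t. indicator {a..b} t * (y t / t) \<partial>unit_interval)"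
    proof (rule integral_cong_AE)
      show "AE t in unit_interval. indicator {..b} t * g t - indicator {..a} t * g t = indicator {a..b} t * (y t / t)"
        using AE_unit_interval_neq[of a] gy by eventually_elim (use ab in \<open>auto simp: indicator_def\<close>)
    qed measurable
    also have "\<dots> = (\<integral>t. indicator {0<..<1} t * (indicator {a..b} t * (y t / t)) \<partial>lborel)"
      unfolding unit_interval_def by (subst integral_density) auto
    also have "\<dots> = (LINT t:{a..b}|lborel. y t / t)"
      unfolding set_lebesgue_integral_def
      using ab by (intro Bochner_Integration.integral_cong) (auto simp: indicator_def)
    also have "\<dots> = integral {a..b} (\<lambda>s. y s / s)"
      using ab by (intro set_borel_integral_eq_integral(2) borel_integrable_atLeastAtMost')
        (auto intro!: continuous_intros continuous_on_subset[OF cont])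
    finally show ?thesis .
  qed
  have deriv: "(y has_real_derivative y s / s) (at s)" if s: "0 < s" "s < 1" for s
  proof -
    \<comment> \<open>The midpoints towards 0 and 1 enclose \<open>s\<close> in a compact interval
      on which \<open>y s / s\<close> is continuous.\<close>
    define a b where "a = s / 2" and "b = (1 + s) / 2"
    have ab: "0 < a" "a < s" "s < b" "b < 1" using s by (auto simp: a_def b_def)
    have "((\<lambda>u. integral {a..u} (\<lambda>s. y s / s)) has_real_derivative y s / s) (at s within {a..b})"
      using ab by (intro integral_has_real_derivative)
        (auto intro!: continuous_intros continuous_on_subset[OF cont])
    then have "((\<lambda>u. y a + integral {a..u} (\<lambda>s. y s / s)) has_real_derivative y s / s) (at s within {a..b})"
      by (auto intro!: derivative_eq_intros)
    then have "(y has_real_derivative y s / s) (at s within {a..b})"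
      by (rule has_field_derivative_transform_within[where d=1])
        (use ab in \<open>auto simp: diff[symmetric]\<close>)
    moreover have "at s within {a..b} = at s"
      using ab by (intro at_within_interior) auto
    ultimately show ?thesis by simp
  qed
  define c where "c = y (1/2) / (1/2)"
  have yc: "y s = c * s" if s: "s \<in> {0<..<1}" for s
  proof -
    have "((\<lambda>s. y s / s) has_real_derivative 0) (at s)" if "s \<in> {0<..<1}" for s
      using that by (auto intro!: derivative_eq_intros deriv simp: field_simps)
    then have "((\<lambda>s. y s / s) has_real_derivative 0) (at s within {0<..<1})" if "s \<in> {0<..<1}" for s
      using that by (blast intro: has_field_derivative_at_within)
    from has_field_derivative_zero_constant[OF convex_real_interval(8) this]
    obtain d where d: "\<And>s. s \<in> {0<..<1} \<Longrightarrow> y s / s = d" by blast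
    have "y s / s = c" using d[OF s] d[of "1/2"] by (simp add: c_def)
    then show ?thesis using s by (simp add: field_simps)
  qed
  have "c = 0"
  proof (rule ccontr)
    assume c: "c \<noteq> 0"
    have "AE s in unit_interval. m s * n s / s\<^sup>2 = c * (1 / s)"
      using AE_unit_intervalI
    proof eventually_elim
      case (elim s)
      then have "m s * n s = c * s" using yc[of s] by (simp add: y_def)
      then show ?case using elim by (simp add: power2_eq_square)
    qed
    then have "integrable unit_interval (\<lambda>s. c * (1 / s))"
      by (intro integrable_cong_AE_imp[OF int]) auto
    then have "integrable unit_interval (\<lambda>s. 1 / c * (c * (1 / s)))" by (rule integrable_mult_right)
    with c not_integrable_inverse_unit_interval show False by simp
  qed
  have "AE s in unit_interval. y s = 0"
    using AE_unit_intervalI by eventually_elim (simp add: yc \<open>c = 0\<close>)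
  \<comment> \<open>If \<open>m s = 0\<close>, then \<open>h s = 0\<close> outside a null set.
    Otherwise \<open>n s = 0\<close>, and the equation reduces to \<open>m s * k s = 0\<close>, so
    \<open>k s = 0\<close>.\<close>
  then show ?thesis
    using ode AE_zero_on_zero_set_of_primitive[OF h]
  proof eventually_elim
    case (elim s)
    then have "m s * n s = 0" "m s * k s + h s * n s = 0" by (auto simp: y_def)
    then show ?case using elim(3) by (auto simp: m_def)
  qed
qed

section \<open>Borel representatives of weak Hessians\<close>

lemma AE_lebesgue_on_B: "(AE x in lebesgue_on B. P x) \<longleftrightarrow> (AE x in disk. P x)"
  by (simp add: AE_restrict_space_iff AE_disk AE_completion_iff)

lemma integrable_lebesgue_on_B:
  fixes g :: "real^2 \<Rightarrow> real"
  assumes [measurable]: "g \<in> borel_measurable borel"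
  shows "integrable (lebesgue_on B) g \<longleftrightarrow> integrable disk g"
proof -
  have "integrable (lebesgue_on B) g \<longleftrightarrow> integrable lebesgue (\<lambda>x. indicator B x *\<^sub>R g x)"
    by (rule integrable_restrict_space) simp
  also have "\<dots> \<longleftrightarrow> integrable lborel (\<lambda>x. indicator B x *\<^sub>R g x)"
    by (rule integrable_completion) measurable
  also have "\<dots> \<longleftrightarrow> integrable disk g"
    unfolding disk_def by (subst integrable_density) auto
  finally show ?thesis .
qed

lemma integral_lebesgue_on_B:
  fixes g :: "real^2 \<Rightarrow> real"
  assumes [measurable]: "g \<in> borel_measurable borel"
  shows "(\<integral>x. g x \<partial>lebesgue_on B) = (\<integral>x. g x \<partial>disk)"
proof -
  have "(\<integral>x. g x \<partial>lebesgue_on B) = (\<integral>x. indicator B x *\<^sub>R g x \<partial>lebesgue)"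
    by (rule integral_restrict_space) simp
  also have "\<dots> = (\<integral>x. indicator B x *\<^sub>R g x \<partial>lborel)"
    by (rule integral_completion) measurable
  also have "\<dots> = (\<integral>x. g x \<partial>disk)"
    unfolding disk_def by (subst integral_density) auto
  finally show ?thesis .
qed

lemma borel_imp_measurable_on_B:
  fixes g :: "real^2 \<Rightarrow> real"
  shows "g \<in> borel_measurable borel \<Longrightarrow> g \<in> borel_measurable (lebesgue_on B)"
  by (intro measurable_restrict_space1 measurable_completion) simp

lemma ex_borel_representative:
  fixes g :: "real^2 \<Rightarrow> real"
  assumes g: "g \<in> borel_measurable (lebesgue_on B)"
  shows "\<exists>g'. g' \<in> borel_measurable borel \<and> (AE x in lebesgue_on B. g x = g' x)"
proof -
  have "(\<lambda>x. indicator B x *\<^sub>R g x) \<in> borel_measurable lebesgue"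
    using g by (subst (asm) borel_measurable_restrict_space_iff) auto
  from completion_ex_borel_measurable_real[OF this]
  obtain g' where g': "g' \<in> borel_measurable lborel" "AE x in lborel. indicator B x *\<^sub>R g x = g' x" by blast
  have "AE x in disk. g x = g' x"
    unfolding AE_disk using g'(2) by eventually_elim (auto simp: indicator_def)
  with g'(1) show ?thesis by (auto simp: AE_lebesgue_on_B)
qed

section \<open>Test functions and uniqueness of the weak Hessian\<close>

lemma test_function_bounded:
  assumes "test_function \<Omega> \<phi>"
  obtains M where "\<And>x. \<bar>\<phi> x\<bar> \<le> M" "0 \<le> M"
proof -
  let ?C = "closure {x. \<phi> x \<noteq> 0}"
  have "continuous_on UNIV \<phi>" "compact ?C"
    using assms C_k_continuous by (auto simp: test_function_def)
  then have "bounded (\<phi> ` ?C)"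
    by (intro compact_imp_bounded compact_continuous_image) (auto intro: continuous_on_subset)
  then obtain M where M: "\<And>x. x \<in> ?C \<Longrightarrow> \<bar>\<phi> x\<bar> \<le> M" by (auto simp: bounded_iff)
  have "\<bar>\<phi> x\<bar> \<le> max M 0" for x
    using M[of x] closure_subset[of "{x. \<phi> x \<noteq> 0}"] by (cases "\<phi> x = 0") force+
  then show ?thesis by (intro that[of "max M 0"]) auto
qed

lemma test_function_measurable:
  "test_function \<Omega> \<phi> \<Longrightarrow> \<phi> \<in> borel_measurable borel"
  unfolding test_function_def using C_k_continuous by (intro borel_measurable_continuous_onI) blast

lemma integrable_times_test_function:
  assumes u: "locally_integrable B u" and \<phi>: "test_function B \<phi>"
  shows "integrable (lebesgue_on B) (\<lambda>x. u x * \<phi> x)"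
proof -
  let ?C = "closure {x. \<phi> x \<noteq> 0}"
  obtain M where M: "\<And>x. \<bar>\<phi> x\<bar> \<le> M" "0 \<le> M" using test_function_bounded[OF \<phi>] by blast
  have C: "compact ?C" "?C \<subseteq> B" using \<phi> by (auto simp: test_function_def)
  then have int: "integrable lebesgue (\<lambda>x. indicator ?C x * u x)"
    using u by (auto simp: locally_integrable_def set_integrable_def)
  have "integrable lebesgue (\<lambda>x. (indicator ?C x * u x) * \<phi> x)"
    using int _ M(1)
  proof (rule integrable_mult_bounded)
    show "\<phi> \<in> borel_measurable lebesgue"
      using test_function_measurable[OF \<phi>] by (simp add: measurable_completion)
  qed
  moreover have "(\<lambda>x. (indicator ?C x * u x) * \<phi> x) = (\<lambda>x. indicator B x *\<^sub>R (u x * \<phi> x))"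
  proof
    fix x
    show "(indicator ?C x * u x) * \<phi> x = indicator B x *\<^sub>R (u x * \<phi> x)"
      using C(2) closure_subset[of "{x. \<phi> x \<noteq> 0}"] by (cases "\<phi> x = 0") (auto simp: indicator_def)
  qed
  ultimately show ?thesis by (subst integrable_restrict_space) auto
qed

text \<open>\<open>weak_hessian\<close> is an arbitrary choice, whereas membership in
  \<open>W22\<close> supplies some Hessian with square integrable entries; uniqueness transfers that
  integrability to the chosen one.\<close>

lemma weak_hessian_unique:
  assumes H: "has_weak_hessian B f H" and K: "has_weak_hessian B f K"
  shows "AE x in lebesgue_on B. H x = K x"
proof -
  have "AE x in lebesgue_on B. H x $ i $ j = K x $ i $ j" for i j
  proof -
    have Hl: "locally_integrable B (\<lambda>x. H x $ i $ j)" and Kl: "locally_integrable B (\<lambda>x. K x $ i $ j)"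
      using H K by (auto simp: has_weak_hessian_def)
    have "AE x in lebesgue_on B. H x $ i $ j - K x $ i $ j = 0"
    proof (rule weak_derivative_unique)
      show "locally_integrable B (\<lambda>x. H x $ i $ j - K x $ i $ j)"
        using Hl Kl by (auto simp: locally_integrable_def intro!: set_integral_diff)
      fix \<phi> assume \<phi>: "test_function B \<phi>"
      have "(\<integral>x. (H x $ i $ j - K x $ i $ j) * \<phi> x \<partial>lebesgue_on B) =
         (\<integral>x. H x $ i $ j * \<phi> x \<partial>lebesgue_on B) - (\<integral>x. K x $ i $ j * \<phi> x \<partial>lebesgue_on B)"
        unfolding left_diff_distrib
        using integrable_times_test_function[OF Hl \<phi>] integrable_times_test_function[OF Kl \<phi>]
        by (rule Bochner_Integration.integral_diff)
      also have "\<dots> = 0" using H K \<phi> unfolding has_weak_hessian_def by (metis (no_types) right_minus_eq)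
      finally show "(\<integral>x. (H x $ i $ j - K x $ i $ j) * \<phi> x \<partial>lebesgue_on B) = 0" .
    qed simp
    then show ?thesis by eventually_elim simp
  qed
  then have "AE x in lebesgue_on B. \<forall>i j. H x $ i $ j = K x $ i $ j"
    by (simp add: AE_all_countable)
  then show ?thesis by eventually_elim (simp add: vec_eq_iff)
qed

text \<open>Collects what is needed of a function and its Hessian after passing to Borel
  representatives on the finite measure \<open>disk\<close>, where square integrable entries are
  integrable and rotations and Fubini apply directly.\<close>

definition borel_hessian :: "(real^2 \<Rightarrow> real) \<Rightarrow> (real^2 \<Rightarrow> real^2^2) \<Rightarrow> bool" where
  "borel_hessian u H \<longleftrightarrow> u \<in> borel_measurable borel \<and> integrable disk u \<and>
     (\<forall>i j. (\<lambda>x. H x $ i $ j) \<in> borel_measurable borel \<and> integrable disk (\<lambda>x. (H x $ i $ j)\<^sup>2)) \<and>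
     (\<forall>\<phi> i j. test_function B \<phi> \<longrightarrow>
        (\<integral>x. u x * partial i (partial j \<phi>) x \<partial>disk) = (\<integral>x. H x $ i $ j * \<phi> x \<partial>disk))"

lemma partial_test_function:
  assumes "test_function \<Omega> \<phi>"
  shows "test_function \<Omega> (partial i \<phi>)"
proof (rule test_functionI)
  let ?C = "closure {x. \<phi> x \<noteq> 0}"
  show "C_k m (partial i \<phi>)" for m
    using assms C_k.simps(2)[of m \<phi>] unfolding test_function_def by blast
  show "compact ?C" "?C \<subseteq> \<Omega>" using assms by (auto simp: test_function_def)
  show "partial i \<phi> x = 0" if x: "x \<notin> ?C" for x
  proof -
    have "((\<lambda>x. 0) has_derivative (\<lambda>h. 0)) (at x)" by simp
    then have "(\<phi> has_derivative (\<lambda>h. 0)) (at x)"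
    proof (rule has_derivative_transform_within_open[where s="- ?C"])
      show "0 = \<phi> y" if "y \<in> - ?C" for y
        using that closure_subset[of "{x. \<phi> x \<noteq> 0}"] by force
    qed (use x in auto)
    then show ?thesis using partial_eqI by metis
  qed
qed

lemma ex_borel_hessian:
  assumes f: "f \<in> W22 B"
  obtains u H where "borel_hessian u H" "AE x in disk. f x = u x" "AE x in disk. hess f x = H x"
proof -
  from f obtain H0 where f2: "f \<in> L2 B" and H0: "has_weak_hessian B f H0"
    and H02: "\<And>i j. (\<lambda>x. H0 x $ i $ j) \<in> L2 B"
    by (auto simp: W22_def)
  have "has_weak_hessian B f (hess f)" unfolding weak_hessian_def using H0 by (rule someI[where P="has_weak_hessian B f"])
  from weak_hessian_unique[OF this H0] have hH0: "AE x in lebesgue_on B. hess f x = H0 x" .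
  obtain u where u: "u \<in> borel_measurable borel" "AE x in lebesgue_on B. f x = u x"
    using ex_borel_representative[of f] f2 by (auto simp: L2_def)
  have "\<exists>g. g \<in> borel_measurable borel \<and> (AE x in lebesgue_on B. H0 x $ i $ j = g x)" for i j
    using ex_borel_representative H02[of i j] by (auto simp: L2_def)
  then have ex: "\<forall>i j. \<exists>g. g \<in> borel_measurable borel \<and> (AE x in lebesgue_on B. H0 x $ i $ j = g x)"
    by blast
  define h where "h i j = (SOME g. g \<in> borel_measurable borel \<and> (AE x in lebesgue_on B. H0 x $ i $ j = g x))"
    for i j
  have "h i j \<in> borel_measurable borel \<and> (AE x in lebesgue_on B. H0 x $ i $ j = h i j x)" for i j
    unfolding h_def by (rule someI_ex[OF ex[rule_format]])
  then have h: "\<And>i j. h i j \<in> borel_measurable borel"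
    "\<And>i j. AE x in lebesgue_on B. H0 x $ i $ j = h i j x" by blast+
  define H :: "real^2 \<Rightarrow> real^2^2" where "H x = (\<chi> i j. h i j x)" for x
  have Hij: "(\<lambda>x. H x $ i $ j) = h i j" for i j by (simp add: H_def)
  have "borel_hessian u H"
    unfolding borel_hessian_def
  proof (intro conjI allI impI)
    have um: "(\<lambda>x. (u x)\<^sup>2) \<in> borel_measurable borel" using u(1) by measurable
    have "integrable (lebesgue_on B) (\<lambda>x. (u x)\<^sup>2)"
    proof (rule integrable_cong_AE_imp)
      show "integrable (lebesgue_on B) (\<lambda>x. (f x)\<^sup>2)" using f2 by (auto simp: L2_def)
      show "AE x in lebesgue_on B. (f x)\<^sup>2 = (u x)\<^sup>2" using u(2) by eventually_elim simp
    qed (rule borel_imp_measurable_on_B[OF um])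
    then have "integrable disk (\<lambda>x. (u x)\<^sup>2)" using integrable_lebesgue_on_B[OF um] by simp
    then show "integrable disk u"
      by (rule disk.square_integrable_imp_integrable[rotated]) (use u(1) in simp)
    show "(\<lambda>x. H x $ i $ j) \<in> borel_measurable borel" for i j using h Hij by simp
    show "integrable disk (\<lambda>x. (H x $ i $ j)\<^sup>2)" for i j
    proof -
      have m: "(\<lambda>x. (h i j x)\<^sup>2) \<in> borel_measurable borel" using h(1)[of i j] by measurable
      have "integrable (lebesgue_on B) (\<lambda>x. (h i j x)\<^sup>2)"
      proof (rule integrable_cong_AE_imp)
        show "integrable (lebesgue_on B) (\<lambda>x. (H0 x $ i $ j)\<^sup>2)" using H02 by (auto simp: L2_def)
        show "AE x in lebesgue_on B. (H0 x $ i $ j)\<^sup>2 = (h i j x)\<^sup>2" using h(2)[of i j] by eventually_elim simp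
      qed (rule borel_imp_measurable_on_B[OF m])
      then show ?thesis using integrable_lebesgue_on_B[OF m] Hij by (simp add: H_def)
    qed
    fix \<phi> i j assume \<phi>: "test_function B \<phi>"
    have pm: "partial i (partial j \<phi>) \<in> borel_measurable borel" "\<phi> \<in> borel_measurable borel"
      using \<phi> by (auto intro!: test_function_measurable partial_test_function)
    have fm: "f \<in> borel_measurable (lebesgue_on B)" "(\<lambda>x. H0 x $ i $ j) \<in> borel_measurable (lebesgue_on B)"
      using f2 H02 by (auto simp: L2_def)
    have "(\<integral>x. u x * partial i (partial j \<phi>) x \<partial>disk) = (\<integral>x. u x * partial i (partial j \<phi>) x \<partial>lebesgue_on B)"
      using u pm by (intro integral_lebesgue_on_B[symmetric]) auto
    also have "\<dots> = (\<integral>x. f x * partial i (partial j \<phi>) x \<partial>lebesgue_on B)"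
    proof (rule integral_cong_AE)
      show "AE x in lebesgue_on B. u x * partial i (partial j \<phi>) x = f x * partial i (partial j \<phi>) x"
        using u(2) by eventually_elim simp
    qed (use fm borel_imp_measurable_on_B[OF u(1)] borel_imp_measurable_on_B[OF pm(1)] in auto)
    also have "\<dots> = (\<integral>x. H0 x $ i $ j * \<phi> x \<partial>lebesgue_on B)"
      using H0 \<phi> unfolding has_weak_hessian_def by blast
    also have "\<dots> = (\<integral>x. h i j x * \<phi> x \<partial>lebesgue_on B)"
    proof (rule integral_cong_AE)
      show "AE x in lebesgue_on B. H0 x $ i $ j * \<phi> x = h i j x * \<phi> x"
        using h(2)[of i j] by eventually_elim simp
    qed (use fm borel_imp_measurable_on_B[OF h(1)] borel_imp_measurable_on_B[OF pm(2)] in auto)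
    also have "\<dots> = (\<integral>x. h i j x * \<phi> x \<partial>disk)"
      using h(1) pm by (intro integral_lebesgue_on_B) auto
    finally show "(\<integral>x. u x * partial i (partial j \<phi>) x \<partial>disk) = (\<integral>x. H x $ i $ j * \<phi> x \<partial>disk)"
      by (simp add: H_def)
  qed (use u in auto)
  moreover have "AE x in disk. f x = u x" using u(2) by (simp add: AE_lebesgue_on_B)
  moreover have "AE x in disk. hess f x = H x"
  proof -
    have "AE x in lebesgue_on B. \<forall>i j. H0 x $ i $ j = h i j x" using h(2) by (simp add: AE_all_countable)
    with hH0 have "AE x in lebesgue_on B. hess f x = H x"
      by eventually_elim (simp add: H_def vec_eq_iff)
    then show ?thesis by (simp add: AE_lebesgue_on_B)
  qed
  ultimately show ?thesis by (rule that)
qed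

lemma borel_hessian_measurable:
  "borel_hessian u H \<Longrightarrow> (\<lambda>x. H x $ i $ j) \<in> borel_measurable borel"
  by (simp add: borel_hessian_def)

lemma borel_hessian_integrable:
  assumes "borel_hessian u H"
  shows "integrable disk (\<lambda>x. H x $ i $ j)"
proof (rule disk.square_integrable_imp_integrable)
  show "(\<lambda>x. H x $ i $ j) \<in> borel_measurable disk"
    using borel_hessian_measurable[OF assms, of i j] by simp
  show "integrable disk (\<lambda>x. (H x $ i $ j)\<^sup>2)" using assms by (simp add: borel_hessian_def)
qed

section \<open>Circle averages of the Hessian\<close>

text \<open>With \<open>g' = h\<close> and \<open>s = \<bar>x\<bar>\<^sup>2\<close>, the matrix with entries \<open>c\<^sub>1\<^sub>1 = g + 2 h x\<^sub>2\<^sup>2\<close>,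
  \<open>c\<^sub>1\<^sub>2 = c\<^sub>2\<^sub>1 = -2 h x\<^sub>1 x\<^sub>2\<close>, \<open>c\<^sub>2\<^sub>2 = g + 2 h x\<^sub>1\<^sup>2\<close> is the cofactor matrix of half the Hessian of a radial
  function, so its rows are divergence free and its pairing with a weak Hessian integrates to 0.\<close>

lemma borel_hessian_cof_test:
  fixes g h :: "real \<Rightarrow> real"
  assumes K: "borel_hessian u K"
    and g: "\<And>t. (g has_real_derivative h t) (at t)" and h: "\<And>m. smooth1 m h"
    and b: "b < 1" and zero: "\<And>t. b < t \<Longrightarrow> g t = 0" "\<And>t. b < t \<Longrightarrow> h t = 0"
  shows "(\<integral>x. K x $ 1 $ 1 * (g ((norm x)\<^sup>2) + 2 * h ((norm x)\<^sup>2) * (x $ 2)\<^sup>2)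
        + K x $ 1 $ 2 * (- 2 * h ((norm x)\<^sup>2) * (x $ 1 * x $ 2))
        + (K x $ 2 $ 1 * (- 2 * h ((norm x)\<^sup>2) * (x $ 1 * x $ 2))
        + K x $ 2 $ 2 * (g ((norm x)\<^sup>2) + 2 * h ((norm x)\<^sup>2) * (x $ 1)\<^sup>2)) \<partial>disk) = 0"
proof -
  obtain h' where h': "\<And>t. (h has_real_derivative h' t) (at t)"
    using h[of "Suc 0"] by auto
  have gs: "smooth1 m g" for m
    by (rule smooth1_SucD) (use g h in auto)
  define p where "p x = (norm x)\<^sup>2" for x :: "real^2"
  have p: "p = (\<lambda>x. x $ 1 * x $ 1 + x $ 2 * x $ 2)"
    by (rule ext) (simp add: p_def norm_2 power2_eq_square[of "_ $ _"])
  have dn: "(\<lambda>x. x $ i) differentiable (at x)" for i and x :: "real^2"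
    using C_k_nth[of "Suc 0" i] by simp
  have ps: "C_k m p" for m unfolding p by (intro C_k_add C_k_mult C_k_nth)
  have dp: "p differentiable (at x)" for x using ps[of "Suc 0"] by simp
  have pp: "partial i p = (\<lambda>x. 2 * x $ i)" for i
  proof -
    have "partial i p = (\<lambda>x. (x $ 1 * partial i (\<lambda>x. x $ 1) x + partial i (\<lambda>x. x $ 1) x * x $ 1)
        + (x $ 2 * partial i (\<lambda>x. x $ 2) x + partial i (\<lambda>x. x $ 2) x * x $ 2))"
      unfolding p by (simp only: partial_add partial_mult dn differentiable_mult)
    then show ?thesis
      using exhaust_2[of i] by (auto simp: partial_nth fun_eq_iff)
  qed
  have cs: "C_k m (\<lambda>x. g (p x))" "C_k m (\<lambda>x. h (p x))" for m
    by (rule C_k_compose[OF gs ps], rule C_k_compose[OF h ps])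
  have dg: "(\<lambda>x. g (p x)) differentiable (at x)" and dh: "(\<lambda>x. h (p x)) differentiable (at x)" for x
    using cs[of "Suc 0"] by auto
  have pg: "partial i (\<lambda>x. g (p x)) = (\<lambda>x. h (p x) * (2 * x $ i))"
    and ph: "partial i (\<lambda>x. h (p x)) = (\<lambda>x. h' (p x) * (2 * x $ i))" for i
    using partial_compose[OF g dp, of i] partial_compose[OF h' dp, of i] by (auto simp: pp)
  have pc: "partial i (\<lambda>x. c) = (\<lambda>x. 0)" for i :: 2 and c :: real
    by (rule ext) (rule partial_eqI, simp)
  \<comment> \<open>The index names the coordinate that is squared, so \<open>c 2\<close> is the
    entry (1,1) of the matrix, \<open>c 1\<close> the entry (2,2), and \<open>e\<close> both
    off-diagonal entries.\<close>
  define c where "c i x = g (p x) + 2 * h (p x) * (x $ i * x $ i)" for i x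
  define e where "e x = - 2 * h (p x) * (x $ 1 * x $ 2)" for x
  have csm: "C_k m (c i)" "C_k m e" for m i
    unfolding c_def e_def by (intro C_k_add C_k_mult C_k_nth C_k_const cs)+
  have pci: "partial j (c i) = (\<lambda>x. h (p x) * (2 * x $ j) + ((2 * h (p x)) * (x $ i * (if j = i then 1 else 0) + (if j = i then 1 else 0) * x $ i) +
      (2 * (h' (p x) * (2 * x $ j)) + 0 * h (p x)) * (x $ i * x $ i)))" for i j
    unfolding c_def
    by (simp only: partial_add partial_mult partial_nth pc pg ph dn dg dh differentiable_mult differentiable_const)
  have pe: "partial j e = (\<lambda>x. (- 2 * h (p x)) * (x $ 1 * (if j = 2 then 1 else 0) + (if j = 1 then 1 else 0) * x $ 2) +
      (- 2 * (h' (p x) * (2 * x $ j)) + 0 * h (p x)) * (x $ 1 * x $ 2))" for j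
    unfolding e_def
    by (simp only: partial_add partial_mult partial_nth pc pg ph dn dg dh differentiable_mult differentiable_const)
  \<comment> \<open>The first row (\<open>c 2\<close>, \<open>e\<close>) is divergence free.
    Applying \<open>partial 1\<close> to this relation cancels the two terms of \<open>sum1\<close>;
    \<open>div2\<close> does the same for the second row and \<open>sum2\<close>.\<close>
  have div1: "partial 2 e = (\<lambda>x. - 1 * partial 1 (c 2) x)"
    unfolding pe pci by (auto simp: fun_eq_iff algebra_simps)
  have div2: "partial 1 e = (\<lambda>x. - 1 * partial 2 (c 1) x)"
    unfolding pe pci by (auto simp: fun_eq_iff algebra_simps)
  have neg: "partial i (\<lambda>x. - 1 * partial j (c k) x) = (\<lambda>x. - partial i (partial j (c k)) x)" for i j k
  proof -
    have d: "(partial j (c k)) differentiable (at x)" for x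
      using csm(1)[of "Suc (Suc 0)" k] by simp
    show ?thesis by (subst partial_mult) (auto simp: pc d)
  qed
  \<comment> \<open>The maximum with 0 covers a negative \<open>b\<close>; then the profiles already
    vanish for all squared radii.\<close>
  have out: "c i x = 0" "e x = 0" if x: "x \<notin> cball 0 (sqrt (max b 0))" for i x
  proof -
    have "sqrt (max b 0) < norm x" using x by simp
    then have "sqrt (max b 0) < sqrt ((norm x)\<^sup>2)" by simp
    then have "b < p x" unfolding p_def real_sqrt_less_iff by simp
    then show "c i x = 0" "e x = 0" by (auto simp: c_def e_def zero)
  qed
  have "sqrt (max b 0) < 1" using b by simp
  then have sub: "cball 0 (sqrt (max b 0)) \<subseteq> B" by (force simp del: real_sqrt_lt_1_iff)
  have tc: "test_function B (c i)" for i
    by (rule test_functionI[OF csm(1) compact_cball sub out(1)])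
  have te: "test_function B e"
    by (rule test_functionI[OF csm(2) compact_cball sub out(2)])
  have int: "integrable disk (\<lambda>x. K x $ i $ j * \<phi> x)" if \<phi>: "test_function B \<phi>" for i j \<phi>
  proof -
    obtain M where M: "\<And>x. \<bar>\<phi> x\<bar> \<le> M" using test_function_bounded[OF \<phi>] by blast
    have m: "\<phi> \<in> borel_measurable disk" using test_function_measurable[OF \<phi>] by simp
    show ?thesis
      using borel_hessian_integrable[OF K] m M by (rule integrable_mult_bounded)
  qed
  have KI: "(\<integral>x. K x $ i $ j * \<phi> x \<partial>disk) = (\<integral>x. u x * partial i (partial j \<phi>) x \<partial>disk)"
    if "test_function B \<phi>" for i j \<phi>
    using K that by (simp add: borel_hessian_def)
  have sum1: "(\<integral>x. K x $ 1 $ 1 * c 2 x \<partial>disk) + (\<integral>x. K x $ 1 $ 2 * e x \<partial>disk) = 0"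
    unfolding KI[OF tc] KI[OF te] div1 neg by simp
  have sum2: "(\<integral>x. K x $ 2 $ 1 * e x \<partial>disk) + (\<integral>x. K x $ 2 $ 2 * c 1 x \<partial>disk) = 0"
    unfolding KI[OF tc] KI[OF te] div2 neg by simp
  have i1: "integrable disk (\<lambda>x. K x $ 1 $ 1 * c 2 x + K x $ 1 $ 2 * e x)"
    and i2: "integrable disk (\<lambda>x. K x $ 2 $ 1 * e x + K x $ 2 $ 2 * c 1 x)"
    using int[OF tc] int[OF te] by (auto intro!: Bochner_Integration.integrable_add)
  have "(\<integral>x. (K x $ 1 $ 1 * c 2 x + K x $ 1 $ 2 * e x) + (K x $ 2 $ 1 * e x + K x $ 2 $ 2 * c 1 x) \<partial>disk) = 0"
    unfolding Bochner_Integration.integral_add[OF i1 i2]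
      Bochner_Integration.integral_add[OF int[OF tc] int[OF te]]
      Bochner_Integration.integral_add[OF int[OF te] int[OF tc]] sum1 sum2 by simp
  then show ?thesis by (simp add: c_def e_def p_def power2_eq_square)
qed

text \<open>As \<open>perp x\<close> has the length of \<open>x\<close>, this is |x|^2 times the
  tangential entry of the matrix. Leaving the factor in makes the expression polynomial in
  \<open>x\<close>, with no singularity at the origin.\<close>

definition tang :: "(real^2 \<Rightarrow> real^2^2) \<Rightarrow> real^2 \<Rightarrow> real" where
  "tang K x = perp x \<bullet> (K x *v perp x)"

lemma tang_expand:
  "tang K x = (x $ 2)\<^sup>2 * K x $ 1 $ 1 - x $ 1 * x $ 2 * (K x $ 1 $ 2 + K x $ 2 $ 1) + (x $ 1)\<^sup>2 * K x $ 2 $ 2"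
  by (simp add: tang_def inner_vec_def matrix_vector_mult_def sum_2 power2_eq_square algebra_simps)

lemma trace_2: "trace A = A $ 1 $ 1 + A $ 2 $ 2" for A :: "real^2^2"
  by (simp add: trace_def sum_2)

lemma trace_borel_hessian:
  assumes K: "borel_hessian u K"
  shows "(\<lambda>x. trace (K x)) \<in> borel_measurable borel" "integrable disk (\<lambda>x. trace (K x))"
proof -
  note [measurable] = borel_hessian_measurable[OF K]
  show "(\<lambda>x. trace (K x)) \<in> borel_measurable borel" unfolding trace_2 by measurable
  show "integrable disk (\<lambda>x. trace (K x))"
    unfolding trace_2
    by (rule Bochner_Integration.integrable_add[OF borel_hessian_integrable[OF K] borel_hessian_integrable[OF K]])
qed

lemma AE_disk_norm: "AE x in disk. norm x < 1"
  by (simp add: AE_disk)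

lemma integrable_disk_mult_bounded:
  fixes f g :: "real^2 \<Rightarrow> real"
  assumes f: "integrable disk f" and [measurable]: "g \<in> borel_measurable borel"
    and bound: "\<And>x. norm x < 1 \<Longrightarrow> \<bar>g x\<bar> \<le> C"
  shows "integrable disk (\<lambda>x. f x * g x)"
proof (rule integrable_cong_AE_imp)
  have "0 \<le> \<bar>g 0\<bar>" "\<bar>g 0\<bar> \<le> C" using bound[of 0] by auto
  then have C: "0 \<le> C" by linarith
  show "integrable disk (\<lambda>x. f x * (indicator B x * g x))"
    using f by (rule integrable_mult_bounded[where C=C]) (auto simp: indicator_def bound C)
  show "AE x in disk. f x * (indicator B x * g x) = f x * g x"
    using AE_disk_norm by eventually_elim simp
  have [measurable]: "f \<in> borel_measurable borel" using borel_measurable_integrable[OF f] by simp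
  show "(\<lambda>x. f x * g x) \<in> borel_measurable disk" by measurable
qed

lemma tang_borel_hessian:
  assumes K: "borel_hessian u K"
  shows "tang K \<in> borel_measurable borel" "integrable disk (tang K)"
proof -
  note [measurable] = borel_hessian_measurable[OF K]
  have "(\<lambda>x. (x $ 2)\<^sup>2 * K x $ 1 $ 1 - x $ 1 * x $ 2 * (K x $ 1 $ 2 + K x $ 2 $ 1) + (x $ 1)\<^sup>2 * K x $ 2 $ 2)
     \<in> borel_measurable borel"
    by measurable
  then show "tang K \<in> borel_measurable borel" unfolding tang_expand[abs_def] .
  have "integrable disk (\<lambda>x. K x $ i $ j * (x $ k * x $ l))" for i j k l
  proof (rule integrable_disk_mult_bounded[OF borel_hessian_integrable[OF K]])
    fix x :: "real^2" assume "norm x < 1"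
    then have "\<bar>x $ k\<bar> \<le> 1" "\<bar>x $ l\<bar> \<le> 1"
      using component_le_norm_cart[of x k] component_le_norm_cart[of x l] by auto
    then show "\<bar>x $ k * x $ l\<bar> \<le> 1" unfolding abs_mult by (intro mult_le_one) auto
  qed measurable
  note i = this
  have "integrable disk (\<lambda>x. (K x $ 1 $ 1 * (x $ 2 * x $ 2) - (K x $ 1 $ 2 * (x $ 1 * x $ 2) + K x $ 2 $ 1 * (x $ 1 * x $ 2)))
      + K x $ 2 $ 2 * (x $ 1 * x $ 1))"
    by (intro Bochner_Integration.integrable_add Bochner_Integration.integrable_diff i)
  then show "integrable disk (tang K)"
    unfolding tang_expand[abs_def] by (simp add: algebra_simps power2_eq_square)
qed

lemma integral_disk_radial_mult:
  fixes u :: "real^2 \<Rightarrow> real"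
  assumes u: "integrable disk (\<lambda>x. g ((norm x)\<^sup>2) * u x)"
    and [measurable]: "u \<in> borel_measurable borel" "g \<in> borel_measurable borel"
  shows "integrable unit_interval (\<lambda>s. g s * circle_integral u s)"
    "(\<integral>x. g ((norm x)\<^sup>2) * u x \<partial>disk) = (\<integral>s. g s * circle_integral u s \<partial>unit_interval)"
proof -
  have eq: "AE s in unit_interval. circle_integral (\<lambda>x. g ((norm x)\<^sup>2) * u x) s = g s * circle_integral u s"
    using AE_unit_intervalI by eventually_elim (simp add: circle_integral_radial_mult)
  show "integrable unit_interval (\<lambda>s. g s * circle_integral u s)"
    by (rule integrable_cong_AE_imp[OF integrable_circle_integral[OF u] _ eq]) measurable
  show "(\<integral>x. g ((norm x)\<^sup>2) * u x \<partial>disk) = (\<integral>s. g s * circle_integral u s \<partial>unit_interval)"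
    unfolding integral_circle_integral[OF u, symmetric]
    by (rule integral_cong_AE[OF _ _ eq]) measurable
qed

lemma primitive_1:
  assumes "integrable unit_interval f"
  shows "primitive f 1 = (\<integral>s. f s \<partial>unit_interval)"
  unfolding primitive_def
proof (rule integral_cong_AE)
  show "f \<in> borel_measurable unit_interval" using assms by auto
  then show "(\<lambda>t. indicator {..1} t * f t) \<in> borel_measurable unit_interval" by measurable
  show "AE s in unit_interval. indicator {..1} s * f s = f s"
    using AE_unit_intervalI by eventually_elim simp
qed

text \<open>\<open>h\<close> is required to vanish outside the open unit interval because
  \<open>abs_cont\<close> demands the identity at every real point, while \<open>primitive h\<close>
  is constant there.\<close>

lemma abs_cont_of_deriv:
  fixes g h :: "real \<Rightarrow> real"
  assumes g: "\<And>t. (g has_real_derivative h t) (at t)" and h: "continuous_on UNIV h"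
    and bound: "\<And>t. \<bar>h t\<bar> \<le> C" and zero: "\<And>t. t \<notin> {0<..<1} \<Longrightarrow> h t = 0"
  shows "abs_cont g h"
proof -
  have [measurable]: "h \<in> borel_measurable borel" using h by (rule borel_measurable_continuous_onI)
  have int: "integrable unit_interval h"
    using bound by (intro unit_interval.integrable_const_bound[where B=C]) auto
  have diff: "g b - g a = integral {a..b} h" if "a \<le> b" for a b
    using that g fundamental_theorem_of_calculus[of a b g h]
    by (auto simp: has_real_derivative_iff_has_vector_derivative intro!: integral_unique[symmetric]
        intro: has_vector_derivative_at_within)
  have "g s = g 0 + primitive h s" for s
  proof (cases "0 \<le> s")
    case True
    have "primitive h s = (\<integral>t. indicator {0<..<1} t * (indicator {..s} t * h t) \<partial>lborel)"
      unfolding primitive_def unit_interval_def by (subst integral_density) auto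
    also have "\<dots> = (LINT t:{0..s}|lborel. h t)"
      unfolding set_lebesgue_integral_def
    proof (rule Bochner_Integration.integral_cong[OF refl])
      fix t show "indicator {0<..<1} t * (indicator {..s} t * h t) = indicator {0..s} t *\<^sub>R h t"
        using zero[of t] by (cases "t \<in> {0<..<1}") (auto simp: indicator_def)
    qed
    also have "\<dots> = integral {0..s} h"
      by (intro set_borel_integral_eq_integral(2) borel_integrable_atLeastAtMost' continuous_on_subset[OF h]) auto
    also have "\<dots> = g s - g 0" using diff[OF True] by simp
    finally show ?thesis by simp
  next
    case False
    then have "g 0 - g s = integral {s..0} h" by (intro diff) simp
    also have "\<dots> = integral {s..0} (\<lambda>t. 0)"
      by (rule Henstock_Kurzweil_Integration.integral_cong) (auto simp: zero)
    finally show ?thesis using False by (simp add: primitive_0)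
  qed
  with int show ?thesis unfolding abs_cont_def by blast
qed

text \<open>Normalising at the right end makes the radial function with profile \<open>g\<close>
  vanish near the boundary of the disk. At the centre \<open>g\<close> may be nonzero.\<close>

lemma ex_antiderivative_vanishing:
  fixes h :: "real \<Rightarrow> real"
  assumes h: "continuous_on UNIV h" and zero: "\<And>t. b \<le> t \<Longrightarrow> h t = 0"
  obtains g where "\<And>t. (g has_real_derivative h t) (at t)" "\<And>t. b \<le> t \<Longrightarrow> g t = 0"
proof -
  have "\<exists>F. \<forall>x::real. -\<infinity> < ereal x \<longrightarrow> ereal x < \<infinity> \<longrightarrow> (F has_vector_derivative h x) (at x)"
    using h by (intro einterval_antiderivative) (auto simp: continuous_on_eq_continuous_at)
  then obtain F where F: "\<And>x. (F has_real_derivative h x) (at x)"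
    by (auto simp: has_real_derivative_iff_has_vector_derivative)
  have Fc: "F t = F b" if "b \<le> t" for t
  proof (cases "b = t")
    case False
    with that have "b < t" by simp
    then show ?thesis
    proof (rule DERIV_isconst_end)
      show "continuous_on {b..t} F"
        by (intro continuous_at_imp_continuous_on ballI DERIV_isCont[OF F])
      show "DERIV F x :> 0" if "b < x" "x < t" for x using F[of x] zero[of x] that by simp
    qed
  qed simp
  show ?thesis
  proof (rule that[of "\<lambda>t. F t - F b"])
    show "((\<lambda>t. F t - F b) has_real_derivative h t) (at t)" for t
      using DERIV_diff[OF F[of t] DERIV_const[of "F b"]] by simp
    show "F t - F b = 0" if "b \<le> t" for t using Fc[OF that] by simp
  qed
qed

text \<open>For smooth \<open>u\<close> both sides are half the flux of the gradient through the
  circle: the primitive is the integral of the Laplacian over the enclosed disk, and in polar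
  coordinates the tangential term is r u_r plus the second angular derivative, which integrates to
  0. For a weak Hessian, radial test matrices give the identity against \<open>h\<close>, with
  \<open>g\<close> removed by integration by parts.\<close>

lemma circle_integral_tang:
  assumes K: "borel_hessian u K"
  shows "AE s in unit_interval.
    circle_integral (tang K) s = primitive (circle_integral (\<lambda>x. trace (K x))) s / 2"
proof -
  define k q where "k = circle_integral (\<lambda>x. trace (K x))" and "q = circle_integral (tang K)"
  note [measurable] = trace_borel_hessian(1)[OF K] tang_borel_hessian(1)[OF K]
  have k: "integrable unit_interval k" and q: "integrable unit_interval q"
    unfolding k_def q_def
    by (intro integrable_circle_integral trace_borel_hessian[OF K] tang_borel_hessian[OF K])+
  have pk: "abs_cont (primitive k) k" using k by (rule abs_cont_primitive)
  define v where "v s = 2 * q s - primitive k s" for s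
  have vi: "integrable unit_interval v"
    unfolding v_def using q integrable_mult_primitive[OF _ k, of "\<lambda>_. 1"]
    by (intro Bochner_Integration.integrable_diff) auto
  have [measurable]: "v \<in> borel_measurable borel" "k \<in> borel_measurable borel" "q \<in> borel_measurable borel"
    using borel_measurable_integrable[OF vi] borel_measurable_integrable[OF k] borel_measurable_integrable[OF q] by auto
  have test: "(\<integral>s. h s * v s \<partial>unit_interval) = 0"
    if h: "\<And>m. smooth1 m h" and hb: "\<And>t. \<bar>h t\<bar> \<le> 1" and b: "0 < b" "b < 1"
      and zero: "\<And>t. t \<notin> {0<..<b} \<Longrightarrow> h t = 0" for h b
  proof -
    have hc: "continuous_on UNIV h" by (rule smooth1_continuous[OF h[of 0]])
    obtain g where g: "\<And>t. (g has_real_derivative h t) (at t)" and g0: "\<And>t. b \<le> t \<Longrightarrow> g t = 0"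
      using ex_antiderivative_vanishing[of h b] hc zero by auto
    have AC: "abs_cont g h"
      by (rule abs_cont_of_deriv[OF g hc hb]) (use zero b in auto)
    have gc: "continuous_on UNIV g"
      using g by (auto intro!: continuous_at_imp_continuous_on intro: DERIV_isCont)
    have [measurable]: "h \<in> borel_measurable borel" "g \<in> borel_measurable borel"
      using hc gc by (auto intro: borel_measurable_continuous_onI)
    obtain C where C: "\<And>t. \<bar>g t\<bar> \<le> C"
    proof -
      have "\<bar>g t\<bar> \<le> \<bar>g 0\<bar> + (\<integral>t. \<bar>h t\<bar> \<partial>unit_interval)" for t
      proof -
        have "g t = g 0 + primitive h t" using AC unfolding abs_cont_def by blast
        moreover have "\<bar>primitive h t\<bar> \<le> (\<integral>t. \<bar>h t\<bar> \<partial>unit_interval)"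
          by (rule primitive_bound[OF abs_cont_integrable[OF AC]])
        ultimately show ?thesis by linarith
      qed
      then show ?thesis by (rule that)
    qed
    have ti: "integrable disk (\<lambda>x. g ((norm x)\<^sup>2) * trace (K x))"
      using integrable_disk_mult_bounded[OF trace_borel_hessian(2)[OF K], of "\<lambda>x. g ((norm x)\<^sup>2)" C] C
      by (simp add: mult.commute)
    have qi: "integrable disk (\<lambda>x. 2 * h ((norm x)\<^sup>2) * tang K x)"
    proof -
      have "integrable disk (\<lambda>x. tang K x * h ((norm x)\<^sup>2))"
        using integrable_disk_mult_bounded[OF tang_borel_hessian(2)[OF K], of "\<lambda>x. h ((norm x)\<^sup>2)" 1] hb
        by simp
      from integrable_mult_right[OF this, of 2] show ?thesis by (simp add: mult_ac)
    qed
    \<comment> \<open>In the pairing, the multiples of the identity collect to the trace and the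
      terms with \<open>2 * h\<close> to \<open>tang K\<close>.\<close>
    have "(\<integral>x. g ((norm x)\<^sup>2) * trace (K x) + 2 * h ((norm x)\<^sup>2) * tang K x \<partial>disk) = 0"
      using borel_hessian_cof_test[OF K g h \<open>b < 1\<close>] g0 zero
      by (simp add: trace_2 tang_expand algebra_simps)
    then have "(\<integral>x. g ((norm x)\<^sup>2) * trace (K x) \<partial>disk) + (\<integral>x. 2 * h ((norm x)\<^sup>2) * tang K x \<partial>disk) = 0"
      by (simp only: Bochner_Integration.integral_add[OF ti qi])
    then have A: "(\<integral>s. g s * k s \<partial>unit_interval) + (\<integral>s. 2 * h s * q s \<partial>unit_interval) = 0"
      using integral_disk_radial_mult(2)[OF ti] integral_disk_radial_mult(2)[of "\<lambda>s. 2 * h s", OF qi]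
      by (simp add: k_def q_def)
    have gki: "integrable unit_interval (\<lambda>s. g s * k s)"
      using integral_disk_radial_mult(1)[OF ti] by (simp add: k_def)
    have hqi: "integrable unit_interval (\<lambda>s. 2 * h s * q s)"
      using integral_disk_radial_mult(1)[of "\<lambda>s. 2 * h s", OF qi] by (simp add: q_def)
    have hpi: "integrable unit_interval (\<lambda>s. h s * primitive k s)"
      by (rule integrable_mult_primitive[OF abs_cont_integrable[OF AC] k])
    \<comment> \<open>Integration by parts on [0, 1]: the boundary terms vanish because
      \<open>g 1 = 0\<close> and \<open>primitive k 0 = 0\<close>.\<close>
    have prod: "abs_cont (\<lambda>s. g s * primitive k s) (\<lambda>s. h s * primitive k s + g s * k s)"
      by (rule abs_cont_mult[OF AC pk])
    have "g 1 * primitive k 1 = g 0 * primitive k 0 + primitive (\<lambda>s. h s * primitive k s + g s * k s) 1"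
      using prod unfolding abs_cont_def by blast
    then have "primitive (\<lambda>s. h s * primitive k s + g s * k s) 1 = 0"
      using g0[of 1] b by (simp add: primitive_0)
    then have "(\<integral>s. h s * primitive k s + g s * k s \<partial>unit_interval) = 0"
      using primitive_1[OF Bochner_Integration.integrable_add[OF hpi gki]] by simp
    then have Bq: "(\<integral>s. h s * primitive k s \<partial>unit_interval) + (\<integral>s. g s * k s \<partial>unit_interval) = 0"
      using Bochner_Integration.integral_add[OF hpi gki] by simp
    have "(\<integral>s. h s * v s \<partial>unit_interval) = (\<integral>s. 2 * h s * q s - h s * primitive k s \<partial>unit_interval)"
      by (simp add: v_def algebra_simps)
    also have "\<dots> = (\<integral>s. 2 * h s * q s \<partial>unit_interval) - (\<integral>s. h s * primitive k s \<partial>unit_interval)"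
      by (rule Bochner_Integration.integral_diff[OF hqi hpi])
    finally show ?thesis using A Bq by simp
  qed
  have P: "primitive v b = 0" if b: "0 < b" "b < 1" for b
  proof -
    have "(\<lambda>n. \<integral>s. bump n 0 b s * v s \<partial>unit_interval) \<longlonglongrightarrow> (\<integral>s. indicator {0<..<b} s * v s \<partial>unit_interval)"
    proof (rule integral_dominated_convergence[where w="\<lambda>s. \<bar>v s\<bar>"])
      have [measurable]: "bump n 0 b \<in> borel_measurable borel" for n
        using smooth1_continuous[OF smooth1_bump[of 0 n 0 b]] by (rule borel_measurable_continuous_onI)
      show "(\<lambda>s. bump n 0 b s * v s) \<in> borel_measurable unit_interval" for n by measurable
      show "AE s in unit_interval. (\<lambda>n. bump n 0 b s * v s) \<longlonglongrightarrow> indicator {0<..<b} s * v s"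
        by (intro AE_I2 tendsto_intros bump_tendsto)
      show "AE s in unit_interval. norm (bump n 0 b s * v s) \<le> \<bar>v s\<bar>" for n
        by (intro AE_I2) (simp add: abs_mult bump_bounds mult_left_le_one_le)
    qed (use vi in auto)
    moreover have "(\<integral>s. bump n 0 b s * v s \<partial>unit_interval) = 0" for n
      by (rule test[OF smooth1_bump _ b]) (auto simp: bump_bounds bump_outside)
    ultimately have "(\<integral>s. indicator {0<..<b} s * v s \<partial>unit_interval) = 0"
      by (simp add: LIMSEQ_const_iff)
    moreover have "primitive v b = (\<integral>s. indicator {0<..<b} s * v s \<partial>unit_interval)"
      unfolding primitive_def
    proof (rule integral_cong_AE)
      show "AE s in unit_interval. indicator {..b} s * v s = indicator {0<..<b} s * v s"
        using AE_unit_intervalI AE_unit_interval_neq[of b] by eventually_elim (auto simp: indicator_def)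
    qed measurable
    ultimately show ?thesis by simp
  qed
  \<comment> \<open>Test profiles have support away from 1, so the end point is reached by
    continuity of the primitive.\<close>
  have P1: "primitive v 1 = 0"
  proof -
    have "(\<lambda>n. 1 - inverse (real (n + 2))) \<longlonglongrightarrow> 1 - 0"
      by (intro tendsto_intros LIMSEQ_ignore_initial_segment lim_inverse_n)
    then have "(\<lambda>n. primitive v (1 - inverse (real (n + 2)))) \<longlonglongrightarrow> primitive v 1"
      using continuous_on_tendsto_compose[OF primitive_continuous[OF vi]] by auto
    moreover have "primitive v (1 - inverse (real (n + 2))) = 0" for n
      by (rule P) (auto simp: field_simps)
    ultimately show ?thesis by (simp add: LIMSEQ_const_iff)
  qed
  have "primitive v s = 0" for s
  proof -
    consider "s \<le> 0" | "0 < s" "s < 1" | "1 \<le> s" by linarith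
    then show ?thesis
    proof cases
      case 3
      have "primitive v s = primitive v 1"
        unfolding primitive_def
      proof (rule integral_cong_AE)
        show "AE t in unit_interval. indicator {..s} t * v t = indicator {..1} t * v t"
          using AE_unit_intervalI by eventually_elim (use 3 in \<open>auto simp: indicator_def\<close>)
      qed measurable
      with P1 show ?thesis by simp
    qed (auto simp: primitive_0 P)
  qed
  then have "AE s in unit_interval. v s = 0" by (rule AE_zero_if_primitive_zero[OF vi])
  then show ?thesis by eventually_elim (simp add: v_def k_def q_def)
qed

section \<open>Hessians of radial functions\<close>

lemma integrable_disk_locally_integrable:
  fixes u :: "real^2 \<Rightarrow> real"
  assumes u: "integrable disk u"
  shows "locally_integrable B u"
  unfolding locally_integrable_def set_integrable_def
proof (intro allI impI)
  fix K :: "(real^2) set" assume K: "compact K \<and> K \<subseteq> B"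
  have [measurable]: "u \<in> borel_measurable borel" using borel_measurable_integrable[OF u] by simp
  have "integrable lborel (\<lambda>x. indicator B x *\<^sub>R u x)"
    using u unfolding disk_def by (subst (asm) integrable_density) auto
  then have "integrable lebesgue (\<lambda>x. indicator B x *\<^sub>R u x)"
    by (subst integrable_completion) auto
  then have "integrable lebesgue (\<lambda>x. indicator K x *\<^sub>R (indicator B x *\<^sub>R u x))"
    by (rule integrable_mult_indicator[rotated]) (use K in \<open>simp add: borel_compact\<close>)
  also have "(\<lambda>x. indicator K x *\<^sub>R (indicator B x *\<^sub>R u x)) = (\<lambda>x. indicator K x *\<^sub>R u x)"
    using K by (auto simp: indicator_def fun_eq_iff)
  finally show "integrable lebesgue (\<lambda>x. indicator K x *\<^sub>R u x)" .
qed

lemma partial_lincomb: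
  assumes "\<And>l x. f l differentiable (at x)"
  shows "partial k (\<lambda>x. \<Sum>l\<in>UNIV. c l * f l x) = (\<lambda>x. \<Sum>l\<in>UNIV. c l * partial k (f l) x)"
proof
  fix x
  have "((\<lambda>x. \<Sum>l\<in>UNIV. c l * f l x) has_derivative
     (\<lambda>h. \<Sum>l\<in>UNIV. c l * frechet_derivative (f l) (at x) h)) (at x)"
    using assms by (intro has_derivative_sum has_derivative_mult_right) (simp add: frechet_derivative_works[symmetric])
  from partial_eqI[OF this] show "partial k (\<lambda>x. \<Sum>l\<in>UNIV. c l * f l x) x = (\<Sum>l\<in>UNIV. c l * partial k (f l) x)"
    by (simp add: partial_def)
qed

lemma test_function_orthogonal:
  fixes \<xi> :: "real^'n \<Rightarrow> real" and R :: "real^'n \<Rightarrow> real^'n"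
  assumes R: "orthogonal_transformation R" and \<xi>: "test_function (ball 0 r) \<xi>"
  shows "test_function (ball 0 r) (\<lambda>x. \<xi> (R x))"
proof (rule test_functionI)
  let ?C = "closure {x. \<xi> x \<noteq> 0}"
  have lin: "linear R" by (rule orthogonal_transformation_linear[OF R])
  have inv: "orthogonal_transformation (inv R)" by (rule orthogonal_transformation_inv[OF R])
  have bij: "bij R" by (rule orthogonal_transformation_bij[OF R])
  show "C_k m (\<lambda>x. \<xi> (R x))" for m
    using C_k_linear[OF lin] \<xi> by (auto simp: test_function_def)
  show "compact (inv R ` ?C)"
    using \<xi> orthogonal_transformation_linear[OF inv]
    by (intro compact_continuous_image linear_continuous_on)
      (auto simp: test_function_def linear_conv_bounded_linear)
  show "inv R ` ?C \<subseteq> ball 0 r"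
    using \<xi> orthogonal_transformation_norm[OF inv] by (auto simp: test_function_def)
  show "\<xi> (R x) = 0" if x: "x \<notin> inv R ` ?C" for x
  proof (rule ccontr)
    assume "\<xi> (R x) \<noteq> 0"
    then have "R x \<in> ?C" using closure_subset[of "{x. \<xi> x \<noteq> 0}"] by auto
    then have "inv R (R x) \<in> inv R ` ?C" by (rule imageI)
    with x show False using bij by (simp add: bij_is_inj)
  qed
qed

text \<open>This is the chain rule H(x) = R^T H(Rx) R for a function invariant under R. It is
  derived by moving R onto the test functions, using that R preserves the disk measure, and
  concluding by uniqueness of weak derivatives.\<close>

lemma borel_hessian_orthogonal:
  assumes v: "borel_hessian v H" and R: "orthogonal_transformation R"
    and inv: "AE x in disk. v (R x) = v x"
  shows "AE x in disk. \<forall>i j. H x $ i $ j =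
    (\<Sum>k\<in>UNIV. \<Sum>l\<in>UNIV. R (axis i 1) $ k * R (axis j 1) $ l * H (R x) $ k $ l)"
proof -
  have lin: "linear R" by (rule orthogonal_transformation_linear[OF R])
  note Rm[measurable] = orthogonal_measurable[OF R]
  note Hm[measurable] = borel_hessian_measurable[OF v]
  have vm[measurable]: "v \<in> borel_measurable borel" and vi: "integrable disk v"
    using v by (auto simp: borel_hessian_def)
  have HRi: "integrable disk (\<lambda>x. H (R x) $ k $ l)" for k l
    using integrable_distr[of R disk borel "\<lambda>x. H x $ k $ l"] borel_hessian_integrable[OF v, of k l]
    by (simp add: distr_disk_orthogonal[OF R])
  have "AE x in disk. H x $ i $ j =
    (\<Sum>k\<in>UNIV. \<Sum>l\<in>UNIV. R (axis i 1) $ k * R (axis j 1) $ l * H (R x) $ k $ l)" for i j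
  proof -
    define a where "a k l = R (axis i 1) $ k * R (axis j 1) $ l" for k l
    define D where "D x = H x $ i $ j - (\<Sum>k\<in>UNIV. \<Sum>l\<in>UNIV. a k l * H (R x) $ k $ l)" for x
    have SI: "integrable disk (\<lambda>x. \<Sum>k\<in>UNIV. \<Sum>l\<in>UNIV. a k l * H (R x) $ k $ l)"
      using HRi by (intro Bochner_Integration.integrable_sum integrable_mult_right) auto
    have Di: "integrable disk D"
      unfolding D_def[abs_def] by (rule Bochner_Integration.integrable_diff[OF borel_hessian_integrable[OF v] SI])
    have Dm: "D \<in> borel_measurable borel" using borel_measurable_integrable[OF Di] by simp
    have "AE x in lebesgue_on B. D x = 0"
    proof (rule weak_derivative_unique[OF open_ball integrable_disk_locally_integrable[OF Di]])
      fix \<xi> assume \<xi>: "test_function B \<xi>"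
      \<comment> \<open>Composing with the inverse makes the given test function equal to
        \<open>\<phi>\<close> after \<open>R\<close>, so its second derivatives are combinations of
        those of \<open>\<phi>\<close> at \<open>R x\<close>.\<close>
      define \<phi> where "\<phi> x = \<xi> (inv R x)" for x
      have \<phi>: "test_function B \<phi>"
        unfolding \<phi>_def[abs_def] by (rule test_function_orthogonal[OF orthogonal_transformation_inv[OF R] \<xi>])
      have \<xi>_eq: "\<xi> = (\<lambda>x. \<phi> (R x))"
        using orthogonal_transformation_bij[OF R] by (simp add: \<phi>_def fun_eq_iff bij_is_inj)
      have dif: "f differentiable (at x)" if "test_function B f" for f and x :: "real^2"
        using that C_k.simps(2)[of 0 f] unfolding test_function_def by blast
      have pt: "test_function B (partial l \<phi>)" for l by (rule partial_test_function[OF \<phi>])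
      have ppt: "test_function B (partial k (partial l \<phi>))" for k l by (rule partial_test_function[OF pt])
      define b where "b l = R (axis j 1) $ l" for l
      have "partial j \<xi> = (\<lambda>x. \<Sum>l\<in>UNIV. b l * partial l \<phi> (R x))"
        unfolding \<xi>_eq b_def by (rule partial_linear[OF dif[OF \<phi>] lin])
      then have "partial i (partial j \<xi>) = partial i (\<lambda>x. (\<lambda>y. \<Sum>l\<in>UNIV. b l * partial l \<phi> y) (R x))" by simp
      also have "\<dots> = (\<lambda>x. \<Sum>k\<in>UNIV. R (axis i 1) $ k * partial k (\<lambda>y. \<Sum>l\<in>UNIV. b l * partial l \<phi> y) (R x))"
      proof (rule partial_linear[OF _ lin])
        show "(\<lambda>y. \<Sum>l\<in>UNIV. b l * partial l \<phi> y) differentiable (at x)" for x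
          using dif[OF pt] by (intro differentiable_sum differentiable_mult differentiable_const) auto
      qed
      also have "\<dots> = (\<lambda>x. \<Sum>k\<in>UNIV. \<Sum>l\<in>UNIV. a k l * partial k (partial l \<phi>) (R x))"
        by (simp add: partial_lincomb[OF dif[OF pt]] sum_distrib_left a_def b_def mult.assoc)
      finally have pp: "partial i (partial j \<xi>) = (\<lambda>x. \<Sum>k\<in>UNIV. \<Sum>l\<in>UNIV. a k l * partial k (partial l \<phi>) (R x))" .
      have tm: "\<psi> \<in> borel_measurable borel" if "test_function B \<psi>" for \<psi> :: "real^2 \<Rightarrow> real"
        by (rule test_function_measurable[OF that])
      have ti: "integrable disk (\<lambda>x. u x * \<psi> (R x))" if u: "integrable disk u" and \<psi>: "test_function B \<psi>" for u \<psi>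
      proof -
        obtain M where M: "\<And>x. \<bar>\<psi> x\<bar> \<le> M" using test_function_bounded[OF \<psi>] by blast
        have "(\<lambda>x. \<psi> (R x)) \<in> borel_measurable disk" using tm[OF \<psi>] by simp
        then show ?thesis by (rule integrable_mult_bounded[OF u _ M])
      qed
      have move: "(\<integral>x. v x * partial k (partial l \<phi>) (R x) \<partial>disk) = (\<integral>x. H (R x) $ k $ l * \<phi> (R x) \<partial>disk)" for k l
      proof -
        have [measurable]: "partial k (partial l \<phi>) \<in> borel_measurable borel" "\<phi> \<in> borel_measurable borel"
          using tm[OF ppt] tm[OF \<phi>] by auto
        \<comment> \<open>Invariance of \<open>v\<close> enters here: it turns the whole integrand
          into a function of \<open>R x\<close>, ready for the change of variables.\<close>
        have "(\<integral>x. v x * partial k (partial l \<phi>) (R x) \<partial>disk) = (\<integral>x. v (R x) * partial k (partial l \<phi>) (R x) \<partial>disk)"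
        proof (rule integral_cong_AE)
          show "AE x in disk. v x * partial k (partial l \<phi>) (R x) = v (R x) * partial k (partial l \<phi>) (R x)"
            using inv by eventually_elim simp
        qed measurable
        also have "\<dots> = (\<integral>x. v x * partial k (partial l \<phi>) x \<partial>disk)"
          by (rule integral_disk_orthogonal[OF R, of "\<lambda>x. v x * partial k (partial l \<phi>) x"]) measurable
        also have "\<dots> = (\<integral>x. H x $ k $ l * \<phi> x \<partial>disk)"
          using v \<phi> by (simp add: borel_hessian_def)
        also have "\<dots> = (\<integral>x. H (R x) $ k $ l * \<phi> (R x) \<partial>disk)"
          by (rule integral_disk_orthogonal[OF R, of "\<lambda>x. H x $ k $ l * \<phi> x", symmetric]) measurable
        finally show ?thesis .
      qed
      have "(\<integral>x. H x $ i $ j * \<xi> x \<partial>disk) = (\<integral>x. v x * partial i (partial j \<xi>) x \<partial>disk)"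
        using v \<xi> by (simp add: borel_hessian_def)
      also have "\<dots> = (\<integral>x. (\<Sum>k\<in>UNIV. \<Sum>l\<in>UNIV. a k l * (v x * partial k (partial l \<phi>) (R x))) \<partial>disk)"
        unfolding pp by (simp add: sum_distrib_left mult.left_commute)
      also have "\<dots> = (\<Sum>k\<in>UNIV. \<Sum>l\<in>UNIV. a k l * (\<integral>x. v x * partial k (partial l \<phi>) (R x) \<partial>disk))"
        using ti[OF vi ppt]
        by (simp add: Bochner_Integration.integral_sum Bochner_Integration.integrable_sum)
      also have "\<dots> = (\<Sum>k\<in>UNIV. \<Sum>l\<in>UNIV. a k l * (\<integral>x. H (R x) $ k $ l * \<phi> (R x) \<partial>disk))"
        by (simp only: move)
      also have "\<dots> = (\<integral>x. (\<Sum>k\<in>UNIV. \<Sum>l\<in>UNIV. a k l * (H (R x) $ k $ l * \<phi> (R x))) \<partial>disk)"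
        using ti[OF HRi \<phi>]
        by (simp add: Bochner_Integration.integral_sum Bochner_Integration.integrable_sum)
      also have "\<dots> = (\<integral>x. (\<Sum>k\<in>UNIV. \<Sum>l\<in>UNIV. a k l * H (R x) $ k $ l) * \<xi> x \<partial>disk)"
        by (simp add: \<xi>_eq sum_distrib_right mult.assoc)
      finally have eq: "(\<integral>x. H x $ i $ j * \<xi> x \<partial>disk) = (\<integral>x. (\<Sum>k\<in>UNIV. \<Sum>l\<in>UNIV. a k l * H (R x) $ k $ l) * \<xi> x \<partial>disk)" .
      have "(\<integral>x. D x * \<xi> x \<partial>disk) = (\<integral>x. H x $ i $ j * \<xi> x - (\<Sum>k\<in>UNIV. \<Sum>l\<in>UNIV. a k l * H (R x) $ k $ l) * \<xi> x \<partial>disk)"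
        by (simp add: D_def left_diff_distrib)
      also have "\<dots> = 0"
        using ti[OF borel_hessian_integrable[OF v] \<phi>, of i j] ti[OF SI \<phi>] eq
        unfolding \<xi>_eq[THEN fun_cong, symmetric]
        by (subst Bochner_Integration.integral_diff) auto
      finally have "(\<integral>x. D x * \<xi> x \<partial>disk) = 0" .
      then show "(\<integral>x. D x * \<xi> x \<partial>lebesgue_on B) = 0"
        using Dm tm[OF \<xi>] by (subst integral_lebesgue_on_B) auto
    qed
    then have "AE x in disk. D x = 0" by (simp add: AE_lebesgue_on_B)
    then show ?thesis by eventually_elim (simp add: D_def a_def)
  qed
  then show ?thesis by (simp add: AE_all_countable)
qed

text \<open>Passes from entries in the standard basis to the bilinear form, into which the moving
  frame \<open>x\<close>, \<open>perp x\<close> can be inserted.\<close>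

lemma bilinear_form_transform:
  fixes A A' :: "real^2^2" and R :: "real^2 \<Rightarrow> real^2"
  assumes R: "linear R"
    and A: "\<forall>i j. A $ i $ j = (\<Sum>k\<in>UNIV. \<Sum>l\<in>UNIV. R (axis i 1) $ k * R (axis j 1) $ l * A' $ k $ l)"
  shows "a \<bullet> (A *v b) = R a \<bullet> (A' *v R b)"
proof -
  have Rx: "R x = x $ 1 *\<^sub>R R (axis 1 1) + x $ 2 *\<^sub>R R (axis 2 1)" for x
  proof -
    have "x = x $ 1 *\<^sub>R axis 1 1 + x $ 2 *\<^sub>R axis 2 1"
      by (simp add: vec_eq_iff forall_2 axis_def)
    then have "R x = R (x $ 1 *\<^sub>R axis 1 1 + x $ 2 *\<^sub>R axis 2 1)" by simp
    then show ?thesis by (simp add: linear_add[OF R] linear_scale[OF R])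
  qed
  show ?thesis
    unfolding Rx[of a] Rx[of b]
    by (simp add: inner_vec_def matrix_vector_mult_def sum_2 A algebra_simps)
qed

section \<open>Rotations and reflections acting on the frame\<close>

lemma perp_rot: "perp (rot z x) = rot z (perp x)"
  by (simp add: rot_def vec_eq_iff forall_2 algebra_simps)

definition reflect :: "real^2 \<Rightarrow> real^2" where
  "reflect x = vector [x $ 1, - x $ 2]"

lemma orthogonal_reflect: "orthogonal_transformation reflect"
proof -
  have "linear reflect" by (rule linearI) (auto simp: reflect_def vec_eq_iff forall_2)
  then show ?thesis
    by (simp add: orthogonal_transformation_def reflect_def inner_vec_def sum_2)
qed

lemma perp_reflect: "perp (reflect x) = - reflect (perp x)"
  by (simp add: reflect_def vec_eq_iff forall_2)

text \<open>Invariance under rotations makes the coefficients of the Hessian in the frame \<open>x\<close>, \<open>perp x\<close>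
  radial; reflections change the sign of the two mixed coefficients, which therefore vanish.\<close>

lemma radial_borel_hessian:
  assumes v: "borel_hessian v H"
    and inv: "\<And>R. orthogonal_transformation R \<Longrightarrow> AE x in disk. v (R x) = v x"
  shows "AE x in disk. trace (H x) = circle_integral (\<lambda>x. trace (H x)) ((norm x)\<^sup>2) / pi"
    and "AE x in disk. tang H x = circle_integral (tang H) ((norm x)\<^sup>2) / pi"
    and "AE x in disk. perp x \<bullet> (H x *v x) = 0"
    and "AE x in disk. x \<bullet> (H x *v perp x) = 0"
proof -
  note [measurable] = borel_hessian_measurable[OF v]
  have form: "AE x in disk. \<forall>a b. a \<bullet> (H x *v b) = R a \<bullet> (H (R x) *v R b)"
    if R: "orthogonal_transformation R" for R
    using borel_hessian_orthogonal[OF v R inv[OF R]]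
    by eventually_elim (blast intro: bilinear_form_transform[OF orthogonal_transformation_linear[OF R]])
  \<comment> \<open>\<open>x\<close> and \<open>perp x\<close> are orthogonal of length |x|, so the
    trace is the sum of the two diagonal coefficients divided by |x|^2.\<close>
  have tr: "trace A = (x \<bullet> (A *v x) + perp x \<bullet> (A *v perp x)) / (norm x)\<^sup>2" if "x \<noteq> 0" for x :: "real^2" and A :: "real^2^2"
  proof -
    have "trace A * ((x $ 1)\<^sup>2 + (x $ 2)\<^sup>2) = x \<bullet> (A *v x) + perp x \<bullet> (A *v perp x)"
      by (simp add: trace_2 inner_vec_def matrix_vector_mult_def sum_2 power2_eq_square algebra_simps)
    then show ?thesis using that by (simp add: norm_2[symmetric] field_simps)
  qed
  show "AE x in disk. trace (H x) = circle_integral (\<lambda>x. trace (H x)) ((norm x)\<^sup>2) / pi"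
  proof (rule AE_radial_if_rotation_invariant)
    show "(\<lambda>x. trace (H x)) \<in> borel_measurable borel" by (rule trace_borel_hessian[OF v])
    fix z :: "real^2" assume z: "z \<noteq> 0"
    show "AE x in disk. trace (H (rot z x)) = trace (H x)"
      using form[OF orthogonal_rot[OF z]] AE_disk_nonzero
    proof eventually_elim
      case (elim x)
      have n: "norm (rot z x) = norm x" by (rule orthogonal_transformation_norm[OF orthogonal_rot[OF z]])
      then have "rot z x \<noteq> 0" using elim(2) by auto
      then show ?case
        unfolding tr[OF \<open>rot z x \<noteq> 0\<close>, of "H (rot z x)"] tr[OF elim(2), of "H x"] n perp_rot
        using elim(1) by simp
    qed
  qed
  show "AE x in disk. tang H x = circle_integral (tang H) ((norm x)\<^sup>2) / pi"
  proof (rule AE_radial_if_rotation_invariant)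
    show "tang H \<in> borel_measurable borel" by (rule tang_borel_hessian[OF v])
    fix z :: "real^2" assume z: "z \<noteq> 0"
    show "AE x in disk. tang H (rot z x) = tang H x"
      using form[OF orthogonal_rot[OF z]] by eventually_elim (simp add: tang_def perp_rot)
  qed
  have zero: "AE x in disk. u x = 0"
    if [measurable]: "u \<in> borel_measurable borel"
      and rot: "\<And>z. z \<noteq> 0 \<Longrightarrow> AE x in disk. u (rot z x) = u x"
      and refl: "AE x in disk. u (reflect x) = - u x" for u :: "real^2 \<Rightarrow> real"
  proof -
    \<comment> \<open>A radial function takes equal values at \<open>x\<close> and
      \<open>reflect x\<close>, so a change of sign under the reflection forces it to
      vanish.\<close>
    have rad: "AE x in disk. u x = circle_integral u ((norm x)\<^sup>2) / pi"
      by (rule AE_radial_if_rotation_invariant[OF that(1) rot])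
    have "AE x in disk. u (reflect x) = circle_integral u ((norm (reflect x))\<^sup>2) / pi"
      by (rule AE_disk_orthogonal[OF orthogonal_reflect rad])
    with rad refl show ?thesis
      by eventually_elim (simp add: orthogonal_transformation_norm[OF orthogonal_reflect])
  qed
  have m: "(\<lambda>x. perp x \<bullet> (H x *v x)) \<in> borel_measurable borel" "(\<lambda>x. x \<bullet> (H x *v perp x)) \<in> borel_measurable borel"
    unfolding inner_vec_def matrix_vector_mult_def sum_2 by simp_all measurable
  show "AE x in disk. perp x \<bullet> (H x *v x) = 0"
  proof (rule zero[OF m(1)])
    show "AE x in disk. perp (rot z x) \<bullet> (H (rot z x) *v rot z x) = perp x \<bullet> (H x *v x)" if "z \<noteq> 0" for z
      using form[OF orthogonal_rot[OF that]] by eventually_elim (simp add: perp_rot)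
    show "AE x in disk. perp (reflect x) \<bullet> (H (reflect x) *v reflect x) = - (perp x \<bullet> (H x *v x))"
      using form[OF orthogonal_reflect] by eventually_elim (simp add: perp_reflect)
  qed
  show "AE x in disk. x \<bullet> (H x *v perp x) = 0"
  proof (rule zero[OF m(2)])
    show "AE x in disk. rot z x \<bullet> (H (rot z x) *v perp (rot z x)) = x \<bullet> (H x *v perp x)" if "z \<noteq> 0" for z
      using form[OF orthogonal_rot[OF that]] by eventually_elim (simp add: perp_rot)
    show "AE x in disk. reflect x \<bullet> (H (reflect x) *v perp (reflect x)) = - (x \<bullet> (H x *v perp x))"
      using form[OF orthogonal_reflect]
      by eventually_elim (simp add: perp_reflect linear_neg[OF matrix_vector_mul_linear])
  qed
qed

section \<open>Stationarity\<close>

lemma cof_inner_expand: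
  "cof A \<bullet> C = A $ 2 $ 2 * C $ 1 $ 1 - A $ 2 $ 1 * C $ 1 $ 2 - A $ 1 $ 2 * C $ 2 $ 1 + A $ 1 $ 1 * C $ 2 $ 2"
  by (simp add: inner_matrix sum_2 cof_def)

text \<open>The two mixed coefficients differ by |x|^2 times the antisymmetric part of the
  matrix.\<close>

lemma symmetric_if_mixed_zero:
  fixes A :: "real^2^2"
  assumes "x \<noteq> 0" "perp x \<bullet> (A *v x) = 0" "x \<bullet> (A *v perp x) = 0"
  shows "A $ 1 $ 2 = A $ 2 $ 1"
proof -
  have "perp x \<bullet> (A *v x) - x \<bullet> (A *v perp x) = ((x $ 1)\<^sup>2 + (x $ 2)\<^sup>2) * (A $ 2 $ 1 - A $ 1 $ 2)"
    by (simp add: inner_vec_def matrix_vector_mult_def sum_2 power2_eq_square algebra_simps)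
  then show ?thesis using assms by (simp add: norm_2[symmetric])
qed

text \<open>For 2x2 matrices the cofactor matrix is the trace times the identity minus the
  transpose; symmetry replaces the transpose by \<open>A\<close>.\<close>

lemma inner_eq_trace_minus_cof:
  fixes A C :: "real^2^2"
  assumes "A $ 1 $ 2 = A $ 2 $ 1"
  shows "A \<bullet> C = trace A * trace C - cof A \<bullet> C"
  using assms unfolding cof_inner_expand by (simp add: inner_matrix sum_2 trace_2 algebra_simps)

text \<open>In the normalised frame \<open>H\<close> is diagonal, so the pairing is H_tt K_rr + H_rr
  K_tt with r radial and t tangential. Substituting trace minus tangential entry for both radial
  entries and multiplying by |x|^4 gives the formula.\<close>

lemma cof_inner_frame:
  assumes "x \<noteq> 0" "perp x \<bullet> (H x *v x) = 0" "x \<bullet> (H x *v perp x) = 0"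
  shows "((norm x)\<^sup>2)\<^sup>2 * (cof (H x) \<bullet> K x) =
    (norm x)\<^sup>2 * (tang H x * trace (K x) + trace (H x) * tang K x) - 2 * tang H x * tang K x"
proof -
  have sym: "H x $ 1 $ 2 = H x $ 2 $ 1" by (rule symmetric_if_mixed_zero[OF assms])
  define m where "m = H x $ 2 $ 1"
  \<comment> \<open>This is the vanishing mixed coefficient in coordinates; the claim is a
    polynomial identity modulo this relation.\<close>
  have o: "((x $ 1)\<^sup>2 - (x $ 2)\<^sup>2) * m + x $ 1 * x $ 2 * (H x $ 2 $ 2 - H x $ 1 $ 1) = 0"
    using assms(2) sym
    by (simp add: m_def inner_vec_def matrix_vector_mult_def sum_2 power2_eq_square algebra_simps)
  show ?thesis
    unfolding cof_inner_expand tang_expand trace_2 norm_2 sym m_def[symmetric]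
    using o by algebra
qed

text \<open>Each quotient is the tangential entry of a Hessian in a unit frame, hence dominated by
  the entries and square integrable. This is the bound that excludes a nonzero constant in m n = c
  s.\<close>

lemma integrable_tang_mult:
  assumes H: "borel_hessian v H" and K: "borel_hessian u K"
  shows "integrable disk (\<lambda>x. (tang H x / (norm x)\<^sup>2) * (tang K x / (norm x)\<^sup>2))"
proof -
  have bound: "\<bar>tang H x / (norm x)\<^sup>2\<bar> \<le> \<bar>H x $ 1 $ 1\<bar> + \<bar>H x $ 1 $ 2\<bar> + \<bar>H x $ 2 $ 1\<bar> + \<bar>H x $ 2 $ 2\<bar>" for H x
  proof (cases "x = 0")
    case False
    then have n: "0 < norm x" by simp
    define y where "y = (1 / norm x) *\<^sub>R x"
    have y: "\<bar>y $ i\<bar> \<le> 1" for i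
      using component_le_norm_cart[of y i] n by (simp add: y_def)
    have tri: "\<bar>a - b - c + d\<bar> \<le> \<bar>a\<bar> + \<bar>b\<bar> + \<bar>c\<bar> + \<bar>d\<bar>" for a b c d :: real
      by linarith
    have E: "tang H x / (norm x)\<^sup>2 = (y $ 2 * y $ 2) * H x $ 1 $ 1 - (y $ 1 * y $ 2) * H x $ 1 $ 2
       - (y $ 1 * y $ 2) * H x $ 2 $ 1 + (y $ 1 * y $ 1) * H x $ 2 $ 2"
      using n by (simp add: tang_expand y_def field_simps power2_eq_square)
    have "\<bar>tang H x / (norm x)\<^sup>2\<bar> \<le> \<bar>(y $ 2 * y $ 2) * H x $ 1 $ 1\<bar> + \<bar>(y $ 1 * y $ 2) * H x $ 1 $ 2\<bar>
       + \<bar>(y $ 1 * y $ 2) * H x $ 2 $ 1\<bar> + \<bar>(y $ 1 * y $ 1) * H x $ 2 $ 2\<bar>"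
      unfolding E by (rule tri)
    moreover have "\<bar>(y $ i * y $ j) * c\<bar> \<le> \<bar>c\<bar>" for i j c
    proof -
      have "\<bar>y $ i * y $ j\<bar> \<le> 1" unfolding abs_mult using y by (intro mult_le_one) auto
      then show ?thesis by (simp add: abs_mult[of "y $ i * y $ j"] mult_left_le_one_le)
    qed
    ultimately show ?thesis by (meson add_mono order_trans)
  qed simp
  define S where "S H x = (H x $ 1 $ 1)\<^sup>2 + (H x $ 1 $ 2)\<^sup>2 + (H x $ 2 $ 1)\<^sup>2 + (H x $ 2 $ 2)\<^sup>2"
    for H :: "real^2 \<Rightarrow> real^2^2" and x
  have S: "(tang H x / (norm x)\<^sup>2)\<^sup>2 \<le> 4 * S H x" for H x
  proof -
    have "(tang H x / (norm x)\<^sup>2)\<^sup>2 \<le> (\<bar>H x $ 1 $ 1\<bar> + \<bar>H x $ 1 $ 2\<bar> + \<bar>H x $ 2 $ 1\<bar> + \<bar>H x $ 2 $ 2\<bar>)\<^sup>2"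
      using bound[of H x] by (subst power2_abs[symmetric]) (intro power_mono, auto)
    also have "\<dots> \<le> 4 * (\<bar>H x $ 1 $ 1\<bar>\<^sup>2 + \<bar>H x $ 1 $ 2\<bar>\<^sup>2 + \<bar>H x $ 2 $ 1\<bar>\<^sup>2 + \<bar>H x $ 2 $ 2\<bar>\<^sup>2)"
    proof -
      \<comment> \<open>Cauchy-Schwarz for four terms; the gap is the sum of the squares of the six
        differences.\<close>
      have "(a + b + c + d)\<^sup>2 \<le> 4 * (a\<^sup>2 + b\<^sup>2 + c\<^sup>2 + d\<^sup>2)" for a b c d :: real
      proof -
        have "4 * (a\<^sup>2 + b\<^sup>2 + c\<^sup>2 + d\<^sup>2) - (a + b + c + d)\<^sup>2 =
          (a - b)\<^sup>2 + (a - c)\<^sup>2 + (a - d)\<^sup>2 + (b - c)\<^sup>2 + (b - d)\<^sup>2 + (c - d)\<^sup>2"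
          by (simp add: power2_eq_square algebra_simps)
        then show ?thesis by (smt (verit) zero_le_power2)
      qed
      then show ?thesis .
    qed
    finally show ?thesis by (simp add: S_def)
  qed
  have Si: "integrable disk (S H)" if "borel_hessian v H" for v H
    unfolding S_def using that by (intro Bochner_Integration.integrable_add) (auto simp: borel_hessian_def)
  \<comment> \<open>From \<open>2 * \<bar>a * b\<bar> \<le> a\<^sup>2 + b\<^sup>2\<close>, where
    each square is at most four times the sum of the squared entries.\<close>
  have int: "integrable disk (\<lambda>x. 2 * (S H x + S K x))"
    using Si[OF H] Si[OF K] by (intro integrable_mult_right Bochner_Integration.integrable_add) auto
  show ?thesis
  proof (rule Bochner_Integration.integrable_bound[OF int])
    note [measurable] = tang_borel_hessian(1)[OF H] tang_borel_hessian(1)[OF K]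
    show "(\<lambda>x. (tang H x / (norm x)\<^sup>2) * (tang K x / (norm x)\<^sup>2)) \<in> borel_measurable disk" by measurable
    have "norm ((tang H x / (norm x)\<^sup>2) * (tang K x / (norm x)\<^sup>2)) \<le> norm (2 * (S H x + S K x))" for x
    proof -
      define a b where "a = tang H x / (norm x)\<^sup>2" and "b = tang K x / (norm x)\<^sup>2"
      have "2 * \<bar>a * b\<bar> \<le> a\<^sup>2 + b\<^sup>2"
        using sum_squares_bound[of "\<bar>a\<bar>" "\<bar>b\<bar>"] by (simp add: abs_mult)
      also have "\<dots> \<le> 4 * S H x + 4 * S K x" using S[of H x] S[of K x] by (simp add: a_def b_def)
      finally show ?thesis by (simp add: a_def b_def)
    qed
    then show "AE x in disk. norm ((tang H x / (norm x)\<^sup>2) * (tang K x / (norm x)\<^sup>2)) \<le> norm (2 * (S H x + S K x))"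
      by simp
  qed
qed

text \<open>The witness replaces the trace of \<open>H\<close> by its radial form, so its circle
  integrals are h k / pi. Being Borel on the whole plane, it has the same integral over
  \<open>disk\<close> and over \<open>lebesgue_on B\<close>.\<close>

lemma integral_inner_hessians_zero:
  assumes H: "borel_hessian v H" and K: "borel_hessian u K"
    and inv: "\<And>R. orthogonal_transformation R \<Longrightarrow> AE x in disk. v (R x) = v x"
    and cof: "AE x in disk. cof (H x) \<bullet> K x = 0"
  shows "\<exists>g. g \<in> borel_measurable borel \<and> (AE x in disk. H x \<bullet> K x = g x) \<and> (\<integral>x. g x \<partial>disk) = 0"
proof -
  define h where "h = circle_integral (\<lambda>x. trace (H x))"
  define k where "k = circle_integral (\<lambda>x. trace (K x))"
  define p where "p = circle_integral (tang H)"
  define q where "q = circle_integral (tang K)"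
  have rad: "AE x in disk. trace (H x) = h ((norm x)\<^sup>2) / pi"
    "AE x in disk. tang H x = p ((norm x)\<^sup>2) / pi"
    "AE x in disk. perp x \<bullet> (H x *v x) = 0" "AE x in disk. x \<bullet> (H x *v perp x) = 0"
    unfolding h_def p_def using radial_borel_hessian[OF H] inv by blast+
  note [measurable] = trace_borel_hessian(1)[OF H] trace_borel_hessian(1)[OF K]
    tang_borel_hessian(1)[OF H] tang_borel_hessian(1)[OF K]
  have [measurable]: "h \<in> borel_measurable borel" "k \<in> borel_measurable borel"
     "p \<in> borel_measurable borel" "q \<in> borel_measurable borel"
    unfolding h_def k_def p_def q_def by measurable
  have hi: "integrable unit_interval h" and ki: "integrable unit_interval k"
    unfolding h_def k_def by (intro integrable_circle_integral trace_borel_hessian[OF H] trace_borel_hessian[OF K])+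
  have ph: "AE s in unit_interval. p s = primitive h s / 2"
    unfolding p_def h_def by (rule circle_integral_tang[OF H])
  have qk: "AE s in unit_interval. q s = primitive k s / 2"
    unfolding q_def k_def by (rule circle_integral_tang[OF K])
  have "AE x in disk. p ((norm x)\<^sup>2) * trace (K x)
      + (h ((norm x)\<^sup>2) - 2 * p ((norm x)\<^sup>2) / (norm x)\<^sup>2) * tang K x = 0"
    using rad cof AE_disk_nonzero
  proof eventually_elim
    case (elim x)
    define s where "s = (norm x)\<^sup>2"
    have s: "s > 0" using elim(6) by (simp add: s_def)
    define c where "c = 1 / pi"
    have T: "tang H x = c * p s" "trace (H x) = c * h s" using elim by (simp_all add: s_def c_def)
    have "s * (c * p s * trace (K x) + c * h s * tang K x) - 2 * (c * p s) * tang K x = 0"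
      using cof_inner_frame[where H=H and K=K, OF elim(6,3,4)] elim(5) unfolding s_def[symmetric] T by simp
    then have "c * (s * (p s * trace (K x) + h s * tang K x) - 2 * p s * tang K x) = 0"
      by (simp add: algebra_simps)
    then have "s * (p s * trace (K x) + h s * tang K x) - 2 * p s * tang K x = 0"
      by (simp add: c_def)
    then show ?case unfolding s_def[symmetric] using s by (simp add: field_simps)
  qed
  then have "AE s in unit_interval. AE y in disk. p ((norm (on_circle s y))\<^sup>2) * trace (K (on_circle s y))
      + (h ((norm (on_circle s y))\<^sup>2) - 2 * p ((norm (on_circle s y))\<^sup>2) / (norm (on_circle s y))\<^sup>2)
        * tang K (on_circle s y) = 0"
    by (rule AE_on_circle)
  \<comment> \<open>On a fixed circle the coefficients from \<open>H\<close> are constants, so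
    integrating over the circle replaces \<open>trace (K x)\<close> and \<open>tang K x\<close> by
    \<open>k s\<close> and \<open>q s\<close>.\<close>
  then have eq: "AE s in unit_interval. p s * k s + (h s - 2 * p s / s) * q s = 0"
    using AE_integrable_on_circle[OF trace_borel_hessian(2)[OF K]]
      AE_integrable_on_circle[OF tang_borel_hessian(2)[OF K]] AE_unit_intervalI
  proof eventually_elim
    case (elim s)
    let ?c = "h s - 2 * p s / s"
    have "AE y in disk. p s * trace (K (on_circle s y)) + ?c * tang K (on_circle s y) = 0"
      using elim(1) AE_disk_nonzero
    proof eventually_elim
      case (elim y)
      have "(norm (on_circle s y))\<^sup>2 = s" using elim(2) \<open>0 < s \<and> s < 1\<close> by (intro norm_on_circle) auto
      with elim(1) show ?case by simp
    qed
    then have "(\<integral>y. p s * trace (K (on_circle s y)) + ?c * tang K (on_circle s y) \<partial>disk) = 0"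
      by (rule integral_eq_zero_AE)
    moreover have "(\<integral>y. p s * trace (K (on_circle s y)) + ?c * tang K (on_circle s y) \<partial>disk) =
        p s * k s + ?c * q s"
      using elim(2,3) by (simp add: k_def q_def circle_integral_def)
    ultimately show ?case by simp
  qed
  \<comment> \<open>Insert p = m/2 and q = n/2 and multiply by 2.\<close>
  have ode: "AE s in unit_interval. primitive h s * k s + h s * primitive k s = primitive h s * primitive k s / s"
    using eq ph qk AE_unit_intervalI by eventually_elim (simp add: field_simps)
  have ti: "integrable disk (\<lambda>x. (p ((norm x)\<^sup>2) / ((norm x)\<^sup>2)\<^sup>2) * tang K x)"
  proof (rule integrable_cong_AE_imp[OF integrable_mult_right[OF integrable_tang_mult[OF H K], of pi]])
    show "AE x in disk. pi * (tang H x / (norm x)\<^sup>2 * (tang K x / (norm x)\<^sup>2)) = (p ((norm x)\<^sup>2) / ((norm x)\<^sup>2)\<^sup>2) * tang K x"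
      using rad(2) by eventually_elim (simp add: power2_eq_square)
  qed measurable
  have "integrable unit_interval (\<lambda>s. (p s / s\<^sup>2) * q s)"
    using integral_disk_radial_mult(1)[of "\<lambda>s. p s / s\<^sup>2", OF ti] by (simp add: q_def)
  \<comment> \<open>The 4 undoes the two halves in \<open>p\<close> and \<open>q\<close>; the factor
    \<open>pi\<close> above comes from the relation between \<open>tang H\<close> and its circle
    integral \<open>p\<close>.\<close>
  from integrable_mult_right[OF this, of 4]
  have "integrable unit_interval (\<lambda>s. primitive h s * primitive k s / s\<^sup>2)"
  proof (rule integrable_cong_AE_imp)
    note [measurable] = primitive_measurable[OF hi] primitive_measurable[OF ki]
    show "(\<lambda>s. primitive h s * primitive k s / s\<^sup>2) \<in> borel_measurable unit_interval" by measurable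
    show "AE s in unit_interval. 4 * ((p s / s\<^sup>2) * q s) = primitive h s * primitive k s / s\<^sup>2"
      using ph qk
    proof eventually_elim
      case (elim s)
      show ?case unfolding elim by simp
    qed
  qed
  from AE_mult_zero_if_product_ode[OF hi ki ode this]
  have hk: "AE s in unit_interval. h s * k s = 0" .
  define g where "g x = (h ((norm x)\<^sup>2) / pi) * trace (K x)" for x
  have [measurable]: "g \<in> borel_measurable borel" unfolding g_def by measurable
  have "(\<integral>x. g x \<partial>disk) = 0"
  \<comment> \<open>In the second case the Bochner integral has the default value 0.\<close>
  proof (cases "integrable disk g")
    case True
    then have "(\<integral>x. g x \<partial>disk) = (\<integral>s. (h s / pi) * k s \<partial>unit_interval)"
      unfolding g_def k_def by (intro integral_disk_radial_mult(2)) auto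
    also have "\<dots> = 0"
      by (rule integral_eq_zero_AE) (use hk in \<open>eventually_elim, simp\<close>)
    finally show ?thesis .
  qed (rule not_integrable_integral_eq)
  moreover have "AE x in disk. H x \<bullet> K x = g x"
    using rad cof AE_disk_nonzero
  proof eventually_elim
    case (elim x)
    then show ?case
      using inner_eq_trace_minus_cof[OF symmetric_if_mixed_zero[of x "H x", OF elim(6,3,4)], of "K x"]
      by (simp add: g_def)
  qed
  ultimately show ?thesis by (intro exI[of _ g]) auto
qed

theorem mainTheorem2:
  fixes V k :: "real^2 \<Rightarrow> real"
  assumes "V \<in> W22 B"
    and "radially_symmetric V"
    and "AE x in lebesgue_on B. k x = det (hess V x)"
  shows "formally_stationary k V"
  unfolding formally_stationary_def
proof (intro conjI ballI impI)
  show "V \<in> W22 B" by fact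
  show "AE x in lebesgue_on B. det (hess V x) = k x"
    using assms(3) by eventually_elim simp
  fix f assume f: "f \<in> W22 B" and cof: "AE x in lebesgue_on B. cof (hess V x) \<bullet> hess f x = 0"
  obtain v H where H: "borel_hessian v H" and v: "AE x in disk. V x = v x" and VH: "AE x in disk. hess V x = H x"
    using ex_borel_hessian[OF assms(1)] by blast
  obtain u K where K: "borel_hessian u K" and fK: "AE x in disk. hess f x = K x"
    using ex_borel_hessian[OF f] by blast
  obtain w where "AE x in disk. V x = w (norm x)"
    using assms(2) by (auto simp: radially_symmetric_def AE_lebesgue_on_B)
  with v have vw: "AE x in disk. v x = w (norm x)" by eventually_elim simp
  \<comment> \<open>\<open>V\<close> is a function of the norm only almost everywhere. Since
    \<open>R\<close> preserves null sets of the disk, that description is available at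
    \<open>x\<close> and at \<open>R x\<close> simultaneously.\<close>
  have inv: "AE x in disk. v (R x) = v x" if R: "orthogonal_transformation R" for R
    using AE_disk_orthogonal[OF R vw] vw
    by eventually_elim (simp add: orthogonal_transformation_norm[OF R])
  have "AE x in disk. cof (H x) \<bullet> K x = 0"
    using cof[unfolded AE_lebesgue_on_B] VH fK by eventually_elim simp
  then have "\<exists>g. g \<in> borel_measurable borel \<and> (AE x in disk. H x \<bullet> K x = g x) \<and> (\<integral>x. g x \<partial>disk) = 0"
    by (intro integral_inner_hessians_zero[OF H K] inv)
  then obtain g where g: "g \<in> borel_measurable borel" "AE x in disk. H x \<bullet> K x = g x" "(\<integral>x. g x \<partial>disk) = 0"
    by blast
  have eq: "AE x in lebesgue_on B. hess V x \<bullet> hess f x = g x"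
    unfolding AE_lebesgue_on_B using VH fK g(2) by eventually_elim simp
  show "(\<integral>x. hess V x \<bullet> hess f x \<partial>lebesgue_on B) = 0"
  proof (cases "integrable (lebesgue_on B) (\<lambda>x. hess V x \<bullet> hess f x)")
    case True
    have "(\<integral>x. hess V x \<bullet> hess f x \<partial>lebesgue_on B) = (\<integral>x. g x \<partial>lebesgue_on B)"
      using borel_measurable_integrable[OF True] borel_imp_measurable_on_B[OF g(1)] eq
      by (rule integral_cong_AE)
    also have "\<dots> = 0" using g by (simp add: integral_lebesgue_on_B)
    finally show ?thesis .
  qed (rule not_integrable_integral_eq)
qed

end
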